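(* Let $\mathbf{a}\in\mathfrak{A}_3$ with $a_{(12)}\neq a_{(13)}=a_{(23)}$. In the Verma module $M_e$ put $N_e=\mathcal{A}_{[\mathbf{a}]}\cdot\bigl(M_e[(13)(23)]\oplus M_e[(12)]\bigr)$. Let $v$ and $w$ stand for elements satisfying $M_e[(13)(23)]=\langle v,m_{(23)(12)}\rangle$ and $M_e[(12)]=\langle w,m_{(13)(12)(23)}\rangle$. The proper nonzero submodules of $M_e$ are exactly $$N_e,\quad \mathcal{A}_{[\mathbf{a}]}\cdot M_e[(13)(23)],\quad \mathcal{A}_{[\mathbf{a}]}\cdot M_e[(12)],\quad \mathcal{A}_{[\mathbf{a}]}\cdot v,\quad \mathcal{A}_{[\mathbf{a}]}\cdot\langle m_{(13)(12)(23)},m_{(23)(12)}\rangle,$$ $$\mathcal{A}_{[\mathbf{a}]}\cdot w,\quad \mathcal{A}_{[\mathbf{a}]}\cdot m_{(13)(12)(23)},\quad \mathcal{A}_{[\mathbf{a}]}\cdot m_{(23)(12)},\quad \langle m_{\mathrm{top}}\rangle,$$ where $v$ runs over all elements of $M_e[(13)(23)]$ with $M_e[(13)(23)]=\langle v,m_{(23)(12)}\rangle$ and $w$ runs over all elements of $M_e[(12)]$ with $M_e[(12)]=\langle w,m_{(13)(12)(23)}\rangle$. The Hasse diagram of this lattice is given by the following covering inclusions $X\supset Y$, where $X\overset{Q}{\supset}Y$ means in addition $X/Y\simeq Q$ (for every such $v$, $w$): - $N_e\overset{\Bbbk_{(12)}}{\supset}\mathcal{A}_{[\mathbf{a}]}\cdot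 M_e[(13)(23)]$ and $N_e\overset{L}{\supset}\mathcal{A}_{[\mathbf{a}]}\cdot M_e[(12)]$; - $\mathcal{A}_{[\mathbf{a}]}\cdot M_e[(13)(23)]\overset{L}{\supset}\mathcal{A}_{[\mathbf{a}]}\cdot v$ and $\mathcal{A}_{[\mathbf{a}]}\cdot M_e[(13)(23)]\overset{L}{\supset}\mathcal{A}_{[\mathbf{a}]}\cdot\langle m_{(13)(12)(23)},m_{(23)(12)}\rangle$; - $\mathcal{A}_{[\mathbf{a}]}\cdot M_e[(12)]\overset{\Bbbk_{(12)}}{\supset}\mathcal{A}_{[\mathbf{a}]}\cdot w$ and $\mathcal{A}_{[\mathbf{a}]}\cdot M_e[(12)]\overset{\Bbbk_{(12)}}{\supset}\mathcal{A}_{[\mathbf{a}]}\cdot\langle m_{(13)(12)(23)},m_{(23)(12)}\rangle$; - $\mathcal{A}_{[\mathbf{a}]}\cdot v\overset{L}{\supset}\mathcal{A}_{[\mathbf{a}]}\cdot m_{(13)(12)(23)}$ and $\mathcal{A}_{[\mathbf{a}]}\cdot w\overset{\Bbbk_{(12)}}{\supset}\mathcal{A}_{[\mathbf{a}]}\cdot m_{(23)(12)}$; - $\mathcal{A}_{[\mathbf{a}]}\cdot\langle m_{(13)(12)(23)},m_{(23)(12)}\rangle\overset{L}{\supset}\mathcal{A}_{[\mathbf{a}]}\cdot m_{(13)(12)(23)}$ and $\mathcal{A}_{[\mathbf{a}]}\cdot\langle m_{(13)(12)(23)},m_{(23)(12)}\rangle\overset{\Bbbk_{(12)}}{\supset}\mathcal{A}_{[\mathbf{a}]}\cdot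 m_{(23)(12)}$; - $\mathcal{A}_{[\mathbf{a}]}\cdot m_{(13)(12)(23)}\overset{\Bbbk_{(12)}}{\supset}\langle m_{\mathrm{top}}\rangle$ and $\mathcal{A}_{[\mathbf{a}]}\cdot m_{(23)(12)}\overset{L}{\supset}\langle m_{\mathrm{top}}\rangle$. The submodules $\mathcal{A}_{[\mathbf{a}]}\cdot v$ and $\mathcal{A}_{[\mathbf{a}]}\cdot v_1$ (resp. $\mathcal{A}_{[\mathbf{a}]}\cdot w$ and $\mathcal{A}_{[\mathbf{a}]}\cdot w_1$) coincide if and only if $v\in\langle v_1\rangle$ (resp. $w\in\langle w_1\rangle$), for $v,v_1$ with $M_e[(13)(23)]=\langle v,m_{(23)(12)}\rangle=\langle v_1,m_{(23)(12)}\rangle$ (resp. $w,w_1$ with $M_e[(12)]=\langle w,m_{(13)(12)(23)}\rangle=\langle w_1,m_{(13)(12)(23)}\rangle$).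
   Context: $\Bbbk$ is an algebraically closed field of characteristic $0$; $\langle S\rangle$ denotes the linear span of $S$. $\mathcal{O}_2^3=\{(12),(13),(23)\}\subset\mathbb{S}_3$; $\Bbbk^{\mathbb{S}_3}$ is the algebra of functions on $\mathbb{S}_3$ with basis the characteristic functions $\delta_g$ of $\{g\}$, $g\in\mathbb{S}_3$. $\mathfrak{A}_3=\{\mathbf{a}=(a_{(12)},a_{(13)},a_{(23)})\in\Bbbk^3: a_{(12)}+a_{(13)}+a_{(23)}=0\}$. For $\mathbf{a}\in\mathfrak{A}_3$ and $(ij)\in\mathcal{O}_2^3$ put $f_{ij}=\sum_{g\in\mathbb{S}_3}(a_{(ij)}-a_{g^{-1}(ij)g})\delta_g\in\Bbbk^{\mathbb{S}_3}$. $\mathcal{A}_{[\mathbf{a}]}$ is the algebra generated by $\Bbbk^{\mathbb{S}_3}$ and $x_{(12)},x_{(13)},x_{(23)}$ with relations $\delta_h x_{(ij)}=x_{(ij)}\delta_{(ij)h}$ ($h\in\mathbb{S}_3$), $x_{(ij)}^2=f_{ij}$, $x_{(13)}x_{(23)}+x_{(23)}x_{(12)}+x_{(12)}x_{(13)}=0$ and $x_{(23)}x_{(13)}+x_{(13)}x_{(12)}+x_{(12)}x_{(23)}=0$. (It is known to have dimension $72$ and to contain $\Bbbk^{\mathbb{S}_3}$ as a subalgebra.) Modules are left modules. For an $\mathcal{A}_{[\mathbf{a}]}$-module $M$ and $g\in\mathbb{S}_3$, $M[g]=\delta_g\cdot M$. The Verma module is $M_g=\mathcal{A}_{[\mathbf{a}]}\otimes_{\Bbbk^{\mathbb{S}_3}}\Bbbk_g$,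 where $\Bbbk_g$ is the one-dimensional $\Bbbk^{\mathbb{S}_3}$-module with $f\cdot 1=f(g)1$. In $M_g$ write $m_{(ij)\cdots(rs)}=x_{(ij)}\cdots x_{(rs)}\otimes 1$ and $m_{\mathrm{top}}=m_{(13)(12)(23)(12)}$. For a subspace $U$ of a module, $\mathcal{A}_{[\mathbf{a}]}\cdot U$ is the submodule it generates. Assume $a_{(12)}\neq a_{(13)}=a_{(23)}$. For $h\in\{e,(12)\}$, $\Bbbk_h$ also denotes the one-dimensional $\mathcal{A}_{[\mathbf{a}]}$-module on which every $x_{(ij)}$ acts by $0$ and $f\in\Bbbk^{\mathbb{S}_3}$ acts by $f(h)$. $L$ is the $\mathcal{A}_{[\mathbf{a}]}$-module with basis $\{v_{(13)},v_{(23)},v_{(13)(23)},v_{(23)(13)}\}$, $v_g\in L[g]$, and $x_{(ij)}\cdot v_g=0$ if $g=(ij)$; $x_{(ij)}\cdot v_g=v_{(ij)g}$ if $g\neq(ij)$ and $\operatorname{sgn} g=-1$; $x_{(ij)}\cdot v_g=f_{ij}(g)v_{(ij)g}$ if $\operatorname{sgn} g=1$ (read as $0$ when $(ij)g=(12)$, since then $f_{ij}(g)=0$). *)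

theory Defs
  imports
    "HOL-Algebra.QuotRing"
    "HOL-Algebra.Module"
    "HOL-Algebra.Free_Abelian_Groups"
    "HOL-Combinatorics.Perm"
    "HOL-Combinatorics.Permutations"
    "HOL-Library.Numeral_Type"
    "HOL-Computational_Algebra.Polynomial"
begin

section \<open>Free algebras\<close>

text \<open>Words form a monoid under concatenation, so that the convolution product of
  finitely supported functions on words is the product of the free algebra.\<close>

instantiation list :: (type) monoid_add
begin
definition zero_list :: "'a list" where "zero_list = []"
definition plus_list :: "'a list \<Rightarrow> 'a list \<Rightarrow> 'a list" where "plus_list = (@)"
instance by standard (simp_all add: zero_list_def plus_list_def)
end

definition free_algebra :: "'x set \<Rightarrow> ('x list \<Rightarrow>\<^sub>0 'k::comm_ring_1) ring" where
  "free_algebra G = \<lparr>carrier = {p. Poly_Mapping.keys p \<subseteq> lists G},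
     monoid.mult = (*), monoid.one = 1, ring.zero = 0, ring.add = (+)\<rparr>"

lemma ring_free_algebra: "ring (free_algebra G :: ('x list \<Rightarrow>\<^sub>0 'k::comm_ring_1) ring)"
proof (rule ringI)
  have k1: "Poly_Mapping.keys (p + q) \<subseteq> lists G"
    if "Poly_Mapping.keys p \<subseteq> lists G" "Poly_Mapping.keys q \<subseteq> lists G"
    for p q :: "'x list \<Rightarrow>\<^sub>0 'k"
    using that Poly_Mapping.keys_add[of p q] by blast
  have k2: "Poly_Mapping.keys (p * q) \<subseteq> lists G"
    if "Poly_Mapping.keys p \<subseteq> lists G" "Poly_Mapping.keys q \<subseteq> lists G"
    for p q :: "'x list \<Rightarrow>\<^sub>0 'k"
  proof
    fix w assume "w \<in> Poly_Mapping.keys (p * q)"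
    then obtain u v where "w = u + v" "u \<in> Poly_Mapping.keys p" "v \<in> Poly_Mapping.keys q"
      using keys_mult[of p q] by blast
    then show "w \<in> lists G" using that by (auto simp: plus_list_def)
  qed
  show "abelian_group (free_algebra G :: ('x list \<Rightarrow>\<^sub>0 'k) ring)"
  proof (rule abelian_groupI)
    fix x :: "'x list \<Rightarrow>\<^sub>0 'k" assume "x \<in> carrier (free_algebra G)"
    then show "\<exists>y\<in>carrier (free_algebra G). y \<oplus>\<^bsub>free_algebra G\<^esub> x = \<zero>\<^bsub>free_algebra G\<^esub>"
      by (intro bexI[of _ "- x"]) (auto simp: free_algebra_def)
  qed (auto simp: free_algebra_def algebra_simps dest: k1[THEN subsetD, rotated 2])
  show "Group.monoid (free_algebra G :: ('x list \<Rightarrow>\<^sub>0 'k) ring)"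
    by (rule Group.monoidI)
      (auto simp: free_algebra_def algebra_simps zero_list_def dest: k2[THEN subsetD, rotated 2])
qed (auto simp: free_algebra_def algebra_simps)

section \<open>Modules over a possibly noncommutative ring\<close>

text \<open>The record \<^typ>\<open>('a, 'b) module\<close> also has fields for a product and a unit, which are
  irrelevant for modules and are left undefined below. The predicate \<^const>\<open>submodule\<close> does not
  require commutativity of the ring, in contrast to the locale \<open>module\<close>.\<close>

definition left_module :: "('a, 'r) ring_scheme \<Rightarrow> ('a, 'b, 'm) module_scheme \<Rightarrow> bool" where
  "left_module R M \<longleftrightarrow> ring R \<and> abelian_group M \<and>
     (\<forall>r\<in>carrier R. \<forall>x\<in>carrier M. r \<odot>\<^bsub>M\<^esub> x \<in> carrier M) \<and>
     (\<forall>r\<in>carrier R. \<forall>s\<in>carrier R. \<forall>x\<in>carrier M.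
        (r \<oplus>\<^bsub>R\<^esub> s) \<odot>\<^bsub>M\<^esub> x = (r \<odot>\<^bsub>M\<^esub> x) \<oplus>\<^bsub>M\<^esub> (s \<odot>\<^bsub>M\<^esub> x)) \<and>
     (\<forall>r\<in>carrier R. \<forall>x\<in>carrier M. \<forall>y\<in>carrier M.
        r \<odot>\<^bsub>M\<^esub> (x \<oplus>\<^bsub>M\<^esub> y) = (r \<odot>\<^bsub>M\<^esub> x) \<oplus>\<^bsub>M\<^esub> (r \<odot>\<^bsub>M\<^esub> y)) \<and>
     (\<forall>r\<in>carrier R. \<forall>s\<in>carrier R. \<forall>x\<in>carrier M.
        (r \<otimes>\<^bsub>R\<^esub> s) \<odot>\<^bsub>M\<^esub> x = r \<odot>\<^bsub>M\<^esub> (s \<odot>\<^bsub>M\<^esub> x)) \<and>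
     (\<forall>x\<in>carrier M. \<one>\<^bsub>R\<^esub> \<odot>\<^bsub>M\<^esub> x = x)"

definition generated_submodule ::
    "('a, 'r) ring_scheme \<Rightarrow> ('a, 'b, 'm) module_scheme \<Rightarrow> 'b set \<Rightarrow> 'b set" where
  "generated_submodule R M U = \<Inter>{N. submodule N R M \<and> U \<subseteq> N}"

text \<open>\<open>X/Y\<close> for submodules \<open>Y \<subseteq> X\<close> of \<open>M\<close>, with cosets of \<open>Y\<close> as elements.\<close>

definition subquotient ::
    "('a, 'b, 'm) module_scheme \<Rightarrow> 'b set \<Rightarrow> 'b set \<Rightarrow> ('a, 'b set) module" where
  "subquotient M X Y = \<lparr>carrier = {Y +>\<^bsub>M\<^esub> x | x. x \<in> X}, monoid.mult = undefined, monoid.one = undefined,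
     ring.zero = Y, ring.add = set_add M, module.smult = (\<lambda>r C. \<Union>c\<in>C. Y +>\<^bsub>M\<^esub> (r \<odot>\<^bsub>M\<^esub> c))\<rparr>"

definition module_isomorphic ::
    "('a, 'r) ring_scheme \<Rightarrow> ('a, 'b, 'm) module_scheme \<Rightarrow> ('a, 'c, 'n) module_scheme \<Rightarrow> bool" where
  "module_isomorphic R M N \<longleftrightarrow> (\<exists>\<phi>. bij_betw \<phi> (carrier M) (carrier N) \<and>
     (\<forall>x\<in>carrier M. \<forall>y\<in>carrier M. \<phi> (x \<oplus>\<^bsub>M\<^esub> y) = \<phi> x \<oplus>\<^bsub>N\<^esub> \<phi> y) \<and>
     (\<forall>r\<in>carrier R. \<forall>x\<in>carrier M. \<phi> (r \<odot>\<^bsub>M\<^esub> x) = r \<odot>\<^bsub>N\<^esub> \<phi> x))"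

text \<open>\<open>A \<otimes>\<^sub>B N\<close>, where \<open>A\<close> is a right \<open>B\<close>-module through the ring homomorphism \<open>\<phi>\<close> from \<open>B\<close> to
  \<open>A\<close>: the free abelian group on \<open>A \<times> N\<close> modulo biadditivity and \<open>(r \<phi>(b), n) = (r, b n)\<close>,
  on which \<open>A\<close> acts by left multiplication on the first factor.\<close>

definition tensor_relators :: "('a, 'r) ring_scheme \<Rightarrow> ('b, 's) ring_scheme \<Rightarrow> ('b \<Rightarrow> 'a) \<Rightarrow>
    ('b, 'n, 'm) module_scheme \<Rightarrow> ('a \<times> 'n \<Rightarrow>\<^sub>0 int) set" where
  "tensor_relators A B \<phi> N =
     {frag_of (r \<oplus>\<^bsub>A\<^esub> s, n) - frag_of (r, n) - frag_of (s, n) | r s n.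
        r \<in> carrier A \<and> s \<in> carrier A \<and> n \<in> carrier N} \<union>
     {frag_of (r, n \<oplus>\<^bsub>N\<^esub> n') - frag_of (r, n) - frag_of (r, n') | r n n'.
        r \<in> carrier A \<and> n \<in> carrier N \<and> n' \<in> carrier N} \<union>
     {frag_of (r \<otimes>\<^bsub>A\<^esub> \<phi> b, n) - frag_of (r, b \<odot>\<^bsub>N\<^esub> n) | r b n.
        r \<in> carrier A \<and> b \<in> carrier B \<and> n \<in> carrier N}"

definition tensor_kernel :: "('a, 'r) ring_scheme \<Rightarrow> ('b, 's) ring_scheme \<Rightarrow> ('b \<Rightarrow> 'a) \<Rightarrow>
    ('b, 'n, 'm) module_scheme \<Rightarrow> ('a \<times> 'n \<Rightarrow>\<^sub>0 int) set" where
  "tensor_kernel A B \<phi> N =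
     generate (free_Abelian_group (carrier A \<times> carrier N)) (tensor_relators A B \<phi> N)"

definition pure_tensor :: "('a, 'r) ring_scheme \<Rightarrow> ('b, 's) ring_scheme \<Rightarrow> ('b \<Rightarrow> 'a) \<Rightarrow>
    ('b, 'n, 'm) module_scheme \<Rightarrow> 'a \<Rightarrow> 'n \<Rightarrow> ('a \<times> 'n \<Rightarrow>\<^sub>0 int) set" where
  "pure_tensor A B \<phi> N r n =
     tensor_kernel A B \<phi> N #>\<^bsub>free_Abelian_group (carrier A \<times> carrier N)\<^esub> frag_of (r, n)"

definition induced_module :: "('a, 'r) ring_scheme \<Rightarrow> ('b, 's) ring_scheme \<Rightarrow> ('b \<Rightarrow> 'a) \<Rightarrow>
    ('b, 'n, 'm) module_scheme \<Rightarrow> ('a, ('a \<times> 'n \<Rightarrow>\<^sub>0 int) set) module" where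
  "induced_module A B \<phi> N =
     (let F = free_Abelian_group (carrier A \<times> carrier N);
          K = tensor_kernel A B \<phi> N;
          T = F Mod K
      in \<lparr>carrier = carrier T, monoid.mult = undefined, monoid.one = undefined,
          ring.zero = monoid.one T, ring.add = monoid.mult T,
          module.smult = (\<lambda>r C. \<Union>c\<in>C. K #>\<^bsub>F\<^esub> frag_extend (\<lambda>(s, n). frag_of (r \<otimes>\<^bsub>A\<^esub> s, n)) c)\<rparr>)"

section \<open>The symmetric group and its function algebra\<close>

text \<open>The three letters are the elements of the type \<^typ>\<open>3\<close>; there \<open>3 = 0\<close>.\<close>

type_synonym S3 = "3 perm"

abbreviation t12 :: S3 where "t12 \<equiv> Perm.swap 1 2"
abbreviation t13 :: S3 where "t13 \<equiv> Perm.swap 1 3"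
abbreviation t23 :: S3 where "t23 \<equiv> Perm.swap 2 3"

definition O23 :: "S3 set" where "O23 = {t12, t13, t23}"

definition sgn_S3 :: "S3 \<Rightarrow> int" where "sgn_S3 g = sign (Perm.apply g)"

definition fun_S3 :: "(S3 \<Rightarrow> 'k::field) ring" where
  "fun_S3 = \<lparr>carrier = UNIV, monoid.mult = (\<lambda>f f' g. f g * f' g), monoid.one = (\<lambda>_. 1),
     ring.zero = (\<lambda>_. 0), ring.add = (\<lambda>f f' g. f g + f' g)\<rparr>"

text \<open>The one-dimensional \<^const>\<open>fun_S3\<close>-module given by evaluation at \<open>g\<close>.\<close>

definition fun_point :: "S3 \<Rightarrow> (S3 \<Rightarrow> 'k::field, 'k) module" where
  "fun_point g = \<lparr>carrier = UNIV, monoid.mult = undefined, monoid.one = undefined,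
     ring.zero = 0, ring.add = (+), module.smult = (\<lambda>f c. f g * c)\<rparr>"

section \<open>The algebra\<close>

text \<open>A parameter is a function on all of \<^typ>\<open>S3\<close>, of which only the values on \<^const>\<open>O23\<close>
  are ever used.\<close>

definition param_space :: "(S3 \<Rightarrow> 'k::field) set" where
  "param_space = {a. a t12 + a t13 + a t23 = 0}"

definition f_fun :: "(S3 \<Rightarrow> 'k::field) \<Rightarrow> S3 \<Rightarrow> S3 \<Rightarrow> 'k" where
  "f_fun a t = (\<lambda>g. a t - a (inverse g * t * g))"

datatype gen = Dl S3 | X S3

definition gens :: "gen set" where "gens = range Dl \<union> X ` O23"

abbreviation word :: "gen list \<Rightarrow> (gen list \<Rightarrow>\<^sub>0 'k::field)" where
  "word w \<equiv> Poly_Mapping.single w 1"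

text \<open>The element \<open>\<Sum>\<^sub>g f(g) \<delta>\<^sub>g\<close> of the free algebra.\<close>

definition free_of_fun :: "(S3 \<Rightarrow> 'k::field) \<Rightarrow> (gen list \<Rightarrow>\<^sub>0 'k)" where
  "free_of_fun f = (\<Sum>g\<in>UNIV. Poly_Mapping.single [Dl g] (f g))"

text \<open>The first two families present the function algebra on \<open>S3\<close>.\<close>

definition relators :: "(S3 \<Rightarrow> 'k::field) \<Rightarrow> (gen list \<Rightarrow>\<^sub>0 'k) set" where
  "relators a =
     {word [Dl g, Dl h] - (if g = h then word [Dl g] else 0) | g h. True} \<union>
     {free_of_fun (\<lambda>_. 1) - 1} \<union>
     {word [Dl h, X t] - word [X t, Dl (t * h)] | h t. t \<in> O23} \<union>
     {word [X t, X t] - free_of_fun (f_fun a t) | t. t \<in> O23} \<union>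
     {word [X t13, X t23] + word [X t23, X t12] + word [X t12, X t13],
      word [X t23, X t13] + word [X t13, X t12] + word [X t12, X t23]}"

definition rel_ideal :: "(S3 \<Rightarrow> 'k::field) \<Rightarrow> (gen list \<Rightarrow>\<^sub>0 'k) set" where
  "rel_ideal a = Idl\<^bsub>free_algebra gens\<^esub> (relators a)"

definition alg :: "(S3 \<Rightarrow> 'k::field) \<Rightarrow> (gen list \<Rightarrow>\<^sub>0 'k) set ring" where
  "alg a = free_algebra gens Quot rel_ideal a"

definition alg_class :: "(S3 \<Rightarrow> 'k::field) \<Rightarrow> (gen list \<Rightarrow>\<^sub>0 'k) \<Rightarrow> (gen list \<Rightarrow>\<^sub>0 'k) set" where
  "alg_class a p = rel_ideal a +>\<^bsub>free_algebra gens\<^esub> p"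

definition scalar :: "(S3 \<Rightarrow> 'k::field) \<Rightarrow> 'k \<Rightarrow> (gen list \<Rightarrow>\<^sub>0 'k) set" where
  "scalar a c = alg_class a (Poly_Mapping.single [] c)"

definition alg_of_fun :: "(S3 \<Rightarrow> 'k::field) \<Rightarrow> (S3 \<Rightarrow> 'k) \<Rightarrow> (gen list \<Rightarrow>\<^sub>0 'k) set" where
  "alg_of_fun a f = alg_class a (free_of_fun f)"

definition delta :: "(S3 \<Rightarrow> 'k::field) \<Rightarrow> S3 \<Rightarrow> (gen list \<Rightarrow>\<^sub>0 'k) set" where
  "delta a g = alg_class a (word [Dl g])"

definition x_gen :: "(S3 \<Rightarrow> 'k::field) \<Rightarrow> S3 \<Rightarrow> (gen list \<Rightarrow>\<^sub>0 'k) set" where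
  "x_gen a t = alg_class a (word [X t])"

section \<open>Modules over the algebra\<close>

definition linear_span :: "(S3 \<Rightarrow> 'k::field) \<Rightarrow>
    ((gen list \<Rightarrow>\<^sub>0 'k) set, 'b, 'm) module_scheme \<Rightarrow> 'b set \<Rightarrow> 'b set" where
  "linear_span a M S = \<Inter>{V. subgroup V (add_monoid M) \<and>
     (\<forall>c. \<forall>x\<in>V. scalar a c \<odot>\<^bsub>M\<^esub> x \<in> V) \<and> S \<subseteq> V}"

definition weight_space :: "(S3 \<Rightarrow> 'k::field) \<Rightarrow>
    ((gen list \<Rightarrow>\<^sub>0 'k) set, 'b, 'm) module_scheme \<Rightarrow> S3 \<Rightarrow> 'b set" where
  "weight_space a M g = {delta a g \<odot>\<^bsub>M\<^esub> x | x. x \<in> carrier M}"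

definition verma :: "(S3 \<Rightarrow> 'k::field) \<Rightarrow> S3 \<Rightarrow>
    ((gen list \<Rightarrow>\<^sub>0 'k) set, ((gen list \<Rightarrow>\<^sub>0 'k) set \<times> 'k \<Rightarrow>\<^sub>0 int) set) module" where
  "verma a g = induced_module (alg a) fun_S3 (alg_of_fun a) (fun_point g)"

text \<open>\<open>verma_vec a g [s, \<dots>, t]\<close> is \<open>x\<^sub>s \<cdots> x\<^sub>t \<otimes> 1\<close> in \<open>verma a g\<close>.\<close>

definition verma_vec :: "(S3 \<Rightarrow> 'k::field) \<Rightarrow> S3 \<Rightarrow> S3 list \<Rightarrow>
    ((gen list \<Rightarrow>\<^sub>0 'k) set \<times> 'k \<Rightarrow>\<^sub>0 int) set" where
  "verma_vec a g ts = pure_tensor (alg a) fun_S3 (alg_of_fun a) (fun_point g)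
     (foldr (\<lambda>t r. x_gen a t \<otimes>\<^bsub>alg a\<^esub> r) ts \<one>\<^bsub>alg a\<^esub>) 1"

text \<open>The modules with a basis of vectors \<open>v\<^sub>g\<close> of weight \<open>g\<close>, for \<open>g\<close> in \<open>B\<close>, on which \<open>x\<^sub>t\<close> maps
  \<open>v\<^sub>g\<close> to \<open>c t g\<close> times \<open>v\<close> of index \<open>t g\<close>. Vectors are their coordinate functions, extended by 0
  outside \<open>B\<close>. A class in the algebra acts through its representatives in the free algebra,
  which presupposes that the relators act by 0; this is verified in the last section.\<close>

fun gen_act :: "(S3 \<Rightarrow> S3 \<Rightarrow> 'k::field) \<Rightarrow> gen \<Rightarrow> (S3 \<Rightarrow> 'k) \<Rightarrow> (S3 \<Rightarrow> 'k)" where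
  "gen_act c (Dl g) u = (\<lambda>h. if h = g then u h else 0)"
| "gen_act c (X t) u = (\<lambda>h. \<Sum>g\<in>{g. t * g = h}. u g * c t g)"

definition free_act :: "(S3 \<Rightarrow> S3 \<Rightarrow> 'k::field) \<Rightarrow> (gen list \<Rightarrow>\<^sub>0 'k) \<Rightarrow> (S3 \<Rightarrow> 'k) \<Rightarrow> (S3 \<Rightarrow> 'k)" where
  "free_act c p u = (\<lambda>h. \<Sum>w\<in>Poly_Mapping.keys p. Poly_Mapping.lookup p w * foldr (gen_act c) w u h)"

definition weight_basis_module :: "S3 set \<Rightarrow> (S3 \<Rightarrow> S3 \<Rightarrow> 'k::field) \<Rightarrow>
    ((gen list \<Rightarrow>\<^sub>0 'k) set, S3 \<Rightarrow> 'k) module" where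
  "weight_basis_module B c = \<lparr>carrier = {u. \<forall>g. g \<notin> B \<longrightarrow> u g = 0},
     monoid.mult = undefined, monoid.one = undefined, ring.zero = (\<lambda>_. 0), ring.add = (\<lambda>u u' g. u g + u' g),
     module.smult = (\<lambda>C u. the_elem ((\<lambda>p. free_act c p u) ` C))\<rparr>"

definition k_module :: "S3 \<Rightarrow> ((gen list \<Rightarrow>\<^sub>0 'k::field) set, S3 \<Rightarrow> 'k) module" where
  "k_module h = weight_basis_module {h} (\<lambda>t g. 0)"

definition L_module :: "(S3 \<Rightarrow> 'k::field) \<Rightarrow> ((gen list \<Rightarrow>\<^sub>0 'k) set, S3 \<Rightarrow> 'k) module" where
  "L_module a = weight_basis_module {t13, t23, t13 * t23, t23 * t13}
     (\<lambda>t g. if g = t then 0 else if sgn_S3 g = -1 then 1 else f_fun a t g)"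

section \<open>Hasse diagrams\<close>

definition covering_pairs :: "'b set set \<Rightarrow> ('b set \<times> 'b set) set" where
  "covering_pairs S = {(X, Y). X \<in> S \<and> Y \<in> S \<and> Y \<subset> X \<and> \<not> (\<exists>Z\<in>S. Y \<subset> Z \<and> Z \<subset> X)}"

section \<open>The modules above are modules\<close>

lemma left_module_induced_module:
  assumes A: "ring A" and \<phi>: "\<And>b. b \<in> carrier B \<Longrightarrow> \<phi> b \<in> carrier A"
    and N: "\<And>n n'. n \<in> carrier N \<Longrightarrow> n' \<in> carrier N \<Longrightarrow> n \<oplus>\<^bsub>N\<^esub> n' \<in> carrier N"
    and NB: "\<And>b n. b \<in> carrier B \<Longrightarrow> n \<in> carrier N \<Longrightarrow> b \<odot>\<^bsub>N\<^esub> n \<in> carrier N"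
  shows "left_module A (induced_module A B \<phi> N)"
proof -
  interpret A: ring A by (rule A)
  define F where "F = free_Abelian_group (carrier A \<times> carrier N)"
  define K where "K = tensor_kernel A B \<phi> N"
  define R where "R = tensor_relators A B \<phi> N"
  define E where "E r = frag_extend (\<lambda>(s, n::'e). frag_of (r \<otimes>\<^bsub>A\<^esub> s, n))" for r
  interpret F: comm_group F by (simp add: F_def abelian_free_Abelian_group)
  have K_gen: "K = generate F R" by (simp add: K_def F_def R_def tensor_kernel_def)
  have cF: "x \<in> carrier F \<longleftrightarrow> Poly_Mapping.keys x \<subseteq> carrier A \<times> carrier N" for x
    by (simp add: F_def)
  have multF [simp]: "x \<otimes>\<^bsub>F\<^esub> y = x + y" for x y by (simp add: F_def)
  have oneF [simp]: "\<one>\<^bsub>F\<^esub> = 0" by (simp add: F_def)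
  have addF: "x + y \<in> carrier F" if "x \<in> carrier F" "y \<in> carrier F" for x y
    using F.m_closed[OF that] by simp
  have minF: "- x \<in> carrier F" if "x \<in> carrier F" for x
    using that by (simp add: cF)
  have diffF: "x - y \<in> carrier F" if "x \<in> carrier F" "y \<in> carrier F" for x y
    using addF[OF that(1) minF[OF that(2)]] by simp
  have fragF: "frag_of (r, n) \<in> carrier F \<longleftrightarrow> r \<in> carrier A \<and> n \<in> carrier N" for r n
    by (simp add: F_def)
  have RF: "R \<subseteq> carrier F"
    unfolding R_def tensor_relators_def
    by (auto intro!: diffF simp: fragF \<phi> N NB)
  have K: "subgroup K F" unfolding K_gen by (rule F.generate_is_subgroup[OF RF])
  then interpret K: normal K F by (rule F.subgroup_imp_normal)
  interpret T: comm_group "F Mod K" by (rule F.abelian_FactGroup[OF K])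
  have E_add: "E r (x + y) = E r x + E r y" for r x y by (simp add: E_def frag_extend_add)
  have E_diff: "E r (x - y) = E r x - E r y" for r x y by (simp add: E_def frag_extend_diff)
  have E_min: "E r (- x) = - E r x" for r x by (simp add: E_def frag_extend_minus)
  have E_of: "E r (frag_of (s, n)) = frag_of (r \<otimes>\<^bsub>A\<^esub> s, n)" for r s n by (simp add: E_def)
  have E_zero [simp]: "E r 0 = 0" for r by (simp add: E_def)
  have F_ind: "P x" if "x \<in> carrier F" "P 0" "\<And>r n. r \<in> carrier A \<Longrightarrow> n \<in> carrier N \<Longrightarrow> P (frag_of (r, n))"
    "\<And>x y. x \<in> carrier F \<Longrightarrow> y \<in> carrier F \<Longrightarrow> P x \<Longrightarrow> P y \<Longrightarrow> P (x - y)" for P x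
  proof -
    have "P x \<and> x \<in> carrier F"
    proof (rule frag_induction[of x "carrier A \<times> carrier N"])
      show "Poly_Mapping.keys x \<subseteq> carrier A \<times> carrier N" using that(1) by (simp add: cF)
    qed (use that in \<open>auto intro: diffF simp: fragF F.one_closed[simplified]\<close>)
    then show ?thesis by simp
  qed
  have EF: "E r x \<in> carrier F" if "r \<in> carrier A" "x \<in> carrier F" for r x
    using that(2)
    by (rule F_ind) (use that(1) F.one_closed in \<open>auto simp: E_diff E_of fragF intro: diffF\<close>)
  have ER: "E r x \<in> R" if r: "r \<in> carrier A" and x: "x \<in> R" for r x
  proof -
    from x consider (a) s t n where "x = frag_of (s \<oplus>\<^bsub>A\<^esub> t, n) - frag_of (s, n) - frag_of (t, n)"
        "s \<in> carrier A" "t \<in> carrier A" "n \<in> carrier N"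
      | (b) s n n' where "x = frag_of (s, n \<oplus>\<^bsub>N\<^esub> n') - frag_of (s, n) - frag_of (s, n')"
        "s \<in> carrier A" "n \<in> carrier N" "n' \<in> carrier N"
      | (c) s b n where "x = frag_of (s \<otimes>\<^bsub>A\<^esub> \<phi> b, n) - frag_of (s, b \<odot>\<^bsub>N\<^esub> n)"
        "s \<in> carrier A" "b \<in> carrier B" "n \<in> carrier N"
      unfolding R_def tensor_relators_def by blast
    then show ?thesis
    proof cases
      case a
      then have "E r x = frag_of ((r \<otimes>\<^bsub>A\<^esub> s) \<oplus>\<^bsub>A\<^esub> (r \<otimes>\<^bsub>A\<^esub> t), n) - frag_of (r \<otimes>\<^bsub>A\<^esub> s, n) - frag_of (r \<otimes>\<^bsub>A\<^esub> t, n)"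
        by (simp add: E_diff E_of A.r_distr r)
      then show ?thesis unfolding R_def tensor_relators_def using a r A.m_closed by blast
    next
      case b
      then show ?thesis unfolding R_def tensor_relators_def using r A.m_closed
        by (simp add: E_diff E_of) blast
    next
      case c
      then have "E r x = frag_of ((r \<otimes>\<^bsub>A\<^esub> s) \<otimes>\<^bsub>A\<^esub> \<phi> b, n) - frag_of (r \<otimes>\<^bsub>A\<^esub> s, b \<odot>\<^bsub>N\<^esub> n)"
        by (simp add: E_diff E_of A.m_assoc r \<phi>)
      then show ?thesis unfolding R_def tensor_relators_def using c r A.m_closed by blast
    qed
  qed
  have EK: "E r x \<in> K" if r: "r \<in> carrier A" and x: "x \<in> K" for r x
    using x unfolding K_gen
  proof (induction x rule: generate.induct)
    case one show ?case using generate.one[of F R] by simp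
  next
    case (incl h) then show ?case by (intro generate.incl ER r)
  next
    case (inv h)
    then have "E r h \<in> R" "h \<in> carrier F" using ER r RF by auto
    then have "E r (inv\<^bsub>F\<^esub> h) = inv\<^bsub>F\<^esub> (E r h)" using RF
      by (simp add: F_def E_min subset_iff cF[unfolded F_def])
    then show ?case using \<open>E r h \<in> R\<close> by (simp add: generate.inv)
  next
    case (eng g h) then show ?case using generate.eng[of _ F R] by (simp add: E_add)
  qed
  have coset_eq: "K #>\<^bsub>F\<^esub> x = K #>\<^bsub>F\<^esub> y" if "x \<in> carrier F" "y \<in> carrier F" "x - y \<in> K" for x y
  proof -
    have "x = (x - y) \<otimes>\<^bsub>F\<^esub> y" by simp
    then have "x \<in> K #>\<^bsub>F\<^esub> y" using that unfolding r_coset_def by blast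
    then show ?thesis using F.repr_independence[OF _ that(2) K] by simp
  qed
  have inK: "y - x \<in> K" if "y \<in> K #>\<^bsub>F\<^esub> x" for x y
    using that by (auto simp: r_coset_def)
  define M where "M = induced_module A B \<phi> N"
  have car: "carrier M = {K #>\<^bsub>F\<^esub> x | x. x \<in> carrier F}"
    by (auto simp: M_def induced_module_def Let_def K_def F_def FactGroup_def RCOSETS_def)
  have sm: "r \<odot>\<^bsub>M\<^esub> (K #>\<^bsub>F\<^esub> x) = K #>\<^bsub>F\<^esub> E r x" if r: "r \<in> carrier A" and x: "x \<in> carrier F" for r x
  proof -
    have "r \<odot>\<^bsub>M\<^esub> (K #>\<^bsub>F\<^esub> x) = (\<Union>c\<in>K #>\<^bsub>F\<^esub> x. K #>\<^bsub>F\<^esub> E r c)"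
      by (simp add: M_def induced_module_def Let_def K_def F_def E_def)
    also have "\<dots> = (\<Union>c\<in>K #>\<^bsub>F\<^esub> x. K #>\<^bsub>F\<^esub> E r x)"
    proof (rule SUP_cong)
      fix c assume c: "c \<in> K #>\<^bsub>F\<^esub> x"
      have "c \<in> carrier F" using F.r_coset_subset_G[OF K.subset x] c by blast
      then show "K #>\<^bsub>F\<^esub> E r c = K #>\<^bsub>F\<^esub> E r x"
        using EK[OF r inK[OF c]] by (intro coset_eq EF r x) (simp_all add: E_diff)
    qed simp
    also have "\<dots> = K #>\<^bsub>F\<^esub> E r x" using F.rcos_self[OF x K] by auto
    finally show ?thesis .
  qed
  have ad: "(K #>\<^bsub>F\<^esub> x) \<oplus>\<^bsub>M\<^esub> (K #>\<^bsub>F\<^esub> y) = K #>\<^bsub>F\<^esub> (x + y)" if "x \<in> carrier F" "y \<in> carrier F" for x y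
    using K.rcos_sum[OF that] by (simp add: M_def induced_module_def Let_def K_def F_def FactGroup_def)
  have ab: "abelian_group M"
    by (rule abelian_groupI)
      (use T.m_closed T.one_closed T.m_assoc T.m_comm T.l_one T.l_inv_ex
        in \<open>simp_all add: M_def induced_module_def Let_def K_def F_def\<close>)
  have E1: "K #>\<^bsub>F\<^esub> E (r \<oplus>\<^bsub>A\<^esub> s) x = K #>\<^bsub>F\<^esub> (E r x + E s x)" if "r \<in> carrier A" "s \<in> carrier A" "x \<in> carrier F" for r s x
  proof (rule coset_eq)
    show "E (r \<oplus>\<^bsub>A\<^esub> s) x - (E r x + E s x) \<in> K" using that(3)
    proof (rule F_ind)
      show "E (r \<oplus>\<^bsub>A\<^esub> s) 0 - (E r 0 + E s 0) \<in> K" using K.one_closed by simp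
      fix t n assume tn: "t \<in> carrier A" "n \<in> carrier N"
      have "frag_of ((r \<otimes>\<^bsub>A\<^esub> t) \<oplus>\<^bsub>A\<^esub> (s \<otimes>\<^bsub>A\<^esub> t), n) - frag_of (r \<otimes>\<^bsub>A\<^esub> t, n) - frag_of (s \<otimes>\<^bsub>A\<^esub> t, n) \<in> R"
        unfolding R_def tensor_relators_def using that tn A.m_closed by blast
      then show "E (r \<oplus>\<^bsub>A\<^esub> s) (frag_of (t, n)) - (E r (frag_of (t, n)) + E s (frag_of (t, n))) \<in> K"
        unfolding K_gen using that tn by (simp add: E_of A.l_distr generate.incl diff_diff_eq)
    next
      fix x y assume xy: "E (r \<oplus>\<^bsub>A\<^esub> s) x - (E r x + E s x) \<in> K" (is "?x \<in> K")
        "E (r \<oplus>\<^bsub>A\<^esub> s) y - (E r y + E s y) \<in> K"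
        (is "?y \<in> K")
      have "?y \<in> carrier F" using xy K.subset by blast
      then have "inv\<^bsub>F\<^esub> ?y = - ?y" by (simp add: F_def cF[unfolded F_def])
      then have "?x + - ?y \<in> K" using K.m_closed[OF xy(1) K.m_inv_closed[OF xy(2)]] by simp
      then show "E (r \<oplus>\<^bsub>A\<^esub> s) (x - y) - (E r (x - y) + E s (x - y)) \<in> K"
        by (simp add: E_diff algebra_simps)
    qed
  qed (use that in \<open>auto intro: EF addF\<close>)
  have E2: "E (r \<otimes>\<^bsub>A\<^esub> s) x = E r (E s x)" if "r \<in> carrier A" "s \<in> carrier A" "x \<in> carrier F" for r s x
    using that(3) by (rule F_ind) (use that in \<open>auto simp: E_of E_diff A.m_assoc\<close>)
  have E3: "E \<one>\<^bsub>A\<^esub> x = x" if "x \<in> carrier F" for x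
    using that by (rule F_ind) (auto simp: E_of E_diff)
  show ?thesis
    unfolding M_def[symmetric] left_module_def
    using A ab by (auto simp: car sm ad EF addF E_add E1 E2 E3)
qed

lemma keys_free_algebra_iff: "p \<in> carrier (free_algebra G) \<longleftrightarrow> Poly_Mapping.keys p \<subseteq> lists G"
  by (simp add: free_algebra_def)

lemma gen_act_add: "gen_act c x (\<lambda>h. u h + v h) = (\<lambda>h. gen_act c x u h + gen_act c x v h)"
  by (cases x) (auto simp: distrib_right sum.distrib)

lemma gen_act_scale: "gen_act c x (\<lambda>h. r * u h) = (\<lambda>h. r * gen_act c x u h)"
  by (cases x) (auto simp: sum_distrib_left mult.assoc)

lemma word_act_add:
  "foldr (gen_act c) w (\<lambda>h. u h + v h) = (\<lambda>h. foldr (gen_act c) w u h + foldr (gen_act c) w v h)"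
  by (induction w) (simp_all only: foldr.simps o_apply id_apply gen_act_add)

lemma word_act_scale:
  "foldr (gen_act c) w (\<lambda>h. r * u h) = (\<lambda>h. r * foldr (gen_act c) w u h)"
  by (induction w) (simp_all only: foldr.simps o_apply id_apply gen_act_scale)

lemma word_act_zero: "foldr (gen_act c) w (\<lambda>h. 0) = (\<lambda>h. 0)"
  using word_act_scale[of c w 0] by simp

lemma word_act_sum:
  "foldr (gen_act c) w (\<lambda>h. \<Sum>i\<in>I. r i * u i h) = (\<lambda>h. \<Sum>i\<in>I. r i * foldr (gen_act c) w (u i) h)"
  by (induction I rule: infinite_finite_induct) (simp_all add: word_act_zero word_act_add word_act_scale)

lemma free_act_superset:
  assumes "finite W" "Poly_Mapping.keys p \<subseteq> W"
  shows "free_act c p u = (\<lambda>h. \<Sum>w\<in>W. Poly_Mapping.lookup p w * foldr (gen_act c) w u h)"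
  unfolding free_act_def using assms
  by (intro ext sum.mono_neutral_left) (auto simp: in_keys_iff)

lemma free_act_zero: "free_act c 0 u = (\<lambda>h. 0)"
  by (simp add: free_act_def)

lemma free_act_add: "free_act c (p + q) u = (\<lambda>h. free_act c p u h + free_act c q u h)"
proof -
  let ?W = "Poly_Mapping.keys p \<union> Poly_Mapping.keys q"
  have "Poly_Mapping.keys (p + q) \<subseteq> ?W" by (rule Poly_Mapping.keys_add)
  then show ?thesis
    using free_act_superset[of ?W "p + q" c u] free_act_superset[of ?W p c u]
      free_act_superset[of ?W q c u]
    by (simp add: lookup_add distrib_right sum.distrib)
qed

lemma free_act_uminus: "free_act c (- p) u = (\<lambda>h. - free_act c p u h)"
  by (simp add: free_act_def sum_negf)

lemma free_act_diff: "free_act c (p - q) u = (\<lambda>h. free_act c p u h - free_act c q u h)"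
  using free_act_add[of c p "- q" u] by (simp add: free_act_uminus)

lemma free_act_sum: "free_act c (\<Sum>i\<in>I. p i) u = (\<lambda>h. \<Sum>i\<in>I. free_act c (p i) u h)"
  by (induction I rule: infinite_finite_induct) (simp_all add: free_act_zero free_act_add)

lemma free_act_single: "free_act c (Poly_Mapping.single w r) u = (\<lambda>h. r * foldr (gen_act c) w u h)"
  using free_act_superset[of "{w}" "Poly_Mapping.single w r" c u] by simp

lemma free_act_one: "free_act c 1 u = u"
  using free_act_single[of c "0 :: gen list" 1 u] by (simp only: single_one) (simp add: zero_list_def)

lemma free_act_add_vec: "free_act c p (\<lambda>h. u h + v h) = (\<lambda>h. free_act c p u h + free_act c p v h)"
  by (simp add: free_act_def word_act_add distrib_left sum.distrib)

lemma free_act_zero_vec: "free_act c p (\<lambda>h. 0) = (\<lambda>h. 0)"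
  by (simp add: free_act_def word_act_zero)

lemma poly_mapping_eq_sum_single:
  "p = (\<Sum>w\<in>Poly_Mapping.keys p. Poly_Mapping.single w (Poly_Mapping.lookup p w))"
  by (rule poly_mapping_eqI) (auto simp: lookup_sum lookup_single when_def in_keys_iff sum.delta')

lemma free_act_mult: "free_act c (p * q) u = free_act c p (free_act c q u)"
proof -
  let ?P = "Poly_Mapping.keys p" and ?Q = "Poly_Mapping.keys q"
  have "p * q = (\<Sum>w\<in>?P. \<Sum>v\<in>?Q.
      Poly_Mapping.single (w + v) (Poly_Mapping.lookup p w * Poly_Mapping.lookup q v))"
    by (subst (1) poly_mapping_eq_sum_single[of p], subst (1) poly_mapping_eq_sum_single[of q])
      (simp add: sum_product mult_single)
  then have "free_act c (p * q) u = (\<lambda>h. \<Sum>w\<in>?P. \<Sum>v\<in>?Q.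
      Poly_Mapping.lookup p w * Poly_Mapping.lookup q v * foldr (gen_act c) w (foldr (gen_act c) v u) h)"
    by (simp add: free_act_sum free_act_single plus_list_def)
  also have "\<dots> = free_act c p (free_act c q u)"
    by (simp add: free_act_def word_act_sum sum_distrib_left mult.assoc)
  finally show ?thesis .
qed

lemma ring_alg:
  assumes "relators a \<subseteq> carrier (free_algebra gens)"
  shows "ideal (rel_ideal a) (free_algebra gens)" "ring (alg a)"
proof -
  interpret ring "free_algebra gens :: (gen list \<Rightarrow>\<^sub>0 'a) ring" by (rule ring_free_algebra)
  show I: "ideal (rel_ideal a) (free_algebra gens)"
    unfolding rel_ideal_def by (rule genideal_ideal[OF assms])
  show "ring (alg a)" unfolding alg_def by (rule ideal.quotient_is_ring[OF I])
qed

lemma free_of_fun_closed: "free_of_fun f \<in> carrier (free_algebra gens)"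
proof -
  have "Poly_Mapping.keys (free_of_fun f) \<subseteq> (\<Union>g\<in>UNIV. Poly_Mapping.keys (Poly_Mapping.single [Dl g] (f g)))"
    unfolding free_of_fun_def by (rule Poly_Mapping.keys_sum)
  also have "\<dots> \<subseteq> lists gens" by (auto simp: gens_def)
  finally show ?thesis by (simp add: free_algebra_def)
qed

lemma relators_closed: "relators a \<subseteq> carrier (free_algebra gens)"
proof -
  have add: "p + q \<in> carrier (free_algebra gens)" "p - q \<in> carrier (free_algebra gens)"
    if "p \<in> carrier (free_algebra gens)" "q \<in> carrier (free_algebra gens)" for p q :: "gen list \<Rightarrow>\<^sub>0 'a"
    using that Poly_Mapping.keys_add[of p q] Poly_Mapping.keys_diff[of p q]
    by (auto simp: keys_free_algebra_iff)
  have word: "word w \<in> carrier (free_algebra gens)" if "set w \<subseteq> gens" for w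
    using that by (auto simp: keys_free_algebra_iff)
  have zero_one: "0 \<in> carrier (free_algebra gens)" "1 \<in> carrier (free_algebra gens)"
    by (auto simp: keys_free_algebra_iff zero_list_def)
  have "Dl g \<in> gens" "t \<in> O23 \<Longrightarrow> X t \<in> gens" "t12 \<in> O23" "t13 \<in> O23" "t23 \<in> O23" for g t
    by (auto simp: gens_def O23_def)
  note mem = this
  show ?thesis
    unfolding relators_def
    by (intro Un_least subsetI; (elim CollectE exE conjE insertE emptyE)?; simp split del: if_split)
      (auto intro!: add word zero_one free_of_fun_closed mem)
qed

lemma left_module_weight_basis_module:
  assumes inv: "\<And>t u h. \<lbrakk>t \<in> O23; \<forall>g. g \<notin> B \<longrightarrow> u g = 0; h \<notin> B\<rbrakk> \<Longrightarrow> gen_act c (X t) u h = 0"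
    and rel: "\<And>p u. \<lbrakk>p \<in> relators a; \<forall>g. g \<notin> B \<longrightarrow> u g = 0\<rbrakk> \<Longrightarrow> free_act c p u = (\<lambda>h. 0)"
  shows "left_module (alg a) (weight_basis_module B c)"
proof -
  let ?F = "free_algebra gens :: (gen list \<Rightarrow>\<^sub>0 'a) ring"
  interpret F: ring ?F by (rule ring_free_algebra)
  interpret I: ideal "rel_ideal a" ?F by (rule ring_alg[OF relators_closed])
  define V where "V = {u :: S3 \<Rightarrow> 'a. \<forall>g. g \<notin> B \<longrightarrow> u g = 0}"
  have gen: "gen_act c x u \<in> V" if "x \<in> gens" "u \<in> V" for x u
    using that inv by (auto simp: gens_def V_def)
  have word: "foldr (gen_act c) w u \<in> V" if "set w \<subseteq> gens" "u \<in> V" for w u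
    using that by (induction w) (auto intro: gen)
  have act: "free_act c p u \<in> V" if p: "p \<in> carrier ?F" and u: "u \<in> V" for p u
  proof -
    have "foldr (gen_act c) w u h = 0" if "w \<in> Poly_Mapping.keys p" "h \<notin> B" for w h
      using p word[of w u] u that by (auto simp: keys_free_algebra_iff V_def)
    then show ?thesis by (auto simp: V_def free_act_def intro!: sum.neutral)
  qed
  define J where "J = {p \<in> carrier ?F. \<forall>u\<in>V. free_act c p u = (\<lambda>h. 0)}"
  have plusF: "p \<oplus>\<^bsub>?F\<^esub> q = p + q" "p \<otimes>\<^bsub>?F\<^esub> q = p * q" "\<zero>\<^bsub>?F\<^esub> = 0" "\<one>\<^bsub>?F\<^esub> = 1" for p q
    by (simp_all add: free_algebra_def)
  have "ideal J ?F"
  proof (rule idealI[OF F.ring_axioms])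
    show "subgroup J (add_monoid ?F)"
    proof (rule group.subgroupI[OF F.a_group])
      show "J \<noteq> {}" using F.zero_closed by (auto simp: J_def plusF free_act_zero intro!: exI[of _ 0])
      fix p assume p: "p \<in> J"
      then have "\<ominus>\<^bsub>?F\<^esub> p = - p" by (intro F.minus_equality) (auto simp: J_def plusF keys_free_algebra_iff)
      then show "inv\<^bsub>add_monoid ?F\<^esub> p \<in> J" using p
        unfolding a_inv_def[symmetric] by (simp add: J_def free_act_uminus keys_free_algebra_iff)
    next
      fix p q assume "p \<in> J" "q \<in> J"
      then show "p \<otimes>\<^bsub>add_monoid ?F\<^esub> q \<in> J"
        using F.a_closed[of p q] by (auto simp: J_def plusF free_act_add)
    qed (auto simp: J_def)
  next
    fix p q assume "p \<in> J" "q \<in> carrier ?F"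
    then show "q \<otimes>\<^bsub>?F\<^esub> p \<in> J" "p \<otimes>\<^bsub>?F\<^esub> q \<in> J"
      using F.m_closed[of p q] F.m_closed[of q p] act
      by (auto simp: J_def plusF free_act_mult free_act_zero_vec)
  qed
  moreover have "relators a \<subseteq> J" using rel relators_closed by (auto simp: J_def V_def)
  ultimately have IJ: "rel_ideal a \<subseteq> J" unfolding rel_ideal_def by (rule F.genideal_minimal)
  have carA: "\<exists>p\<in>carrier ?F. C = alg_class a p" if "C \<in> carrier (alg a)" for C
    using that by (auto simp: alg_def FactRing_def A_RCOSETS_def' alg_class_def)
  define M where "M = weight_basis_module B c"
  have car: "carrier M = V" and ad: "u \<oplus>\<^bsub>M\<^esub> v = (\<lambda>h. u h + v h)" and ze: "\<zero>\<^bsub>M\<^esub> = (\<lambda>h. 0)" for u v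
    by (simp_all add: M_def weight_basis_module_def V_def)
  have sm: "alg_class a p \<odot>\<^bsub>M\<^esub> u = free_act c p u" if p: "p \<in> carrier ?F" and u: "u \<in> V" for p u
  proof -
    have "free_act c q u = free_act c p u" if "q \<in> alg_class a p" for q
    proof -
      from that obtain i where i: "i \<in> rel_ideal a" "q = i + p"
        by (auto simp: alg_class_def a_r_coset_def' plusF)
      then show ?thesis using IJ u by (auto simp: free_act_add J_def)
    qed
    moreover have "p \<in> alg_class a p"
      unfolding alg_class_def by (rule I.a_rcos_self[OF p])
    ultimately have "(\<lambda>q. free_act c q u) ` alg_class a p = {free_act c p u}" by blast
    then show ?thesis by (simp add: M_def weight_basis_module_def)
  qed
  have hom: "alg_class a p \<oplus>\<^bsub>alg a\<^esub> alg_class a q = alg_class a (p + q)"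
    "alg_class a p \<otimes>\<^bsub>alg a\<^esub> alg_class a q = alg_class a (p * q)"
    "\<one>\<^bsub>alg a\<^esub> = alg_class a 1"
    if "p \<in> carrier ?F" "q \<in> carrier ?F" for p q
    using I.rcos_ring_hom that unfolding alg_class_def alg_def
    by (simp_all add: ring_hom_def plusF)
  have "abelian_group M"
  proof (rule abelian_groupI)
    fix u assume "u \<in> carrier M"
    then show "\<exists>v\<in>carrier M. v \<oplus>\<^bsub>M\<^esub> u = \<zero>\<^bsub>M\<^esub>"
      by (intro bexI[of _ "\<lambda>h. - u h"]) (auto simp: car ad ze V_def)
  qed (auto simp: car ad ze V_def algebra_simps)
  moreover have "ring (alg a)" by (rule ring_alg[OF relators_closed])
  moreover have [simp]: "1 \<in> carrier ?F" using F.one_closed by (simp add: plusF)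
  moreover have "p + q \<in> carrier ?F" "p * q \<in> carrier ?F" if "p \<in> carrier ?F" "q \<in> carrier ?F" for p q
    using F.a_closed[OF that] F.m_closed[OF that] by (simp_all add: plusF)
  moreover have "(\<lambda>h. u h + v h) \<in> V" if "u \<in> V" "v \<in> V" for u v using that by (auto simp: V_def)
  ultimately show ?thesis
    unfolding M_def[symmetric] left_module_def
    by (auto simp: car ad sm act hom(1,2) hom(3)[OF \<open>1 \<in> carrier ?F\<close> \<open>1 \<in> carrier ?F\<close>] free_act_add free_act_mult free_act_add_vec free_act_one
        dest!: carA)
qed

lemma forall_three: "(\<forall>x::3. P x) \<longleftrightarrow> P 1 \<and> P 2 \<and> P 3"
proof (intro iffI allI)
  fix x :: 3 assume *: "P 1 \<and> P 2 \<and> P 3"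
  have "(3::3) = 0" by simp
  show "P x"
  proof (cases x)
    case (of_int z)
    then have "z = 0 \<or> z = 1 \<or> z = 2" by auto
    then show ?thesis using * of_int \<open>(3::3) = 0\<close> by auto
  qed
qed simp

lemma three_neq: "(1::3) \<noteq> 2" "(2::3) \<noteq> 1" "(1::3) \<noteq> 3" "(3::3) \<noteq> 1" "(2::3) \<noteq> 3" "(3::3) \<noteq> 2"
  by simp_all

lemma apply_t:
  "Perm.apply t12 1 = 2" "Perm.apply t12 2 = 1" "Perm.apply t12 3 = 3"
  "Perm.apply t13 1 = 3" "Perm.apply t13 3 = 1" "Perm.apply t13 2 = 2"
  "Perm.apply t23 2 = 3" "Perm.apply t23 3 = 2" "Perm.apply t23 1 = 1"
  by (simp_all only: apply_swap_simp apply_swap_same three_neq not_False_eq_True)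

lemma S3_mult:
  "t23 * t12 = t13 * t23" "t12 * t13 = t13 * t23"
  "t13 * t12 = t23 * t13" "t12 * t23 = t23 * t13"
  "t12 * (t13 * t23) = t13" "t13 * (t13 * t23) = t23" "t23 * (t13 * t23) = t12"
  "t12 * (t23 * t13) = t23" "t13 * (t23 * t13) = t12" "t23 * (t23 * t13) = t13"
  by (simp_all only: perm_eq_iff apply_times o_apply forall_three apply_t simp_thms)

lemma t_neq: "t12 \<noteq> t13" "t12 \<noteq> t23" "t13 \<noteq> t23" "t13 \<noteq> t12" "t23 \<noteq> t12" "t23 \<noteq> t13"
  "t13 * t23 \<noteq> t12" "t13 * t23 \<noteq> t13" "t13 * t23 \<noteq> t23" "t13 * t23 \<noteq> t23 * t13"
  "t23 * t13 \<noteq> t12" "t23 * t13 \<noteq> t13" "t23 * t13 \<noteq> t23" "t23 * t13 \<noteq> t13 * t23"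
  by (simp_all only: perm_eq_iff apply_times o_apply forall_three apply_t three_neq simp_thms)

lemma t_square: "t \<in> O23 \<Longrightarrow> t * t = 1" "t \<in> O23 \<Longrightarrow> t * (t * g) = g"
  by (auto simp: O23_def mult.assoc[symmetric])

lemma gen_act_X: "t \<in> O23 \<Longrightarrow> gen_act c (X t) u h = u (t * h) * c t (t * h)"
proof -
  assume t: "t \<in> O23"
  have "{g. t * g = h} = {t * h}" using t_square(2)[OF t] by force
  then show ?thesis by simp
qed

lemma finite_S3: "finite (UNIV :: S3 set)"
proof (rule finite_imageD)
  show "inj_on Perm.apply (UNIV :: S3 set)" by (simp add: inj_on_def perm_eq_iff)
qed (rule finite_subset[OF subset_UNIV finite])

lemma free_act_free_of_fun: "free_act c (free_of_fun f) u = (\<lambda>h. f h * u h)"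
  by (simp add: free_of_fun_def free_act_sum free_act_single if_distrib[of "\<lambda>x. _ * x"] finite_S3 cong: if_cong)

lemma left_module_weight_basis_moduleI:
  assumes B: "\<And>t g. \<lbrakk>t \<in> O23; g \<in> B; t * g \<notin> B\<rbrakk> \<Longrightarrow> c t g = 0"
    and square: "\<And>t g. \<lbrakk>t \<in> O23; g \<in> B\<rbrakk> \<Longrightarrow> c t g * c t (t * g) = f_fun a t g"
    and cubic1: "\<And>g. g \<in> B \<Longrightarrow> c t23 g * c t13 (t23 * g) + c t12 g * c t23 (t12 * g)
      + c t13 g * c t12 (t13 * g) = 0"
    and cubic2: "\<And>g. g \<in> B \<Longrightarrow> c t13 g * c t23 (t13 * g) + c t12 g * c t13 (t12 * g)
      + c t23 g * c t12 (t23 * g) = 0"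
  shows "left_module (alg a) (weight_basis_module B c)"
proof (rule left_module_weight_basis_module)
  note mem = O23_def[THEN equalityD2, THEN subsetD]
  fix t :: S3 and u :: "S3 \<Rightarrow> 'a" and h
  assume "t \<in> O23" "\<forall>g. g \<notin> B \<longrightarrow> u g = 0" "h \<notin> B"
  then show "gen_act c (X t) u h = 0"
    using B[of t "t * h"] by (cases "t * h \<in> B") (simp_all add: gen_act_X t_square del: gen_act.simps)
next
  have mem: "t12 \<in> O23" "t13 \<in> O23" "t23 \<in> O23" by (simp_all add: O23_def)
  fix p and u :: "S3 \<Rightarrow> 'a"
  assume p: "p \<in> relators a" and u: "\<forall>g. g \<notin> B \<longrightarrow> u g = 0"
  have two: "free_act c (word [X s, X t]) u h = u (t * (s * h)) * (c t (t * (s * h)) * c s (s * h))"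
    if "s \<in> O23" "t \<in> O23" for s t h
    using that by (simp add: free_act_single gen_act_X del: gen_act.simps)
  consider (1) g h where "p = word [Dl g, Dl h] - (if g = h then word [Dl g] else 0)"
    | (2) "p = free_of_fun (\<lambda>_. 1) - 1"
    | (3) h t where "t \<in> O23" "p = word [Dl h, X t] - word [X t, Dl (t * h)]"
    | (4) t where "t \<in> O23" "p = word [X t, X t] - free_of_fun (f_fun a t)"
    | (5) "p = word [X t13, X t23] + word [X t23, X t12] + word [X t12, X t13]"
    | (6) "p = word [X t23, X t13] + word [X t13, X t12] + word [X t12, X t23]"
    using p unfolding relators_def by blast
  then show "free_act c p u = (\<lambda>h. 0)"
  proof cases
    case 1 then show ?thesis by (auto simp: free_act_diff free_act_single free_act_zero)
  next
    case 2 then show ?thesis by (simp add: free_act_diff free_act_free_of_fun free_act_one)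
  next
    case 3
    have "t * h' = t * h \<longleftrightarrow> h' = h" for h' using t_square(2)[OF 3(1)] by metis
    then show ?thesis using 3
      by (auto simp: free_act_diff free_act_single gen_act_X simp del: gen_act.simps(2))
  next
    case 4
    show ?thesis
    proof
      fix h
      have "free_act c p u h = u h * (c t h * c t (t * h)) - f_fun a t h * u h"
        unfolding 4(2) by (simp only: free_act_diff free_act_free_of_fun two[OF 4(1) 4(1)] t_square(2)[OF 4(1)])
      then show "free_act c p u h = 0"
        using u square[OF 4(1), of h] by (cases "h \<in> B") simp_all
    qed
  next
    case 5
    show ?thesis
    proof
      fix h
      define g where "g = t23 * (t13 * h)"
      have g1: "t12 * (t23 * h) = g" "t13 * (t12 * h) = g"
        unfolding g_def by (simp_all only: mult.assoc[symmetric] S3_mult)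
      have g2: "t13 * h = t23 * g" "t23 * h = t12 * g" "t12 * h = t13 * g"
        by (simp only: g_def t_square(2) mem, simp only: g1(1)[symmetric] t_square(2) mem,
          simp only: g1(2)[symmetric] t_square(2) mem)
      have "free_act c p u h = u g * (c t23 g * c t13 (t23 * g) + c t12 g * c t23 (t12 * g)
          + c t13 g * c t12 (t13 * g))"
        unfolding 5 by (simp only: free_act_add two mem g2 t_square(2)[OF mem(1)]
            t_square(2)[OF mem(2)] t_square(2)[OF mem(3)] distrib_left)
      then show "free_act c p u h = 0" using u cubic1[of g] by (cases "g \<in> B") simp_all
    qed
  next
    case 6
    show ?thesis
    proof
      fix h
      define g where "g = t13 * (t23 * h)"
      have g1: "t12 * (t13 * h) = g" "t23 * (t12 * h) = g"
        unfolding g_def by (simp_all only: mult.assoc[symmetric] S3_mult)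
      have g2: "t23 * h = t13 * g" "t13 * h = t12 * g" "t12 * h = t23 * g"
        by (simp only: g_def t_square(2) mem, simp only: g1(1)[symmetric] t_square(2) mem,
          simp only: g1(2)[symmetric] t_square(2) mem)
      have "free_act c p u h = u g * (c t13 g * c t23 (t13 * g) + c t12 g * c t13 (t12 * g)
          + c t23 g * c t12 (t23 * g))"
        unfolding 6 by (simp only: free_act_add two mem g2 t_square(2)[OF mem(1)]
            t_square(2)[OF mem(2)] t_square(2)[OF mem(3)] distrib_left)
      then show "free_act c p u h = 0" using u cubic2[of g] by (cases "g \<in> B") simp_all
    qed
  qed
qed

lemma sgn_S3: "sgn_S3 t12 = -1" "sgn_S3 t13 = -1" "sgn_S3 t23 = -1"
  "sgn_S3 (t13 * t23) = 1" "sgn_S3 (t23 * t13) = 1"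
proof -
  have *: "Perm.apply (Perm.swap x y) = Transposition.transpose x y" for x y :: 3
    by transfer simp
  show "sgn_S3 t12 = -1" "sgn_S3 t13 = -1" "sgn_S3 t23 = -1"
    "sgn_S3 (t13 * t23) = 1" "sgn_S3 (t23 * t13) = 1"
    unfolding sgn_S3_def apply_times *
    by (simp_all only: sign_swap_id sign_compose permutation_swap_id three_neq) simp_all
qed

lemma f_fun_values:
  "f_fun a t12 1 = 0" "f_fun a t13 1 = 0" "f_fun a t23 1 = 0"
  "f_fun a t12 t12 = 0" "f_fun a t13 t12 = a t13 - a t23" "f_fun a t23 t12 = a t23 - a t13"
  "f_fun a t12 t13 = a t12 - a t23" "f_fun a t13 t13 = 0" "f_fun a t23 t13 = a t23 - a t12"
  "f_fun a t12 t23 = a t12 - a t13" "f_fun a t13 t23 = a t13 - a t12" "f_fun a t23 t23 = 0"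
  "f_fun a t12 (t13 * t23) = a t12 - a t23" "f_fun a t13 (t13 * t23) = a t13 - a t12"
  "f_fun a t23 (t13 * t23) = a t23 - a t13"
  "f_fun a t12 (t23 * t13) = a t12 - a t13" "f_fun a t13 (t23 * t13) = a t13 - a t23"
  "f_fun a t23 (t23 * t13) = a t23 - a t12"
proof -
  have conj: "t12 * t13 * t12 = t23" "t12 * t23 * t12 = t13" "t13 * t12 * t13 = t23"
    "t13 * t23 * t13 = t12" "t23 * t12 * t23 = t13" "t23 * t13 * t23 = t12"
    by (simp_all only: perm_eq_iff apply_times o_apply forall_three apply_t simp_thms)
  have conj2: "(t23 * t13) * t * (t13 * t23) = t23 * (t13 * t * t13) * t23"
    "(t13 * t23) * t * (t23 * t13) = t13 * (t23 * t * t23) * t13" for t :: S3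
    by (simp_all only: mult.assoc)
  show "f_fun a t12 1 = 0" "f_fun a t13 1 = 0" "f_fun a t23 1 = 0"
    "f_fun a t12 t12 = 0" "f_fun a t13 t12 = a t13 - a t23" "f_fun a t23 t12 = a t23 - a t13"
    "f_fun a t12 t13 = a t12 - a t23" "f_fun a t13 t13 = 0" "f_fun a t23 t13 = a t23 - a t12"
    "f_fun a t12 t23 = a t12 - a t13" "f_fun a t13 t23 = a t13 - a t12" "f_fun a t23 t23 = 0"
    "f_fun a t12 (t13 * t23) = a t12 - a t23" "f_fun a t13 (t13 * t23) = a t13 - a t12"
    "f_fun a t23 (t13 * t23) = a t23 - a t13"
    "f_fun a t12 (t23 * t13) = a t12 - a t13" "f_fun a t13 (t23 * t13) = a t13 - a t23"
    "f_fun a t23 (t23 * t13) = a t23 - a t12"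
    by (simp_all only: f_fun_def perm.inverse_distrib_swap inverse_swap conj2 conj
        swap_self mult_1_left mult_1_right perm.inverse_neutral diff_self S3_mult(5,8))
qed

lemma left_module_k_module:
  assumes "a t13 = a t23" "h \<in> {1, t12}"
  shows "left_module (alg a) (k_module h)"
  unfolding k_module_def
proof (rule left_module_weight_basis_moduleI)
  fix t g assume "t \<in> O23" "g \<in> {h}"
  then have "t \<in> {t12, t13, t23}" "g \<in> {1, t12}" using assms by (simp_all only: O23_def singleton_iff)
  then have "f_fun a t g = 0" by (elim insertE emptyE; simp only: f_fun_values assms(1) diff_self)
  then show "0 * 0 = f_fun a t g" by (simp only: mult_zero_left)
qed (simp_all only: mult_zero_left add_0_right)

lemma left_module_L_module:
  assumes "a t13 = a t23"
  shows "left_module (alg a) (L_module a)"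
proof -
  let ?B = "{t13, t23, t13 * t23, t23 * t13}"
  define c where "c t g = (if g = t then 0 else if sgn_S3 g = -1 then 1 else f_fun a t g)" for t g
  have c: "c t12 t13 = 1" "c t13 t13 = 0" "c t23 t13 = 1" "c t12 t23 = 1" "c t13 t23 = 1" "c t23 t23 = 0"
    "c t12 (t13 * t23) = a t12 - a t23" "c t13 (t13 * t23) = a t13 - a t12" "c t23 (t13 * t23) = 0"
    "c t12 (t23 * t13) = a t12 - a t13" "c t13 (t23 * t13) = 0" "c t23 (t23 * t13) = a t23 - a t12"
    by (simp_all only: c_def sgn_S3 t_neq f_fun_values assms diff_self) simp_all
  have "left_module (alg a) (weight_basis_module ?B c)"
  proof (rule left_module_weight_basis_moduleI)
    fix t g assume "t \<in> O23" and g: "g \<in> ?B"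
    then have t: "t \<in> {t12, t13, t23}" by (simp only: O23_def)
    show "c t g = 0" if "t * g \<notin> ?B"
      using t g that by (elim insertE emptyE; simp only: c S3_mult insert_iff simp_thms)
    show "c t g * c t (t * g) = f_fun a t g"
      using t g by (elim insertE emptyE)
        (simp_all only: c S3_mult swap_self f_fun_values assms mult_1_left mult_1_right mult_zero_left diff_self)
  next
    fix g assume g: "g \<in> ?B"
    show "c t23 g * c t13 (t23 * g) + c t12 g * c t23 (t12 * g) + c t13 g * c t12 (t13 * g) = 0"
      "c t13 g * c t23 (t13 * g) + c t12 g * c t13 (t12 * g) + c t23 g * c t12 (t23 * g) = 0"
      using g by (elim insertE emptyE; simp only: c S3_mult swap_self assms
        mult_1_left mult_1_right mult_zero_left mult_zero_right diff_self; simp)+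
  qed
  then show ?thesis unfolding L_module_def c_def .
qed

lemma left_module_verma: "left_module (alg a) (verma a g)"
proof -
  interpret I: ideal "rel_ideal a" "free_algebra gens" by (rule ring_alg[OF relators_closed])
  show ?thesis
    unfolding verma_def
  proof (rule left_module_induced_module)
    fix f :: "S3 \<Rightarrow> 'a"
    show "alg_of_fun a f \<in> carrier (alg a)"
      using I.rcos_ring_hom free_of_fun_closed[of f]
      unfolding alg_of_fun_def alg_class_def alg_def by (simp add: ring_hom_closed)
  qed (simp_all add: ring_alg[OF relators_closed] fun_point_def)
qed

end

theory Submission
  imports Defs "HOL-Library.Function_Algebras"
begin

text \<open>The Verma module is the quotient of the free algebra by a left ideal. The relations of the
  algebra show that twelve vectors span it, and these are linearly independent because the
  relations hold for an explicit action on a space with twelve coordinates. In that model every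
  weight space is a plane. A proper submodule meets the weight space of the identity in the line of
  \<open>m\<^sub>t\<^sub>o\<^sub>p\<close> or in zero. Since \<open>a\<^sub>1\<^sub>2 \<noteq> a\<^sub>1\<^sub>3\<close>, the generators identify the four weight spaces in the
  support of \<open>L\<close>, so that a nonzero proper submodule amounts to a pair \<open>(l, m)\<close> of subspaces of the
  plane: \<open>l\<close> for these four weights and \<open>m\<close> for the weight \<open>(12)\<close>. The remaining actions of the
  generators say that each of \<open>l\<close> and \<open>m\<close> contains \<open>(0, 1)\<close> as soon as the other one is not contained
  in the line through \<open>(0, 1)\<close>, and the pairs subject to these two conditions form the lattice of
  the theorem. The simple subquotients come from linear functionals on \<open>l\<close> and \<open>m\<close>.\<close>

section \<open>The free algebra and its actions\<close>

text \<open>The delicate point is the choice of basis. For the generator \<open>x13\<close> alone,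
  the three-term relations give \<open>x13 * (- x23) = x12 * x13 + x23 * x12\<close> on
  \<open>1 \<otimes> 1\<close>, so the two coordinates at one weight would get mixed on the way to
  another, and no single plane \<open>l\<close> could serve all four weights. Adding the correction
  \<open>M13\<close> to \<open>x13\<close> removes the mixing: then
  \<open>x12 * V13 = x13 * V23\<close> and \<open>x23 * V13 = x12 * V23\<close>, and generators
  passing between these weights multiply both coordinates by one common factor, which is 1 or plus
  or minus the difference of \<open>a t12\<close> and \<open>a t13\<close>. The hypothesis that this
  difference is nonzero makes these passages reversible.

  A second obstacle is that an element of the tensor product is a coset of formal sums over classes
  of polynomials. Computations are therefore made with polynomials \<open>p\<close> standing for
  \<open>p \<otimes> 1\<close>. Congruences between them bound the module from above, and maps out
  of the tensor product bound it from below; the same action table appears on both sides, derived as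
  congruences in one case and verified against the relators in the other.\<close>

lemma free_algebra_ops:
  "p \<oplus>\<^bsub>free_algebra G\<^esub> q = p + q" "p \<otimes>\<^bsub>free_algebra G\<^esub> q = p * q"
  "\<zero>\<^bsub>free_algebra G\<^esub> = 0" "\<one>\<^bsub>free_algebra G\<^esub> = 1"
  by (simp_all add: free_algebra_def)

lemma free_algebra_closed:
  fixes p q :: "'x list \<Rightarrow>\<^sub>0 'k::comm_ring_1"
  shows "(0 :: 'x list \<Rightarrow>\<^sub>0 'k) \<in> carrier (free_algebra G)" "(1 :: 'x list \<Rightarrow>\<^sub>0 'k) \<in> carrier (free_algebra G)"
    and "\<lbrakk>p \<in> carrier (free_algebra G); q \<in> carrier (free_algebra G)\<rbrakk> \<Longrightarrow> p + q \<in> carrier (free_algebra G)"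
    and "\<lbrakk>p \<in> carrier (free_algebra G); q \<in> carrier (free_algebra G)\<rbrakk> \<Longrightarrow> p * q \<in> carrier (free_algebra G)"
    and "p \<in> carrier (free_algebra G) \<Longrightarrow> - p \<in> carrier (free_algebra G)"
    and "\<lbrakk>p \<in> carrier (free_algebra G); q \<in> carrier (free_algebra G)\<rbrakk> \<Longrightarrow> p - q \<in> carrier (free_algebra G)"
    and "set w \<subseteq> G \<Longrightarrow> Poly_Mapping.single w (k :: 'k) \<in> carrier (free_algebra G)"
proof -
  interpret ring "free_algebra G :: ('x list \<Rightarrow>\<^sub>0 'k) ring" by (rule ring_free_algebra)
  note ops = free_algebra_ops[of G]
  show "(0 :: 'x list \<Rightarrow>\<^sub>0 'k) \<in> carrier (free_algebra G)" "(1 :: 'x list \<Rightarrow>\<^sub>0 'k) \<in> carrier (free_algebra G)"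
    using zero_closed one_closed by (simp_all only: ops)
  show add: "p + q \<in> carrier (free_algebra G)"
    if "p \<in> carrier (free_algebra G)" "q \<in> carrier (free_algebra G)" for p q :: "'x list \<Rightarrow>\<^sub>0 'k"
    using a_closed[OF that] by (simp add: ops)
  show "p * q \<in> carrier (free_algebra G)"
    if "p \<in> carrier (free_algebra G)" "q \<in> carrier (free_algebra G)"
    using m_closed[OF that] by (simp add: ops)
  show minus: "- p \<in> carrier (free_algebra G)" if "p \<in> carrier (free_algebra G)" for p :: "'x list \<Rightarrow>\<^sub>0 'k"
    using that by (simp add: keys_free_algebra_iff)
  show "p - q \<in> carrier (free_algebra G)"
    if "p \<in> carrier (free_algebra G)" "q \<in> carrier (free_algebra G)"
    using add[OF that(1) minus[OF that(2)]] by simp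
  show "set w \<subseteq> G \<Longrightarrow> Poly_Mapping.single w (k :: 'k) \<in> carrier (free_algebra G)"
    by (auto simp: keys_free_algebra_iff)
qed

lemma single_Cons: "Poly_Mapping.single (x # w) k = word [x] * Poly_Mapping.single w k"
  by (simp add: mult_single plus_list_def)

lemma single_Nil_commute:
  "Poly_Mapping.single [] k * p = p * Poly_Mapping.single [] (k :: 'k::comm_ring_1)"
proof -
  have "Poly_Mapping.single [] k * (\<Sum>w\<in>W. Poly_Mapping.single w (r w))
      = (\<Sum>w\<in>W. Poly_Mapping.single w (r w)) * Poly_Mapping.single [] k" for W and r :: "'b list \<Rightarrow> 'k"
    by (simp add: sum_distrib_left sum_distrib_right mult_single plus_list_def mult.commute)
  then show ?thesis using poly_mapping_eq_sum_single[of p] by metis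
qed

text \<open>Words are peeled off from the left, one generator at a time, because the modules are
  left modules: a statement about the action of a polynomial reduces to the effect of one generator
  on a vector already understood.\<close>

lemma free_algebra_induct [consumes 1, case_names scalar gen add]:
  assumes p: "p \<in> carrier (free_algebra G)"
    and scalar: "\<And>k. P (Poly_Mapping.single [] k)"
    and gen: "\<And>x p. \<lbrakk>x \<in> G; p \<in> carrier (free_algebra G); P p\<rbrakk> \<Longrightarrow> P (Poly_Mapping.single [x] 1 * p)"
    and add: "\<And>p q. \<lbrakk>p \<in> carrier (free_algebra G); q \<in> carrier (free_algebra G); P p; P q\<rbrakk> \<Longrightarrow> P (p + q)"
  shows "P p"
proof -
  have single: "P (Poly_Mapping.single w k)" if "set w \<subseteq> G" for w k
    using that
  proof (induction w)
    case (Cons x w)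
    then show ?case
      using gen[of x "Poly_Mapping.single w k"] by (simp add: mult_single plus_list_def free_algebra_closed)
  qed (rule scalar)
  have "P (\<Sum>w\<in>W. Poly_Mapping.single w (r w)) \<and> (\<Sum>w\<in>W. Poly_Mapping.single w (r w)) \<in> carrier (free_algebra G)"
    if "finite W" "W \<subseteq> lists G" for W r
    using that
  proof (induction W)
    case empty
    show ?case using scalar[of 0] by (simp add: free_algebra_closed)
  next
    case (insert w W)
    then have "set w \<subseteq> G" by auto
    then show ?case
      using insert add[OF _ _ single[of w "r w"]] by (simp add: free_algebra_closed)
  qed
  from this[of "Poly_Mapping.keys p" "Poly_Mapping.lookup p"] p show ?thesis
    by (simp add: keys_free_algebra_iff flip: poly_mapping_eq_sum_single)
qed

section \<open>Actions of the free algebra on coordinate vectors\<close>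

definition scale :: "'k::times \<Rightarrow> ('i \<Rightarrow> 'k) \<Rightarrow> 'i \<Rightarrow> 'k" where
  "scale k u = (\<lambda>i. k * u i)"

lemma scale_apply [simp]: "scale k u i = k * u i"
  by (simp add: scale_def)

lemma scale_simps:
  fixes u v :: "'i \<Rightarrow> 'k::comm_ring_1"
  shows "scale k (u + v) = scale k u + scale k v" "scale (k + r) u = scale k u + scale r u"
    "scale k (scale r u) = scale (k * r) u" "scale 1 u = u" "scale 0 u = 0" "scale k 0 = 0"
  by (auto simp: fun_eq_iff algebra_simps)

text \<open>\<open>free_act\<close> acts on functions on \<open>S3\<close>, which have one
  coordinate per weight. The model of the Verma module has two coordinates in each weight, hence
  this version over an arbitrary index type.\<close>

definition poly_act :: "('x \<Rightarrow> ('i \<Rightarrow> 'k) \<Rightarrow> 'i \<Rightarrow> 'k) \<Rightarrow> ('x list \<Rightarrow>\<^sub>0 'k::comm_ring_1) \<Rightarrow>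
    ('i \<Rightarrow> 'k) \<Rightarrow> 'i \<Rightarrow> 'k" where
  "poly_act \<gamma> p u = (\<lambda>i. \<Sum>w\<in>Poly_Mapping.keys p. Poly_Mapping.lookup p w * foldr \<gamma> w u i)"

lemma free_act_eq_poly_act: "free_act c = poly_act (gen_act c)"
  by (simp add: fun_eq_iff free_act_def poly_act_def)

lemma poly_act_superset:
  assumes "finite W" "Poly_Mapping.keys p \<subseteq> W"
  shows "poly_act \<gamma> p u = (\<lambda>i. \<Sum>w\<in>W. Poly_Mapping.lookup p w * foldr \<gamma> w u i)"
  unfolding poly_act_def using assms
  by (intro ext sum.mono_neutral_left) (auto simp: in_keys_iff)

lemma poly_act_single: "poly_act \<gamma> (Poly_Mapping.single w r) u = scale r (foldr \<gamma> w u)"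
  using poly_act_superset[of "{w}" "Poly_Mapping.single w r" \<gamma> u] by (simp add: scale_def)

lemma poly_act_one: "poly_act \<gamma> 1 u = u"
  using poly_act_single[of \<gamma> 0 1 u]
  by (simp only: single_one) (simp add: zero_list_def scale_simps)

lemma poly_act_zero: "poly_act \<gamma> 0 u = 0"
  by (simp add: poly_act_def fun_eq_iff)

lemma poly_act_add: "poly_act \<gamma> (p + q) u = poly_act \<gamma> p u + poly_act \<gamma> q u"
proof -
  let ?W = "Poly_Mapping.keys p \<union> Poly_Mapping.keys q"
  have "Poly_Mapping.keys (p + q) \<subseteq> ?W" by (rule Poly_Mapping.keys_add)
  then show ?thesis
    using poly_act_superset[of ?W "p + q" \<gamma> u] poly_act_superset[of ?W p \<gamma> u]
      poly_act_superset[of ?W q \<gamma> u]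
    by (simp add: fun_eq_iff lookup_add distrib_right sum.distrib)
qed

lemma poly_act_sum: "poly_act \<gamma> (\<Sum>i\<in>I. p i) u = (\<Sum>i\<in>I. poly_act \<gamma> (p i) u)"
  by (induction I rule: infinite_finite_induct) (simp_all add: poly_act_zero poly_act_add)

lemma poly_act_uminus: "poly_act \<gamma> (- p) u = - poly_act \<gamma> p u"
  by (simp add: fun_eq_iff poly_act_def sum_negf)

lemma poly_act_diff: "poly_act \<gamma> (p - q) u = poly_act \<gamma> p u - poly_act \<gamma> q u"
  using poly_act_add[of \<gamma> p "- q" u] by (simp add: poly_act_uminus)

locale linear_action =
  fixes \<gamma> :: "'x \<Rightarrow> ('i \<Rightarrow> 'k::comm_ring_1) \<Rightarrow> 'i \<Rightarrow> 'k"
  assumes action_add: "\<gamma> x (u + v) = \<gamma> x u + \<gamma> x v"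
    and action_scale: "\<gamma> x (scale k u) = scale k (\<gamma> x u)"
begin

lemma foldr_add: "foldr \<gamma> w (u + v) = foldr \<gamma> w u + foldr \<gamma> w v"
  by (induction w) (simp_all only: foldr.simps o_apply id_apply action_add)

lemma foldr_scale: "foldr \<gamma> w (scale k u) = scale k (foldr \<gamma> w u)"
  by (induction w) (simp_all only: foldr.simps o_apply id_apply action_scale)

lemma poly_act_scale_vec: "poly_act \<gamma> p (scale k u) = scale k (poly_act \<gamma> p u)"
  by (simp add: fun_eq_iff poly_act_def foldr_scale sum_distrib_left mult.left_commute)

lemma poly_act_zero_vec: "poly_act \<gamma> p 0 = 0"
  using poly_act_scale_vec[of p 0 0] by (simp add: scale_simps)

lemma poly_act_single_mult:
  "poly_act \<gamma> (Poly_Mapping.single v r * p) u = scale r (foldr \<gamma> v (poly_act \<gamma> p u))"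
proof -
  have "foldr \<gamma> v (\<Sum>w\<in>W. f w) = (\<Sum>w\<in>W. foldr \<gamma> v (f w))" if "finite W" for W :: "'x list set" and f
    using that
    by (induction W) (use foldr_scale[of v 0 0] in \<open>simp_all only: scale_simps foldr_add sum.empty sum.insert not_False_eq_True\<close>)
  moreover have "scale r (\<Sum>w\<in>W. f w) = (\<Sum>w\<in>W. scale r (f w))"
    if "finite W" for W :: "'x list set" and f :: "'x list \<Rightarrow> 'i \<Rightarrow> 'k"
    using that by (induction W) (simp_all only: scale_simps sum.empty sum.insert not_False_eq_True)
  ultimately have "poly_act \<gamma> (Poly_Mapping.single v r * (\<Sum>w\<in>W. Poly_Mapping.single w (k w))) u
      = scale r (foldr \<gamma> v (poly_act \<gamma> (\<Sum>w\<in>W. Poly_Mapping.single w (k w)) u))"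
    if "finite W" for W k
    using that by (simp add: sum_distrib_left mult_single plus_list_def poly_act_sum poly_act_single
        foldr_scale scale_simps)
  from this[of "Poly_Mapping.keys p" "Poly_Mapping.lookup p"] show ?thesis by (simp flip: poly_mapping_eq_sum_single)
qed

lemma poly_act_mult: "poly_act \<gamma> (p * q) u = poly_act \<gamma> p (poly_act \<gamma> q u)"
proof -
  \<comment> \<open>Over the full alphabet every polynomial lies in the carrier, so the induction is
    available for arbitrary \<open>p\<close>.\<close>
  have "p \<in> carrier (free_algebra UNIV)" by (simp add: keys_free_algebra_iff)
  then show ?thesis
  proof (induction p rule: free_algebra_induct)
    case (gen x p)
    then show ?case
      by (simp add: mult.assoc poly_act_single_mult scale_simps)
  qed (simp_all add: poly_act_single_mult poly_act_single poly_act_add distrib_right)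
qed

end

section \<open>Verma modules as cyclic modules over the free algebra\<close>

lemma free_of_fun_const: "free_of_fun (\<lambda>_. k) = Poly_Mapping.single [] k * free_of_fun (\<lambda>_. 1)"
  by (simp add: free_of_fun_def sum_distrib_left mult_single plus_list_def)

lemma alg_class_hom:
  assumes p: "p \<in> carrier (free_algebra gens)" and q: "q \<in> carrier (free_algebra gens)"
  shows "alg_class a p \<in> carrier (alg a)"
    and "alg_class a (p + q) = alg_class a p \<oplus>\<^bsub>alg a\<^esub> alg_class a q"
    and "alg_class a (p * q) = alg_class a p \<otimes>\<^bsub>alg a\<^esub> alg_class a q"
    and "\<one>\<^bsub>alg a\<^esub> = alg_class a 1"
    and "alg_class a p = alg_class a q \<longleftrightarrow> p - q \<in> rel_ideal a"
proof -
  let ?F = "free_algebra gens :: (gen list \<Rightarrow>\<^sub>0 'a) ring"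
  interpret I: ideal "rel_ideal a" ?F by (rule ring_alg[OF relators_closed])
  show "alg_class a p \<in> carrier (alg a)"
    using I.rcos_ring_hom p unfolding alg_class_def alg_def by (simp add: ring_hom_closed)
  show "alg_class a (p + q) = alg_class a p \<oplus>\<^bsub>alg a\<^esub> alg_class a q"
    "alg_class a (p * q) = alg_class a p \<otimes>\<^bsub>alg a\<^esub> alg_class a q"
    "\<one>\<^bsub>alg a\<^esub> = alg_class a 1"
    using I.rcos_ring_hom p q unfolding alg_class_def alg_def
    by (simp_all add: ring_hom_def free_algebra_ops)
  have "\<exists>i\<in>rel_ideal a. p = i + q" if "alg_class a p = alg_class a q"
  proof -
    have "p \<in> alg_class a q" using I.a_rcos_self[OF p] that by (simp add: alg_class_def)
    then show ?thesis by (auto simp: alg_class_def a_r_coset_def' free_algebra_ops)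
  qed
  moreover have "alg_class a p = alg_class a q" if "p - q \<in> rel_ideal a"
  proof -
    have "p \<in> rel_ideal a +>\<^bsub>?F\<^esub> q"
      unfolding a_r_coset_def' using that by (auto simp: free_algebra_ops intro!: bexI[of _ "p - q"])
    then show ?thesis using I.a_repr_independence[OF _ q] I.a_subgroup by (simp add: alg_class_def)
  qed
  ultimately show "alg_class a p = alg_class a q \<longleftrightarrow> p - q \<in> rel_ideal a" by auto
qed

lemma carrier_alg: "carrier (alg a) = alg_class a ` carrier (free_algebra gens)"
  by (auto simp: alg_def FactRing_def A_RCOSETS_def' alg_class_def)

lemma rel_idealI:
  assumes "p \<in> relators a" "q \<in> carrier (free_algebra gens)"
  shows "p * q \<in> rel_ideal a" "q * p \<in> rel_ideal a" "p \<in> rel_ideal a"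
proof -
  interpret R: ring "free_algebra gens :: (gen list \<Rightarrow>\<^sub>0 'a) ring" by (rule ring_free_algebra)
  interpret I: ideal "rel_ideal a" "free_algebra gens" by (rule ring_alg[OF relators_closed])
  show p: "p \<in> rel_ideal a"
    using R.genideal_self[OF relators_closed] assms(1) by (auto simp: rel_ideal_def)
  show "p * q \<in> rel_ideal a" "q * p \<in> rel_ideal a"
    using I.I_r_closed[OF p assms(2)] I.I_l_closed[OF p assms(2)] by (simp_all add: free_algebra_ops)
qed

text \<open>The polynomials that annihilate every vector form a two-sided ideal, since
  \<open>poly_act\<close> turns products into compositions of linear maps. It contains the relators,
  hence the ideal generated by them.\<close>

lemma poly_act_rel_ideal:
  fixes \<gamma> :: "gen \<Rightarrow> ('i \<Rightarrow> 'k::field) \<Rightarrow> 'i \<Rightarrow> 'k"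
  assumes "linear_action \<gamma>" and gens: "\<And>p u. p \<in> relators a \<Longrightarrow> poly_act \<gamma> p u = 0" and p: "p \<in> rel_ideal a"
  shows "poly_act \<gamma> p u = 0"
proof -
  interpret linear_action \<gamma> by fact
  let ?F = "free_algebra gens :: (gen list \<Rightarrow>\<^sub>0 'k) ring"
  interpret F: ring ?F by (rule ring_free_algebra)
  define J where "J = {p \<in> carrier ?F. \<forall>u. poly_act \<gamma> p u = 0}"
  have "ideal J ?F"
  proof (rule idealI[OF F.ring_axioms])
    show "subgroup J (add_monoid ?F)"
    proof (rule group.subgroupI[OF F.a_group])
      show "J \<noteq> {}" using free_algebra_closed(1)[of gens] by (auto simp: J_def poly_act_zero)
      fix p assume p: "p \<in> J"
      then have "\<ominus>\<^bsub>?F\<^esub> p = - p"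
        by (intro F.minus_equality) (auto simp: J_def free_algebra_ops free_algebra_closed)
      then show "inv\<^bsub>add_monoid ?F\<^esub> p \<in> J" using p
        unfolding a_inv_def[symmetric] by (simp add: J_def poly_act_uminus free_algebra_closed)
    qed (auto simp: J_def free_algebra_ops free_algebra_closed poly_act_add)
  qed (auto simp: J_def free_algebra_ops free_algebra_closed poly_act_mult poly_act_zero_vec)
  moreover have "relators a \<subseteq> J" using gens relators_closed by (auto simp: J_def)
  ultimately have "rel_ideal a \<subseteq> J" unfolding rel_ideal_def by (rule F.genideal_minimal)
  then show ?thesis using p by (auto simp: J_def)
qed

text \<open>The element \<open>p \<otimes> 1\<close>, with a polynomial \<open>p\<close> as
  representative of its class in the algebra.\<close>

definition verma_class :: "(S3 \<Rightarrow> 'k::field) \<Rightarrow> S3 \<Rightarrow> (gen list \<Rightarrow>\<^sub>0 'k) \<Rightarrow>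
    ((gen list \<Rightarrow>\<^sub>0 'k) set \<times> 'k \<Rightarrow>\<^sub>0 int) set" where
  "verma_class a g p =
     pure_tensor (alg a) fun_S3 (alg_of_fun a) (fun_point g) (alg_class a p) 1"

lemma verma_vec_eq:
  assumes "set ts \<subseteq> O23"
  shows "verma_vec a g ts = verma_class a g (word (map X ts))"
proof -
  have "foldr (\<lambda>t r. x_gen a t \<otimes>\<^bsub>alg a\<^esub> r) ts \<one>\<^bsub>alg a\<^esub> = alg_class a (word (map X ts))"
    using assms
  proof (induction ts)
    case Nil
    have "word [] = (1 :: gen list \<Rightarrow>\<^sub>0 'a)" by (simp flip: single_one add: zero_list_def)
    then show ?case by (simp add: alg_class_hom(4)[OF free_algebra_closed(1,1)])
  next
    case (Cons t ts)
    then have "word [X t] \<in> carrier (free_algebra gens)" "word (map X ts) \<in> carrier (free_algebra gens)"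
      by (auto intro!: free_algebra_closed(7) simp: gens_def subset_iff)
    from alg_class_hom(3)[OF this, of a] Cons show ?case
      by (simp add: x_gen_def flip: single_Cons)
  qed
  then show ?thesis by (simp add: verma_vec_def verma_class_def)
qed

lemma tensor_kernel_subgroup:
  "subgroup (tensor_kernel (alg a) fun_S3 (alg_of_fun a) (fun_point g))
     (free_Abelian_group (carrier (alg a) \<times> carrier (fun_point g :: (S3 \<Rightarrow> 'k::field, 'k) module)))"
  "tensor_relators (alg a) fun_S3 (alg_of_fun a) (fun_point g)
     \<subseteq> carrier (free_Abelian_group (carrier (alg a) \<times> carrier (fun_point g :: (S3 \<Rightarrow> 'k::field, 'k) module)))"
proof -
  let ?N = "fun_point g :: (S3 \<Rightarrow> 'k, 'k) module"
  define G where "G = free_Abelian_group (carrier (alg a) \<times> carrier ?N)"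
  interpret A: ring "alg a" by (rule ring_alg[OF relators_closed])
  interpret G: comm_group G by (simp add: G_def abelian_free_Abelian_group)
  have frag: "frag_of (r, n) \<in> carrier G" if "r \<in> carrier (alg a)" for r n
    using that by (simp add: G_def fun_point_def)
  have diff: "x - y \<in> carrier G" if "x \<in> carrier G" "y \<in> carrier G" for x y
    using that Poly_Mapping.keys_diff[of x y] by (auto simp: G_def)
  have of_fun: "alg_of_fun a f \<in> carrier (alg a)" for f
    unfolding alg_of_fun_def by (rule alg_class_hom(1)[OF free_of_fun_closed free_of_fun_closed])
  show "tensor_relators (alg a) fun_S3 (alg_of_fun a) (fun_point g) \<subseteq> carrier G"
    unfolding tensor_relators_def
    by (auto intro!: diff simp: frag of_fun A.m_closed A.a_closed)
  then show "subgroup (tensor_kernel (alg a) fun_S3 (alg_of_fun a) (fun_point g)) G"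
    unfolding tensor_kernel_def G_def[symmetric] by (rule G.generate_is_subgroup)
qed

text \<open>A scalar in the second tensor factor is the value at \<open>g\<close> of a constant
  function, so it moves across the tensor sign into the algebra. Hence single tensors
  \<open>p \<otimes> 1\<close> exhaust the module, although its elements are classes of formal
  sums.\<close>

lemma verma_class_facts:
  fixes a :: "S3 \<Rightarrow> 'k::field"
  shows verma_class_closed: "p \<in> carrier (free_algebra gens) \<Longrightarrow> verma_class a g p \<in> carrier (verma a g)"
    and verma_class_add: "\<lbrakk>p \<in> carrier (free_algebra gens); q \<in> carrier (free_algebra gens)\<rbrakk> \<Longrightarrow>
      verma_class a g (p + q) = verma_class a g p \<oplus>\<^bsub>verma a g\<^esub> verma_class a g q"
    and verma_class_mult: "\<lbrakk>p \<in> carrier (free_algebra gens); q \<in> carrier (free_algebra gens)\<rbrakk> \<Longrightarrow>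
      verma_class a g (p * q) = alg_class a p \<odot>\<^bsub>verma a g\<^esub> verma_class a g q"
    and verma_class_fun: "p \<in> carrier (free_algebra gens) \<Longrightarrow>
      verma_class a g (p * free_of_fun f) = verma_class a g (Poly_Mapping.single [] (f g) * p)"
    and verma_class_surj: "x \<in> carrier (verma a g) \<Longrightarrow> \<exists>p\<in>carrier (free_algebra gens). x = verma_class a g p"
    and verma_class_zero_iff: "p \<in> carrier (free_algebra gens) \<Longrightarrow>
      verma_class a g p = \<zero>\<^bsub>verma a g\<^esub> \<longleftrightarrow>
        frag_of (alg_class a p, 1) \<in> tensor_kernel (alg a) fun_S3 (alg_of_fun a) (fun_point g)"
proof -
  let ?F = "free_algebra gens :: (gen list \<Rightarrow>\<^sub>0 'k) ring"
  let ?N = "fun_point g :: (S3 \<Rightarrow> 'k, 'k) module"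
  define G where "G = free_Abelian_group (carrier (alg a) \<times> carrier ?N)"
  define K where "K = tensor_kernel (alg a) fun_S3 (alg_of_fun a) (fun_point g)"
  define R where "R = tensor_relators (alg a) fun_S3 (alg_of_fun a) (fun_point g)"
  define M where "M = verma a g"
  interpret A: ring "alg a" by (rule ring_alg[OF relators_closed])
  interpret G: comm_group G by (simp add: G_def abelian_free_Abelian_group)
  have K: "subgroup K G" and RG: "R \<subseteq> carrier G"
    using tensor_kernel_subgroup[of a g] by (simp_all add: K_def R_def G_def)
  interpret K: normal K G by (rule G.subgroup_imp_normal[OF K])
  interpret M: abelian_group M
    using left_module_verma[of a g] by (simp add: left_module_def M_def)
  have M_smult: "r \<odot>\<^bsub>M\<^esub> x \<in> carrier M" if "r \<in> carrier (alg a)" "x \<in> carrier M" for r x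
    using left_module_verma[of a g] that by (simp add: left_module_def M_def)
  have RK: "x \<in> K" if "x \<in> R" for x
    using that by (auto simp: K_def R_def tensor_kernel_def intro: generate.incl)
  have carM: "carrier M = {K #>\<^bsub>G\<^esub> x | x. x \<in> carrier G}"
    by (auto simp: M_def verma_def induced_module_def Let_def K_def G_def FactGroup_def RCOSETS_def)
  have addM: "(K #>\<^bsub>G\<^esub> x) \<oplus>\<^bsub>M\<^esub> (K #>\<^bsub>G\<^esub> y) = K #>\<^bsub>G\<^esub> (x + y)"
    if "x \<in> carrier G" "y \<in> carrier G" for x y
    using K.rcos_sum[OF that]
    by (simp add: M_def verma_def induced_module_def Let_def K_def G_def FactGroup_def)
  have zeroM: "\<zero>\<^bsub>M\<^esub> = K"
    by (simp add: M_def verma_def induced_module_def Let_def K_def G_def FactGroup_def)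
  have fragG: "frag_of (r, n) \<in> carrier G" if "r \<in> carrier (alg a)" for r n
    using that by (simp add: G_def fun_point_def)
  have addG: "x + y \<in> carrier G" if "x \<in> carrier G" "y \<in> carrier G" for x y
    using G.m_closed[OF that] by (simp add: G_def)
  have coset_eq: "K #>\<^bsub>G\<^esub> x = K #>\<^bsub>G\<^esub> y" if "x \<in> carrier G" "y \<in> carrier G" "x - y \<in> K" for x y
  proof -
    have "x = (x - y) \<otimes>\<^bsub>G\<^esub> y" by (simp add: G_def)
    then have "x \<in> K #>\<^bsub>G\<^esub> y" using that unfolding r_coset_def by blast
    then show ?thesis using G.repr_independence[OF _ that(2) K] by simp
  qed
  define t where "t r n = K #>\<^bsub>G\<^esub> frag_of (r, n)" for r n
  have vc: "verma_class a g p = t (alg_class a p) 1" for p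
    by (simp add: verma_class_def pure_tensor_def t_def K_def G_def)
  have tM: "t r n \<in> carrier M" if "r \<in> carrier (alg a)" for r n
    using fragG[OF that] by (auto simp: carM t_def)
  have t_add: "t (r \<oplus>\<^bsub>alg a\<^esub> s) n = t r n \<oplus>\<^bsub>M\<^esub> t s n" if "r \<in> carrier (alg a)" "s \<in> carrier (alg a)" for r s n
  proof -
    have "frag_of (r \<oplus>\<^bsub>alg a\<^esub> s, n) - frag_of (r, n) - frag_of (s, n) \<in> R"
      unfolding R_def tensor_relators_def using that by (force simp: fun_point_def)
    from RK[OF this] show ?thesis
      unfolding t_def using that
      by (subst addM) (simp_all add: coset_eq fragG addG diff_diff_eq)
  qed
  have t_fun: "t (r \<otimes>\<^bsub>alg a\<^esub> alg_of_fun a f) n = t r (f g * n)" if "r \<in> carrier (alg a)" for r f n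
  proof -
    have "frag_of (r \<otimes>\<^bsub>alg a\<^esub> alg_of_fun a f, n) - frag_of (r, f \<odot>\<^bsub>?N\<^esub> n) \<in> R"
      unfolding R_def tensor_relators_def using that by (force simp: fun_point_def fun_S3_def)
    then have "frag_of (r \<otimes>\<^bsub>alg a\<^esub> alg_of_fun a f, n) - frag_of (r, f g * n) \<in> K"
      by (intro RK) (simp add: fun_point_def)
    moreover have "alg_of_fun a f \<in> carrier (alg a)"
      unfolding alg_of_fun_def by (rule alg_class_hom(1)[OF free_of_fun_closed free_of_fun_closed])
    ultimately show ?thesis unfolding t_def using that by (simp add: coset_eq fragG)
  qed
  have t_smult: "r \<odot>\<^bsub>M\<^esub> t s n = t (r \<otimes>\<^bsub>alg a\<^esub> s) n"
    if rs: "r \<in> carrier (alg a)" "s \<in> carrier (alg a)" for r s n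
  proof -
    \<comment> \<open>The product is defined as a union of cosets. It is already known to be a
      single coset, because the module is closed under the action, so one element shared with the
      expected coset identifies it.\<close>
    have "frag_of (s, n) \<in> K #>\<^bsub>G\<^esub> frag_of (s, n)" by (rule G.rcos_self[OF fragG[OF that(2)] K])
    then have "K #>\<^bsub>G\<^esub> frag_extend (\<lambda>(s, n). frag_of (r \<otimes>\<^bsub>alg a\<^esub> s, n)) (frag_of (s, n)) \<subseteq> r \<odot>\<^bsub>M\<^esub> t s n"
      by (auto simp: M_def verma_def induced_module_def Let_def t_def K_def G_def)
    then have sub: "K #>\<^bsub>G\<^esub> frag_of (r \<otimes>\<^bsub>alg a\<^esub> s, n) \<subseteq> r \<odot>\<^bsub>M\<^esub> t s n" by simp
    moreover have "frag_of (r \<otimes>\<^bsub>alg a\<^esub> s, n) \<in> K #>\<^bsub>G\<^esub> frag_of (r \<otimes>\<^bsub>alg a\<^esub> s, n)"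
      using that by (intro G.rcos_self fragG K) auto
    ultimately have *: "frag_of (r \<otimes>\<^bsub>alg a\<^esub> s, n) \<in> r \<odot>\<^bsub>M\<^esub> t s n" by blast
    obtain y where y: "y \<in> carrier G" "r \<odot>\<^bsub>M\<^esub> t s n = K #>\<^bsub>G\<^esub> y"
      using M_smult[OF rs(1) tM[OF rs(2)]] by (auto simp: carM)
    show ?thesis
      unfolding y(2) using G.repr_independence[OF *[unfolded y(2)] y(1) K] by (simp add: t_def)
  qed
  show "verma_class a g p \<in> carrier (verma a g)" if "p \<in> carrier ?F" for p
    using tM[OF alg_class_hom(1)[OF that that]] by (simp add: vc M_def)
  show "verma_class a g (p + q) = verma_class a g p \<oplus>\<^bsub>verma a g\<^esub> verma_class a g q"
    if "p \<in> carrier ?F" "q \<in> carrier ?F" for p q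
    using that t_add by (simp add: vc M_def alg_class_hom)
  show "verma_class a g (p * q) = alg_class a p \<odot>\<^bsub>verma a g\<^esub> verma_class a g q"
    if "p \<in> carrier ?F" "q \<in> carrier ?F" for p q
    using that t_smult by (simp add: vc M_def alg_class_hom)
  have scalar: "t (alg_class a p) n = t (alg_class a (Poly_Mapping.single [] n * p)) 1" if p: "p \<in> carrier ?F" for p n
  proof -
    let ?s = "Poly_Mapping.single [] n"
    have s: "?s \<in> carrier ?F" by (rule free_algebra_closed) simp
    \<comment> \<open>The relator saying that the \<open>\<delta>_g\<close> add up to one identifies
      the constant function \<open>n\<close> with the scalar \<open>n\<close>.\<close>
    have "free_of_fun (\<lambda>_. n) - ?s = ?s * (free_of_fun (\<lambda>_. 1) - 1)"
      by (subst free_of_fun_const) (simp add: right_diff_distrib)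
    moreover have "\<dots> \<in> rel_ideal a"
      by (rule rel_idealI(2)[OF _ s]) (simp add: relators_def)
    ultimately have "alg_of_fun a (\<lambda>_. n) = alg_class a ?s"
      unfolding alg_of_fun_def using alg_class_hom(5)[OF free_of_fun_closed s] by simp
    then have "t (alg_class a p) n = t (alg_class a p \<otimes>\<^bsub>alg a\<^esub> alg_class a ?s) 1"
      using t_fun[OF alg_class_hom(1)[OF p p], of "\<lambda>_. n" 1] by simp
    then show ?thesis by (simp add: single_Nil_commute alg_class_hom(3)[OF p s])
  qed
  show "verma_class a g (p * free_of_fun f) = verma_class a g (Poly_Mapping.single [] (f g) * p)"
    if p: "p \<in> carrier ?F" for p
    using t_fun[OF alg_class_hom(1)[OF p p], of f 1] scalar[OF p]
    by (simp add: vc alg_class_hom(3)[OF p free_of_fun_closed] alg_of_fun_def)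
  show "verma_class a g p = \<zero>\<^bsub>verma a g\<^esub> \<longleftrightarrow>
      frag_of (alg_class a p, 1) \<in> tensor_kernel (alg a) fun_S3 (alg_of_fun a) (fun_point g)"
    if p: "p \<in> carrier ?F" for p
  proof -
    have f: "frag_of (alg_class a p, 1) \<in> carrier G" by (rule fragG[OF alg_class_hom(1)[OF p p]])
    have "frag_of (alg_class a p, 1) \<in> verma_class a g p"
      unfolding vc t_def by (rule G.rcos_self[OF f K])
    moreover have "K #>\<^bsub>G\<^esub> x = K" if "x \<in> K" for x using K that by (simp add: G.coset_join2 K.mem_carrier)
    ultimately show ?thesis by (auto simp: zeroM[unfolded M_def] vc t_def simp flip: K_def)
  qed
  have *: "\<exists>p\<in>carrier ?F. K #>\<^bsub>G\<^esub> x = verma_class a g p \<and> x \<in> carrier G" if "x \<in> carrier G" for x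
  proof (rule frag_induction[of x "carrier (alg a) \<times> carrier ?N"])
    show "Poly_Mapping.keys x \<subseteq> carrier (alg a) \<times> carrier ?N" using that by (simp add: G_def)
    have "t (\<zero>\<^bsub>alg a\<^esub>) 1 = K"
      using t_add[of "\<zero>\<^bsub>alg a\<^esub>" "\<zero>\<^bsub>alg a\<^esub>" 1] tM[of "\<zero>\<^bsub>alg a\<^esub>" 1] M.add.r_cancel_one' by (simp flip: zeroM)
    moreover obtain z where "z \<in> carrier ?F" "\<zero>\<^bsub>alg a\<^esub> = alg_class a z"
      using A.zero_closed unfolding carrier_alg by blast
    moreover have "K #>\<^bsub>G\<^esub> 0 = K" using G.coset_mult_one[OF K.subset] by (simp add: G_def)
    ultimately show "\<exists>p\<in>carrier ?F. K #>\<^bsub>G\<^esub> 0 = verma_class a g p \<and> 0 \<in> carrier G"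
      by (auto simp: vc G_def)
  next
    fix y assume "y \<in> carrier (alg a) \<times> carrier ?N"
    then obtain p n where "y = (alg_class a p, n)" "p \<in> carrier ?F" by (auto simp: carrier_alg)
    then show "\<exists>p\<in>carrier ?F. K #>\<^bsub>G\<^esub> frag_of y = verma_class a g p \<and> frag_of y \<in> carrier G"
      using scalar[of p n] alg_class_hom(1)[of p p]
      by (auto simp: vc fragG simp flip: t_def intro!: bexI[of _ "Poly_Mapping.single [] n * p"] free_algebra_closed)
  next
    fix x y assume "\<exists>p\<in>carrier ?F. K #>\<^bsub>G\<^esub> x = verma_class a g p \<and> x \<in> carrier G"
      "\<exists>p\<in>carrier ?F. K #>\<^bsub>G\<^esub> y = verma_class a g p \<and> y \<in> carrier G"
    then obtain p q where p: "p \<in> carrier ?F" "K #>\<^bsub>G\<^esub> x = verma_class a g p" "x \<in> carrier G"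
      and q: "q \<in> carrier ?F" "K #>\<^bsub>G\<^esub> y = verma_class a g q" "y \<in> carrier G" by blast
    have xy: "x - y \<in> carrier G" using p(3) q(3) Poly_Mapping.keys_diff[of x y] by (auto simp: G_def)
    have pq: "p - q \<in> carrier ?F" using p q by (simp add: free_algebra_closed)
    \<comment> \<open>The rules at hand concern sums, so the difference is treated by adding the
      class of \<open>q\<close> on both sides and cancelling it.\<close>
    have "(K #>\<^bsub>G\<^esub> (x - y)) \<oplus>\<^bsub>M\<^esub> verma_class a g q = verma_class a g (p - q) \<oplus>\<^bsub>M\<^esub> verma_class a g q"
      using addM[OF xy q(3)] t_add[OF alg_class_hom(1)[OF pq pq] alg_class_hom(1)[OF q(1,1)], of 1]
        alg_class_hom(2)[OF pq q(1), of a] by (simp add: p(2) q(2)) (simp add: vc)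
    moreover have "K #>\<^bsub>G\<^esub> (x - y) \<in> carrier M" using xy by (auto simp: carM)
    ultimately have "K #>\<^bsub>G\<^esub> (x - y) = verma_class a g (p - q)"
      using pq q(1) by (simp add: vc tM alg_class_hom(1) M.add.right_cancel)
    then show "\<exists>p\<in>carrier ?F. K #>\<^bsub>G\<^esub> (x - y) = verma_class a g p \<and> x - y \<in> carrier G"
      using xy pq by blast
  qed
  show "\<exists>p\<in>carrier ?F. x = verma_class a g p" if "x \<in> carrier (verma a g)" for x
    using that * unfolding M_def[symmetric] carM by blast
qed

lemma verma_class_zero: "verma_class a g 0 = \<zero>\<^bsub>verma a g\<^esub>"
proof -
  interpret M: abelian_group "verma a g"
    using left_module_verma[of a g] by (simp add: left_module_def)
  have "(0 :: gen list \<Rightarrow>\<^sub>0 'a) \<in> carrier (free_algebra gens)" by (rule free_algebra_closed)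
  from verma_class_add[OF this this, of a g] verma_class_closed[OF this, of a g] show ?thesis
    using M.add.r_cancel_one' by simp
qed

lemma verma_class_eq_iff:
  assumes "p \<in> carrier (free_algebra gens)" "q \<in> carrier (free_algebra gens)"
  shows "verma_class a g p = verma_class a g q \<longleftrightarrow> verma_class a g (p - q) = \<zero>\<^bsub>verma a g\<^esub>"
proof -
  interpret M: abelian_group "verma a g"
    using left_module_verma[of a g] by (simp add: left_module_def)
  have d: "p - q \<in> carrier (free_algebra gens)" using assms by (rule free_algebra_closed)
  have "verma_class a g p = verma_class a g (p - q) \<oplus>\<^bsub>verma a g\<^esub> verma_class a g q"
    using verma_class_add[OF d assms(2), of a g] by simp
  then show ?thesis
    using verma_class_closed[OF d, of a g] verma_class_closed[OF assms(2), of a g]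
    by (metis M.add.l_cancel_one M.l_zero M.add.r_cancel_one)
qed

text \<open>The universal property of \<^term>\<open>verma a g\<close>, for vectors \<open>u\<close> of weight \<open>g\<close>.\<close>

lemma poly_act_eq_if_verma_class_eq:
  fixes \<gamma> :: "gen \<Rightarrow> ('i \<Rightarrow> 'k::field) \<Rightarrow> 'i \<Rightarrow> 'k"
  assumes lin: "linear_action \<gamma>"
    and rel: "\<And>p u. p \<in> relators a \<Longrightarrow> poly_act \<gamma> p u = 0"
    and u: "\<And>f. poly_act \<gamma> (free_of_fun f) u = scale (f g) u"
    and pq: "p \<in> carrier (free_algebra gens)" "q \<in> carrier (free_algebra gens)"
    and eq: "verma_class a g p = verma_class a g q"
  shows "poly_act \<gamma> p u = poly_act \<gamma> q u"
proof -
  interpret linear_action \<gamma> by fact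
  let ?F = "free_algebra gens :: (gen list \<Rightarrow>\<^sub>0 'k) ring"
  let ?N = "fun_point g :: (S3 \<Rightarrow> 'k, 'k) module"
  let ?H = "\<lparr>carrier = UNIV, monoid.mult = (+), monoid.one = 0\<rparr> :: ('i \<Rightarrow> 'k) monoid"
  define G where "G = free_Abelian_group (carrier (alg a) \<times> carrier ?N)"
  interpret H: comm_group ?H
    by (rule comm_groupI) (auto simp: add.assoc add.commute intro: exI[of _ "- _"])
  \<comment> \<open>A class acts through a chosen representative; the choice is immaterial because
    the relation ideal acts by zero.\<close>
  define act where "act r = poly_act \<gamma> (SOME p. p \<in> carrier ?F \<and> r = alg_class a p) u" for r
  have act: "act (alg_class a p) = poly_act \<gamma> p u" if p: "p \<in> carrier ?F" for p
  proof -
    define p' where "p' = (SOME p'. p' \<in> carrier ?F \<and> alg_class a p = alg_class a p')"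
    have p': "p' \<in> carrier ?F \<and> alg_class a p = alg_class a p'"
      unfolding p'_def by (rule someI[of _ p]) (simp add: p)
    then have "p - p' \<in> rel_ideal a" using alg_class_hom(5)[OF p] by blast
    from poly_act_rel_ideal[OF lin rel this] have "poly_act \<gamma> p' u = poly_act \<gamma> p u"
      by (simp add: poly_act_diff)
    then show ?thesis by (simp add: act_def p'_def)
  qed
  obtain h where h: "h \<in> hom G ?H"
    "\<And>x. x \<in> carrier (alg a) \<times> carrier ?N \<Longrightarrow> h (frag_of x) = scale (snd x) (act (fst x))"
    unfolding G_def
    using H.free_Abelian_group_universal[of "\<lambda>x. scale (snd x) (act (fst x))" "carrier (alg a) \<times> carrier ?N"]
    by auto
  interpret G: comm_group G by (simp add: G_def abelian_free_Abelian_group)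
  interpret h: group_hom G ?H h by (simp add: group_hom_def group_hom_axioms_def h(1))
  have R: "tensor_relators (alg a) fun_S3 (alg_of_fun a) (fun_point g) \<subseteq> carrier G"
    using tensor_kernel_subgroup[of a g] by (simp add: G_def)
  have addG: "x + y \<in> carrier G" "h (x + y) = h x + h y" if "x \<in> carrier G" "y \<in> carrier G" for x y
    using G.m_closed[OF that] h.hom_mult[OF that] by (simp_all add: G_def)
  have diffG: "x - y \<in> carrier G" "h (x - y) = h x - h y" if "x \<in> carrier G" "y \<in> carrier G" for x y
  proof -
    show d: "x - y \<in> carrier G" using that Poly_Mapping.keys_diff[of x y] by (auto simp: G_def)
    show "h (x - y) = h x - h y" using addG(2)[OF d that(2)] by (simp add: algebra_simps)
  qed
  have hf: "h (frag_of (alg_class a p, n)) = scale n (poly_act \<gamma> p u)" "frag_of (alg_class a p, n) \<in> carrier G"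
    if "p \<in> carrier ?F" for p n
    using that h(2)[of "(alg_class a p, n)"] alg_class_hom(1)[OF that that]
    by (simp_all add: act fun_point_def G_def)
  have h0: "h x = 0" if x: "x \<in> tensor_relators (alg a) fun_S3 (alg_of_fun a) (fun_point g)" for x
  proof -
    \<comment> \<open>The first two families of relators vanish by additivity in each factor. The
      third is where the weight of \<open>u\<close> enters: a function moved across the tensor sign
      must act on \<open>u\<close> by its value at \<open>g\<close>.\<close>
    consider (a) p q n where "x = frag_of (alg_class a p \<oplus>\<^bsub>alg a\<^esub> alg_class a q, n)
          - frag_of (alg_class a p, n) - frag_of (alg_class a q, n)" "p \<in> carrier ?F" "q \<in> carrier ?F"
      | (b) p n n' where "x = frag_of (alg_class a p, n + n') - frag_of (alg_class a p, n)
          - frag_of (alg_class a p, n')" "p \<in> carrier ?F"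
      | (c) p f n where "x = frag_of (alg_class a p \<otimes>\<^bsub>alg a\<^esub> alg_of_fun a f, n)
          - frag_of (alg_class a p, f g * n)" "p \<in> carrier ?F"
      using x unfolding tensor_relators_def carrier_alg by (auto simp: fun_point_def)
    then show ?thesis
    proof cases
      case a
      then show ?thesis
        by (simp add: diffG hf free_algebra_closed poly_act_add scale_simps flip: alg_class_hom(2))
    next
      case b
      then show ?thesis by (simp add: diffG hf scale_simps)
    next
      case c
      then show ?thesis
        by (simp add: alg_of_fun_def diffG hf free_algebra_closed free_of_fun_closed poly_act_mult u
            poly_act_scale_vec scale_simps mult.commute flip: alg_class_hom(3))
    qed
  qed
  have ker: "h x = 0" if "x \<in> tensor_kernel (alg a) fun_S3 (alg_of_fun a) (fun_point g)" for x
    using that unfolding tensor_kernel_def G_def[symmetric]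
  proof (induction x rule: generate.induct)
    case one
    then show ?case using h.hom_one by simp
  next
    case (inv x)
    then have "h (inv\<^bsub>G\<^esub> x) = inv\<^bsub>?H\<^esub> 0" using R h.hom_inv[of x] h0[of x] by (simp only: subset_iff)
    then show ?case using H.inv_one by simp
  next
    case (eng x y)
    then show ?case using G.generate_in_carrier[OF R] by simp
  qed (rule h0)
  have d: "p - q \<in> carrier ?F" using pq by (rule free_algebra_closed)
  have "frag_of (alg_class a (p - q), 1) \<in> tensor_kernel (alg a) fun_S3 (alg_of_fun a) (fun_point g)"
    using eq verma_class_eq_iff[OF pq] verma_class_zero_iff[OF d] by blast
  from ker[OF this] show ?thesis by (simp add: hf[OF d] scale_simps poly_act_diff)
qed

section \<open>A coordinate model of the Verma module at the identity\<close>

text \<open>The index \<open>E\<close> stands for \<open>1 \<otimes> 1\<close> and \<open>Top\<close> for \<open>m\<^sub>t\<^sub>o\<^sub>p / (a\<^sub>1\<^sub>2 - a\<^sub>1\<^sub>3)\<close>, \<open>W\<close> for \<open>m\<^sub>(\<^sub>1\<^sub>2\<^sub>)\<close> and \<open>W'\<close> for \<open>m\<^sub>3\<close>.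
  Modulo \<open>W'\<close> and \<open>Top\<close>, each of the families \<open>V\<close> and \<open>M\<close> is a copy of the basis of \<open>L\<close>, with
  \<open>r = (13)(23)\<close> and \<open>s = (23)(13)\<close>; \<open>Mr\<close> stands for \<open>m\<^sub>2\<close>. Apart from those of \<open>E\<close>, the images of
  the basis vectors under the generators are multiples of basis vectors.\<close>

datatype ix = E | Top | W | W' | V13 | V23 | Vr | Vs | M13 | M23 | Mr | Ms

fun wt :: "ix \<Rightarrow> S3" where
  "wt E = 1" | "wt Top = 1" | "wt W = t12" | "wt W' = t12"
| "wt V13 = t13" | "wt M13 = t13" | "wt V23 = t23" | "wt M23 = t23"
| "wt Vr = t13 * t23" | "wt Mr = t13 * t23" | "wt Vs = t23 * t13" | "wt Ms = t23 * t13"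

text \<open>The matrix of \<open>x12\<close> read by target: the entry at an index collects the
  coordinates that are sent there. The entries of this and the next two definitions transpose the
  tables \<open>basis_action_M\<close> and \<open>basis_action_V\<close>, with \<open>c\<close> for
  the difference of \<open>a t12\<close> and \<open>a t13\<close>.\<close>

definition act12 :: "'k::comm_ring_1 \<Rightarrow> (ix \<Rightarrow> 'k) \<Rightarrow> ix \<Rightarrow> 'k" where
  "act12 c u = case_ix 0 (- c * u W') (u E) 0
     (c * u Vr) (c * u Vs) (u V13) (u V23) (c * u Mr) (c * u Ms) (u M13) (u M23)"

definition act13 :: "'k::comm_ring_1 \<Rightarrow> (ix \<Rightarrow> 'k) \<Rightarrow> ix \<Rightarrow> 'k" where
  "act13 c u = case_ix 0 (u V13 + u M13) 0 (- u Vs)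
     (u E) (- c * u Vr) (u V23) 0 (- u E) (- c * u Mr) (u M23) (u W)"

definition act23 :: "'k::comm_ring_1 \<Rightarrow> (ix \<Rightarrow> 'k) \<Rightarrow> ix \<Rightarrow> 'k" where
  "act23 c u = case_ix 0 (u M23) 0 (u Vr)
     (- c * u Vs) (- u E) 0 (u V13) (- c * u Ms) 0 (u W) (u M13)"

lemmas act_defs = act12_def act13_def act23_def

fun model_act :: "'k::comm_ring_1 \<Rightarrow> gen \<Rightarrow> (ix \<Rightarrow> 'k) \<Rightarrow> ix \<Rightarrow> 'k" where
  "model_act c (Dl g) u = (\<lambda>i. if wt i = g then u i else 0)"
| "model_act c (X t) u = (if t = t12 then act12 c u else if t = t13 then act13 c u else act23 c u)"

lemma model_act_X:
  "model_act c (X t12) = act12 c" "model_act c (X t13) = act13 c" "model_act c (X t23) = act23 c"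
  by (simp_all add: fun_eq_iff t_neq)

declare model_act.simps(2) [simp del]

lemma all_ix: "(\<forall>i. P i) \<longleftrightarrow> P E \<and> P Top \<and> P W \<and> P W' \<and> P V13 \<and> P V23 \<and> P Vr \<and> P Vs
    \<and> P M13 \<and> P M23 \<and> P Mr \<and> P Ms"
proof (intro iffI allI)
  fix i assume "P E \<and> P Top \<and> P W \<and> P W' \<and> P V13 \<and> P V23 \<and> P Vr \<and> P Vs
    \<and> P M13 \<and> P M23 \<and> P Mr \<and> P Ms"
  then show "P i" by (cases i) simp_all
qed simp

lemma ix_fun_eq_iff: "u = v \<longleftrightarrow> (\<forall>i::ix. u i = v i)"
  by (rule fun_eq_iff)

lemma linear_model_act: "linear_action (model_act c)"
proof
  fix x and u v :: "ix \<Rightarrow> 'a" and k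
  show "model_act c x (u + v) = model_act c x u + model_act c x v"
    by (cases x) (simp_all add: model_act.simps(2) fun_eq_iff all_ix act_defs algebra_simps)
  show "model_act c x (scale k u) = scale k (model_act c x u)"
    by (cases x) (simp_all add: model_act.simps(2) fun_eq_iff all_ix act_defs algebra_simps)
qed

interpretation model: linear_action "model_act c" for c
  by (rule linear_model_act)

lemma model_act_delta:
  assumes "t \<in> O23"
  shows "model_act c (Dl h) (model_act c (X t) u) = model_act c (X t) (model_act c (Dl (t * h)) u)"
proof -
  have mem: "t12 \<in> O23" "t13 \<in> O23" "t23 \<in> O23" by (simp_all add: O23_def)
  have *: "g = t * h \<longleftrightarrow> t * g = h" for g
    using t_square(2)[OF assms] by metis
  have sq: "t12 * t12 = 1" "t13 * t13 = 1" "t23 * t23 = 1" by (simp_all add: t_square mem)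
  have m: "t12 * (t13 * t23) = t13" "t13 * (t13 * t23) = t23" "t23 * (t13 * t23) = t12"
    "t12 * (t23 * t13) = t23" "t13 * (t23 * t13) = t12" "t23 * (t23 * t13) = t13"
    by (rule S3_mult)+
  from assms consider "t = t12" | "t = t13" | "t = t23" by (auto simp: O23_def)
  then show ?thesis
  proof cases
    case 1
    show ?thesis
      unfolding 1 model_act_X ix_fun_eq_iff all_ix model_act.simps(1) act_defs ix.case wt.simps *[unfolded 1]
        mult_1_right sq m S3_mult(1-4)
      by simp
  next
    case 2
    show ?thesis
      unfolding 2 model_act_X ix_fun_eq_iff all_ix model_act.simps(1) act_defs ix.case wt.simps *[unfolded 2]
        mult_1_right sq m S3_mult(1-4)
      by simp
  next
    case 3
    show ?thesis
      unfolding 3 model_act_X ix_fun_eq_iff all_ix model_act.simps(1) act_defs ix.case wt.simps *[unfolded 3]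
        mult_1_right sq m S3_mult(1-4)
      by simp
  qed
qed

text \<open>Under the hypothesis \<open>a t13 = a t23\<close> the numbers \<open>f_fun a t g\<close>
  are 0 or plus or minus the parameter of the model. At \<open>E\<close> the square of the action of
  \<open>t13\<close> vanishes by cancellation: \<open>E\<close> goes to \<open>V13 - M13\<close>,
  and both terms go to \<open>Top\<close>.\<close>

lemma model_act_square:
  assumes "t \<in> O23" and eq: "a t13 = a t23"
  shows "model_act (a t12 - a t13) (X t) (model_act (a t12 - a t13) (X t) u) i = f_fun a t (wt i) * u i"
proof -
  from assms consider "t = t12" | "t = t13" | "t = t23" by (auto simp: O23_def)
  then show ?thesis
  proof cases
    case 1
    then show ?thesis
      by (cases i) (simp_all only: 1 model_act_X act_defs ix.case wt.simps f_fun_values eq, simp_all)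
  next
    case 2
    then show ?thesis
      by (cases i) (simp_all only: 2 model_act_X act_defs ix.case wt.simps f_fun_values eq, simp_all add: algebra_simps)
  next
    case 3
    then show ?thesis
      by (cases i) (simp_all only: 3 model_act_X act_defs ix.case wt.simps f_fun_values eq, simp_all add: algebra_simps)
  qed
qed

lemma foldr_two: "foldr f [x, y] u = f x (f y u)"
  by simp

lemma poly_act_free_of_fun: "poly_act (model_act c) (free_of_fun f) u i = f (wt i) * u i"
proof -
  have "poly_act (model_act c) (free_of_fun f) u i = (\<Sum>g\<in>UNIV. f g * (if wt i = g then u i else 0))"
    unfolding free_of_fun_def poly_act_sum poly_act_single
    by (induction rule: finite_induct[OF finite_S3]) simp_all
  also have "\<dots> = f (wt i) * u i"
    by (simp add: finite_S3 if_distrib cong: if_cong)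
  finally show ?thesis .
qed

lemma poly_act_relators:
  assumes eq: "a t13 = a t23" and p: "p \<in> relators a"
  shows "poly_act (model_act (a t12 - a t13)) p u = 0"
proof -
  let ?c = "a t12 - a t13"
  note two = poly_act_single foldr_two scale_simps(4)
  consider (1) g h where "p = word [Dl g, Dl h] - (if g = h then word [Dl g] else 0)"
    | (2) "p = free_of_fun (\<lambda>_. 1) - 1"
    | (3) h t where "t \<in> O23" "p = word [Dl h, X t] - word [X t, Dl (t * h)]"
    | (4) t where "t \<in> O23" "p = word [X t, X t] - free_of_fun (f_fun a t)"
    | (5) "p = word [X t13, X t23] + word [X t23, X t12] + word [X t12, X t13]"
    | (6) "p = word [X t23, X t13] + word [X t13, X t12] + word [X t12, X t23]"
    using p unfolding relators_def by blast
  then show ?thesis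
  proof cases
    case 1 then show ?thesis by (auto simp: fun_eq_iff poly_act_diff poly_act_single poly_act_zero)
  next
    case 2 then show ?thesis by (simp add: fun_eq_iff poly_act_diff poly_act_free_of_fun poly_act_one)
  next
    case 3 then show ?thesis by (simp add: poly_act_diff two model_act_delta del: model_act.simps)
  next
    case 4 then show ?thesis
      by (simp add: fun_eq_iff poly_act_diff two model_act_square[OF _ eq] poly_act_free_of_fun)
  next
    case 5
    show ?thesis
      unfolding 5 poly_act_add two model_act_X
      by (simp add: fun_eq_iff all_ix act_defs algebra_simps)
  next
    case 6
    show ?thesis
      unfolding 6 poly_act_add two model_act_X
      by (simp add: fun_eq_iff all_ix act_defs algebra_simps)
  qed
qed

definition unit_vec :: "ix \<Rightarrow> ix \<Rightarrow> 'k::comm_ring_1" where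
  "unit_vec i = (\<lambda>j. if j = i then 1 else 0)"

section \<open>The Verma module at the identity in coordinates\<close>

definition smul :: "'k::comm_ring_1 \<Rightarrow> ('x list \<Rightarrow>\<^sub>0 'k) \<Rightarrow> ('x list \<Rightarrow>\<^sub>0 'k)" (infixr "\<bullet>" 75) where
  "k \<bullet> p = Poly_Mapping.single [] k * p"

lemma word_Nil: "Poly_Mapping.single [] 1 = (1 :: 'x list \<Rightarrow>\<^sub>0 'k::comm_ring_1)"
  by (simp flip: single_one add: zero_list_def)

lemma smul_simps:
  "k \<bullet> (p + q) = k \<bullet> p + k \<bullet> q" "(k + l) \<bullet> p = k \<bullet> p + l \<bullet> p" "k \<bullet> l \<bullet> p = (k * l) \<bullet> p"
  "1 \<bullet> p = p" "0 \<bullet> p = 0" "k \<bullet> 0 = 0" "k \<bullet> (- p) = - (k \<bullet> p)" "(- k) \<bullet> p = - (k \<bullet> p)"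
  "k \<bullet> (p - q) = k \<bullet> p - k \<bullet> q"
  by (simp_all add: smul_def distrib_left distrib_right single_add right_diff_distrib single_uminus
      mult_single plus_list_def word_Nil flip: mult.assoc)

lemma mult_smul: "q * (k \<bullet> p) = k \<bullet> (q * p)"
  by (metis smul_def mult.assoc single_Nil_commute)

locale special_param =
  fixes a :: "S3 \<Rightarrow> 'k::field"
  assumes a12: "a t12 \<noteq> a t13" and a13: "a t13 = a t23"
begin

definition c where "c = a t12 - a t13"

lemma c_nonzero: "c \<noteq> 0"
  using a12 by (simp add: c_def)

section \<open>Congruences between representatives\<close>

abbreviation fcarrier :: "(gen list \<Rightarrow>\<^sub>0 'k) set" where
  "fcarrier \<equiv> carrier (free_algebra gens)"

text \<open>Congruence modulo the left ideal annihilating \<open>1 \<otimes> 1\<close>, so that it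
  is preserved by multiplication from the left. Membership in the carrier is built in to keep chains
  of congruences free of side conditions.\<close>

definition eqv :: "(gen list \<Rightarrow>\<^sub>0 'k) \<Rightarrow> (gen list \<Rightarrow>\<^sub>0 'k) \<Rightarrow> bool" (infix "\<doteq>" 50) where
  "p \<doteq> q \<longleftrightarrow> p \<in> fcarrier \<and> q \<in> fcarrier \<and> verma_class a 1 p = verma_class a 1 q"

lemma eqv_refl: "p \<in> fcarrier \<Longrightarrow> p \<doteq> p"
  by (simp add: eqv_def)

lemma eqv_sym: "p \<doteq> q \<Longrightarrow> q \<doteq> p"
  by (simp add: eqv_def)

lemma eqv_trans [trans]: "p \<doteq> q \<Longrightarrow> q \<doteq> r \<Longrightarrow> p \<doteq> r"
  by (simp add: eqv_def)

lemma eqv_add: "p \<doteq> q \<Longrightarrow> p' \<doteq> q' \<Longrightarrow> p + p' \<doteq> q + q'"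
  by (simp add: eqv_def free_algebra_closed verma_class_add)

lemma eqv_mult: "r \<in> fcarrier \<Longrightarrow> p \<doteq> q \<Longrightarrow> r * p \<doteq> r * q"
  by (simp add: eqv_def free_algebra_closed verma_class_mult)

lemma eqv_smul: "p \<doteq> q \<Longrightarrow> k \<bullet> p \<doteq> k \<bullet> q"
  unfolding smul_def by (rule eqv_mult) (simp_all add: free_algebra_closed)

lemma eqv_uminus: "p \<doteq> q \<Longrightarrow> - p \<doteq> - q"
  using eqv_smul[of p q "-1"] by (simp add: smul_simps)

lemma eqv_diff: "p \<doteq> q \<Longrightarrow> p' \<doteq> q' \<Longrightarrow> p - p' \<doteq> q - q'"
  using eqv_add[OF _ eqv_uminus, of p q p' q'] by simp

text \<open>The relators generate a two-sided ideal; therefore a relation may be applied in front of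
  an arbitrary factor \<open>r\<close>, even though the congruence itself comes from a left
  ideal.\<close>

lemma eqv_relator:
  assumes "p - q \<in> relators a" "r \<in> fcarrier" "p * r \<in> fcarrier" "q * r \<in> fcarrier"
  shows "p * r \<doteq> q * r"
proof -
  have "(p - q) * r \<in> rel_ideal a" by (rule rel_idealI(1)[OF assms(1,2)])
  then have "alg_class a (p * r) = alg_class a (q * r)"
    using alg_class_hom(5)[OF assms(3,4)] by (simp add: left_diff_distrib)
  then show ?thesis using assms by (simp add: eqv_def verma_class_def)
qed

definition x12 :: "gen list \<Rightarrow>\<^sub>0 'k" where "x12 = word [X t12]"
definition x13 :: "gen list \<Rightarrow>\<^sub>0 'k" where "x13 = word [X t13]"
definition x23 :: "gen list \<Rightarrow>\<^sub>0 'k" where "x23 = word [X t23]"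

lemma word_X_closed: "t \<in> O23 \<Longrightarrow> word [X t] \<in> fcarrier" "word [Dl h] \<in> fcarrier"
  by (auto intro!: free_algebra_closed(7) simp: gens_def)

lemma O23_mem: "t12 \<in> O23" "t13 \<in> O23" "t23 \<in> O23"
  by (simp_all add: O23_def)

lemma x_closed: "x12 \<in> fcarrier" "x13 \<in> fcarrier" "x23 \<in> fcarrier"
  by (simp_all add: x12_def x13_def x23_def word_X_closed O23_mem)

lemma smul_closed: "p \<in> fcarrier \<Longrightarrow> k \<bullet> p \<in> fcarrier"
  by (simp add: smul_def free_algebra_closed)

lemmas closed = free_algebra_closed(1-6) x_closed smul_closed word_X_closed(2) free_of_fun_closed

lemma word_two: "word [x, y] * p = word [x] * (word [y] * p)"
  by (simp add: single_Cons[of x "[y]"] mult.assoc)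

lemma eqv_cubic:
  assumes "p \<in> fcarrier"
  shows "x13 * (x23 * p) \<doteq> - (x23 * (x12 * p)) - x12 * (x13 * p)"
    "x23 * (x12 * p) \<doteq> - (x13 * (x23 * p)) - x12 * (x13 * p)"
    "x12 * (x13 * p) \<doteq> - (x13 * (x23 * p)) - x23 * (x12 * p)"
    "x23 * (x13 * p) \<doteq> - (x13 * (x12 * p)) - x12 * (x23 * p)"
    "x13 * (x12 * p) \<doteq> - (x23 * (x13 * p)) - x12 * (x23 * p)"
proof -
  let ?p = "word [X t13, X t23] + word [X t23, X t12] + word [X t12, X t13] :: gen list \<Rightarrow>\<^sub>0 'k"
  let ?q = "word [X t23, X t13] + word [X t13, X t12] + word [X t12, X t23] :: gen list \<Rightarrow>\<^sub>0 'k"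
  have rel: "?p - 0 \<in> relators a" "?q - 0 \<in> relators a"
    by (simp_all add: relators_def)
  have "?p \<in> fcarrier" "?q \<in> fcarrier"
    by (auto intro!: free_algebra_closed simp: gens_def O23_def)
  then have "?p * p \<in> fcarrier" "?q * p \<in> fcarrier" "0 * p \<in> fcarrier"
    using assms by (simp_all only: closed)
  then have "?p * p \<doteq> 0 * p" "?q * p \<doteq> 0 * p"
    using eqv_relator[OF rel(1) assms] eqv_relator[OF rel(2) assms] by simp_all
  then have 1: "x13 * (x23 * p) + x23 * (x12 * p) + x12 * (x13 * p) \<doteq> 0"
    and 2: "x23 * (x13 * p) + x13 * (x12 * p) + x12 * (x23 * p) \<doteq> 0"
    by (simp_all add: distrib_right word_two x12_def x13_def x23_def)
  have r: "x13 * (x23 * p) \<doteq> x13 * (x23 * p)" "x23 * (x12 * p) \<doteq> x23 * (x12 * p)"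
    "x12 * (x13 * p) \<doteq> x12 * (x13 * p)" "x23 * (x13 * p) \<doteq> x23 * (x13 * p)"
    "x13 * (x12 * p) \<doteq> x13 * (x12 * p)" "x12 * (x23 * p) \<doteq> x12 * (x23 * p)"
    using assms by (simp_all add: eqv_refl closed)
  show "x13 * (x23 * p) \<doteq> - (x23 * (x12 * p)) - x12 * (x13 * p)"
    using eqv_diff[OF eqv_diff[OF 1 r(2)] r(3)] by simp
  show "x23 * (x12 * p) \<doteq> - (x13 * (x23 * p)) - x12 * (x13 * p)"
    using eqv_diff[OF eqv_diff[OF 1 r(1)] r(3)] by simp
  show "x12 * (x13 * p) \<doteq> - (x13 * (x23 * p)) - x23 * (x12 * p)"
    using eqv_diff[OF eqv_diff[OF 1 r(1)] r(2)] by simp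
  show "x23 * (x13 * p) \<doteq> - (x13 * (x12 * p)) - x12 * (x23 * p)"
    using eqv_diff[OF eqv_diff[OF 2 r(5)] r(6)] by simp
  show "x13 * (x12 * p) \<doteq> - (x23 * (x13 * p)) - x12 * (x23 * p)"
    using eqv_diff[OF eqv_diff[OF 2 r(4)] r(6)] by simp
qed

section \<open>Weight vectors and the relations for squares\<close>

definition homogeneous :: "S3 \<Rightarrow> (gen list \<Rightarrow>\<^sub>0 'k) \<Rightarrow> bool" where
  "homogeneous g p \<longleftrightarrow> p \<in> fcarrier \<and> (\<forall>h. word [Dl h] * p \<doteq> (if h = g then p else 0))"

lemma homogeneous_one: "homogeneous 1 1"
proof -
  have "word [Dl h] * 1 \<doteq> (if h = 1 then 1 else 0)" for h
  proof -
    \<comment> \<open>For the indicator function of \<open>h\<close>, \<open>free_of_fun f\<close>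
      is \<open>\<delta>_h\<close>; moving it across the tensor sign leaves the number
      \<open>f 1\<close>.\<close>
    define f :: "S3 \<Rightarrow> 'k" where "f g = (if g = h then 1 else 0)" for g
    have "free_of_fun f = (\<Sum>g\<in>UNIV. if g = h then word [Dl h] else 0)"
      unfolding free_of_fun_def by (rule sum.cong) (auto simp: f_def)
    then have "free_of_fun f = word [Dl h]" by (simp add: finite_S3)
    then show ?thesis
      using verma_class_fun[OF free_algebra_closed(2), of a 1 f]
      by (auto simp: eqv_def closed f_def word_Nil word_X_closed)
  qed
  then show ?thesis by (simp add: homogeneous_def closed)
qed

lemma homogeneous_X:
  assumes p: "homogeneous g p" and t: "t \<in> O23"
  shows "homogeneous (t * g) (word [X t] * p)"
proof -
  have "word [Dl h] * (word [X t] * p) \<doteq> (if h = t * g then word [X t] * p else 0)" for h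
  proof -
    have c: "p \<in> fcarrier" using p by (simp add: homogeneous_def)
    have "word [Dl h, X t] - word [X t, Dl (t * h)] \<in> relators a"
      using t by (auto simp: relators_def)
    then have "word [Dl h, X t] * p \<doteq> word [X t, Dl (t * h)] * p"
      using c t by (auto intro!: eqv_relator free_algebra_closed simp: gens_def)
    then have "word [Dl h] * (word [X t] * p) \<doteq> word [X t] * (word [Dl (t * h)] * p)"
      by (simp add: word_two)
    also have "\<dots> \<doteq> word [X t] * (if t * h = g then p else 0)"
      using p by (intro eqv_mult word_X_closed t) (auto simp: homogeneous_def)
    finally show ?thesis using t_square(2)[OF t] by (auto split: if_splits)
  qed
  then show ?thesis using p t by (simp add: homogeneous_def closed word_X_closed)
qed

lemma homogeneous_smul: "homogeneous g p \<Longrightarrow> homogeneous g (k \<bullet> p)"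
  using eqv_smul[of "word [Dl h] * p" "if h = g then p else 0" k for h]
  by (auto simp: homogeneous_def closed mult_smul smul_simps if_distrib[of "\<lambda>p. k \<bullet> p"] cong: if_cong)

lemma homogeneous_uminus: "homogeneous g p \<Longrightarrow> homogeneous g (- p)"
  using homogeneous_smul[of g p "-1"] by (simp add: smul_simps)

lemma homogeneous_add:
  assumes "homogeneous g p" "homogeneous g q"
  shows "homogeneous g (p + q)"
  unfolding homogeneous_def
proof (intro conjI allI)
  show "p + q \<in> fcarrier" using assms by (simp add: homogeneous_def closed)
  show "word [Dl h] * (p + q) \<doteq> (if h = g then p + q else 0)" for h
    using assms eqv_add[of "word [Dl h] * p" "if h = g then p else 0" "word [Dl h] * q" "if h = g then q else 0"]
    by (simp add: homogeneous_def distrib_left split: if_splits)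
qed

text \<open>The square of a generator is a function on the group. On a vector of known weight this
  turns that function into a number.\<close>

lemma eqv_free_of_fun:
  assumes p: "homogeneous g p"
  shows "free_of_fun f * p \<doteq> f g \<bullet> p"
proof -
  have "(\<Sum>h\<in>H. Poly_Mapping.single [Dl h] (f h)) * p \<doteq> (\<Sum>h\<in>H. if h = g then f h \<bullet> p else 0)"
    if "finite H" for H
    using that
  proof (induction H)
    case empty
    then show ?case by (simp add: eqv_refl closed)
  next
    case (insert h H)
    have s: "Poly_Mapping.single [Dl h] (f h) = f h \<bullet> word [Dl h]" for h
      by (simp add: smul_def mult_single plus_list_def)
    have "f h \<bullet> (word [Dl h] * p) \<doteq> f h \<bullet> (if h = g then p else 0)"
      using p by (intro eqv_smul) (simp add: homogeneous_def)
    from eqv_add[OF this insert.IH] insert.hyps show ?case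
      by (cases "h = g") (simp_all add: s distrib_right smul_def mult.assoc)
  qed
  from this[OF finite_S3] show ?thesis by (simp add: free_of_fun_def finite_S3)
qed

lemma eqv_square:
  assumes p: "homogeneous g p" and t: "t \<in> O23"
  shows "word [X t] * (word [X t] * p) \<doteq> f_fun a t g \<bullet> p"
proof -
  have "word [X t, X t] - free_of_fun (f_fun a t) \<in> relators a"
    using t by (auto simp: relators_def)
  moreover have "word [X t, X t] \<in> fcarrier"
    using t by (auto intro!: free_algebra_closed simp: gens_def)
  ultimately have "word [X t, X t] * p \<doteq> free_of_fun (f_fun a t) * p"
    using p by (auto intro!: eqv_relator simp: homogeneous_def closed)
  also have "\<dots> \<doteq> f_fun a t g \<bullet> p" by (rule eqv_free_of_fun[OF p])
  finally show ?thesis by (simp add: word_two)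
qed

text \<open>The vectors of the family \<open>M\<close> arise from \<open>x12\<close> by further
  generators. Since \<open>x12\<close> squares to \<open>c\<close> at the weights of
  \<open>bMr\<close> and \<open>bMs\<close>, the factors \<open>1 / c\<close> in \<open>bM13\<close>
  and \<open>bM23\<close> normalise these so that \<open>x12\<close> carries them back to
  \<open>bMr\<close> and \<open>bMs\<close>.\<close>

definition bW where "bW = x12"
definition bMr where "bMr = x23 * bW"
definition bMs where "bMs = x13 * bW"
definition bM13 where "bM13 = (1 / c) \<bullet> (x12 * bMr)"
definition bM23 where "bM23 = (1 / c) \<bullet> (x12 * bMs)"
definition bTop where "bTop = x13 * bM13"
text \<open>The summand \<open>bM13\<close> is dictated by the first three-term relation: applied to
  1 it says that \<open>x13 * bV23\<close> is congruent to \<open>x12 * x13 + bMr\<close>, and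
  \<open>bMr\<close> is congruent to \<open>x12 * bM13\<close>. The sign in \<open>bW'\<close>
  undoes the one in \<open>bV23\<close>, so that \<open>bW'\<close> is the product of
  \<open>x13\<close>, \<open>x12\<close> and \<open>x23\<close>.\<close>

definition bV13 where "bV13 = x13 + bM13"
definition bV23 where "bV23 = - x23"
definition bVr where "bVr = x12 * bV13"
definition bVs where "bVs = x12 * bV23"
definition bW' where "bW' = - (x13 * bVs)"

lemma basis_homogeneous:
  "homogeneous t12 bW" "homogeneous (t13 * t23) bMr" "homogeneous (t23 * t13) bMs"
  "homogeneous t13 bM13" "homogeneous t23 bM23" "homogeneous 1 bTop"
  "homogeneous t13 bV13" "homogeneous t23 bV23" "homogeneous (t13 * t23) bVr"
  "homogeneous (t23 * t13) bVs" "homogeneous t12 bW'"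
proof -
  note X = homogeneous_X[OF _ O23_mem(1), folded x12_def] homogeneous_X[OF _ O23_mem(2), folded x13_def]
    homogeneous_X[OF _ O23_mem(3), folded x23_def]
  have one: "homogeneous t12 x12" "homogeneous t13 x13" "homogeneous t23 x23"
    using X[OF homogeneous_one] by simp_all
  show 1: "homogeneous t12 bW" unfolding bW_def by (rule one)
  show 2: "homogeneous (t13 * t23) bMr" using X(3)[OF 1] by (simp only: bMr_def S3_mult)
  show 3: "homogeneous (t23 * t13) bMs" using X(2)[OF 1] by (simp only: bMs_def S3_mult)
  show 4: "homogeneous t13 bM13"
    using homogeneous_smul[OF X(1)[OF 2]] by (simp only: bM13_def S3_mult)
  show "homogeneous t23 bM23"
    using homogeneous_smul[OF X(1)[OF 3]] by (simp only: bM23_def S3_mult)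
  show "homogeneous 1 bTop" using X(2)[OF 4] by (simp only: bTop_def t_square O23_mem)
  show 5: "homogeneous t13 bV13" unfolding bV13_def by (intro homogeneous_add one 4)
  show 6: "homogeneous t23 bV23" unfolding bV23_def by (intro homogeneous_uminus one)
  show "homogeneous (t13 * t23) bVr" using X(1)[OF 5] by (simp only: bVr_def S3_mult)
  show 7: "homogeneous (t23 * t13) bVs" using X(1)[OF 6] by (simp only: bVs_def S3_mult)
  show "homogeneous t12 bW'"
    using homogeneous_uminus[OF X(2)[OF 7]] by (simp only: bW'_def S3_mult)
qed

lemma basis_closed:
  "bW \<in> fcarrier" "bMr \<in> fcarrier" "bMs \<in> fcarrier" "bM13 \<in> fcarrier" "bM23 \<in> fcarrier"
  "bTop \<in> fcarrier" "bV13 \<in> fcarrier" "bV23 \<in> fcarrier" "bVr \<in> fcarrier" "bVs \<in> fcarrier" "bW' \<in> fcarrier"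
  using basis_homogeneous by (auto simp: homogeneous_def)

lemma eqv_squares:
  assumes "homogeneous g p"
  shows "x12 * (x12 * p) \<doteq> f_fun a t12 g \<bullet> p" "x13 * (x13 * p) \<doteq> f_fun a t13 g \<bullet> p"
    "x23 * (x23 * p) \<doteq> f_fun a t23 g \<bullet> p"
  unfolding x12_def x13_def x23_def by (intro eqv_square assms O23_mem)+

lemma f_fun_c:
  "f_fun a t12 1 = 0" "f_fun a t13 1 = 0" "f_fun a t23 1 = 0"
  "f_fun a t12 t12 = 0" "f_fun a t13 t12 = 0" "f_fun a t23 t12 = 0"
  "f_fun a t12 t13 = c" "f_fun a t13 t13 = 0" "f_fun a t23 t13 = - c"
  "f_fun a t12 t23 = c" "f_fun a t13 t23 = - c" "f_fun a t23 t23 = 0"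
  "f_fun a t12 (t13 * t23) = c" "f_fun a t13 (t13 * t23) = - c" "f_fun a t23 (t13 * t23) = 0"
  "f_fun a t12 (t23 * t13) = c" "f_fun a t13 (t23 * t13) = 0" "f_fun a t23 (t23 * t13) = - c"
  by (simp_all only: f_fun_values a13 c_def) simp_all

lemmas eqv_simps = mult_smul smul_simps

lemma smul_c: "(1 / c) \<bullet> c \<bullet> p = p" "c \<bullet> (1 / c) \<bullet> p = p"
  using c_nonzero by (simp_all add: smul_simps)

text \<open>If the images of \<open>p\<close> under two generators are known, a three-term relation
  gives the image of \<open>p\<close> under a product of two generators. In this way the action on
  one basis vector yields the action on the next.\<close>

lemma eqv_cubic_trans:
  assumes "p \<in> fcarrier"
  shows "\<lbrakk>x23 * p \<doteq> q; x13 * p \<doteq> r\<rbrakk> \<Longrightarrow> x23 * (x12 * p) \<doteq> - (x13 * q) - x12 * r"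
    and "\<lbrakk>x12 * p \<doteq> q; x13 * p \<doteq> r\<rbrakk> \<Longrightarrow> x13 * (x23 * p) \<doteq> - (x23 * q) - x12 * r"
    and "\<lbrakk>x23 * p \<doteq> q; x12 * p \<doteq> r\<rbrakk> \<Longrightarrow> x12 * (x13 * p) \<doteq> - (x13 * q) - x23 * r"
    and "\<lbrakk>x12 * p \<doteq> q; x23 * p \<doteq> r\<rbrakk> \<Longrightarrow> x23 * (x13 * p) \<doteq> - (x13 * q) - x12 * r"
    and "\<lbrakk>x13 * p \<doteq> q; x23 * p \<doteq> r\<rbrakk> \<Longrightarrow> x13 * (x12 * p) \<doteq> - (x23 * q) - x12 * r"
  by (rule eqv_trans, rule eqv_cubic[OF assms], intro eqv_diff eqv_uminus eqv_mult x_closed; assumption)+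

text \<open>Whenever a vector was obtained by applying a generator, applying the same generator
  again is governed by the relation for its square; the other entries come from the three-term
  relations. The last three entries make the span of \<open>bTop\<close> a one-dimensional
  submodule.\<close>

lemma basis_action_M:
  "x12 * bW \<doteq> 0" "x13 * bW \<doteq> bMs" "x23 * bW \<doteq> bMr"
  "x12 * bMr \<doteq> c \<bullet> bM13" "x13 * bMr \<doteq> - (c \<bullet> bM23)" "x23 * bMr \<doteq> 0"
  "x12 * bMs \<doteq> c \<bullet> bM23" "x13 * bMs \<doteq> 0" "x23 * bMs \<doteq> - (c \<bullet> bM13)"
  "x12 * bM13 \<doteq> bMr" "x13 * bM13 \<doteq> bTop" "x23 * bM13 \<doteq> bMs"
  "x12 * bM23 \<doteq> bMs" "x13 * bM23 \<doteq> bMr" "x23 * bM23 \<doteq> bTop"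
  "x12 * bTop \<doteq> 0" "x13 * bTop \<doteq> 0" "x23 * bTop \<doteq> 0"
proof -
  note bc = basis_closed and hom = basis_homogeneous and cub = eqv_cubic_trans
  show W12: "x12 * bW \<doteq> 0"
    using eqv_squares(1)[OF homogeneous_one] by (simp add: bW_def f_fun_c eqv_simps)
  show W13: "x13 * bW \<doteq> bMs" and W23: "x23 * bW \<doteq> bMr"
    by (simp_all add: bMs_def bMr_def eqv_refl closed bc)
  show Mr12: "x12 * bMr \<doteq> c \<bullet> bM13" and Ms12: "x12 * bMs \<doteq> c \<bullet> bM23"
    by (simp_all add: bM13_def bM23_def smul_c eqv_refl closed bc)
  show Mr23: "x23 * bMr \<doteq> 0" and Ms13: "x13 * bMs \<doteq> 0"
    using eqv_squares(2,3)[OF hom(1)] by (simp_all add: bMs_def bMr_def f_fun_c eqv_simps)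
  show M13_12: "x12 * bM13 \<doteq> bMr" and M23_12: "x12 * bM23 \<doteq> bMs"
    using eqv_smul[OF eqv_squares(1)[OF hom(2)], of "1 / c"] eqv_smul[OF eqv_squares(1)[OF hom(3)], of "1 / c"]
    by (simp_all add: bM13_def bM23_def mult_smul smul_c f_fun_c)
  show Mr13: "x13 * bMr \<doteq> - (c \<bullet> bM23)"
    using eqv_trans[OF cub(2)[OF bc(1) W12 W13]] Ms12[THEN eqv_uminus] by (simp add: bMr_def)
  show Ms23: "x23 * bMs \<doteq> - (c \<bullet> bM13)"
    using eqv_trans[OF cub(4)[OF bc(1) W12 W23]] Mr12[THEN eqv_uminus] by (simp add: bMs_def)
  show M13_23: "x23 * bM13 \<doteq> bMs"
    using eqv_smul[OF eqv_trans[OF cub(1)[OF bc(2) Mr23 Mr13]], of "c \<bullet> bMs" "1 / c"] M23_12[THEN eqv_smul, of c]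
    by (simp add: bM13_def mult_smul smul_c smul_simps(7))
  show M23_13: "x13 * bM23 \<doteq> bMr"
    using eqv_smul[OF eqv_trans[OF cub(5)[OF bc(3) Ms13 Ms23]], of "c \<bullet> bMr" "1 / c"] M13_12[THEN eqv_smul, of c]
    by (simp add: bM23_def mult_smul smul_c smul_simps(7))
  show M13_13: "x13 * bM13 \<doteq> bTop" by (simp add: bTop_def eqv_refl closed bc)
  show "x23 * bM23 \<doteq> bTop"
    using eqv_smul[OF eqv_trans[OF cub(1)[OF bc(3) Ms23 Ms13]], of "c \<bullet> bTop" "1 / c"] M13_13[THEN eqv_smul, of c]
    by (simp add: bM23_def mult_smul smul_c smul_simps(7))
  show "x12 * bTop \<doteq> 0"
    using eqv_trans[OF cub(3)[OF bc(4) M13_23 M13_12] eqv_diff[OF eqv_uminus[OF Ms13] Mr23]]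
    by (simp add: bTop_def)
  show "x13 * bTop \<doteq> 0"
    using eqv_squares(2)[OF hom(4)] by (simp add: bTop_def f_fun_c eqv_simps)
  show "x23 * bTop \<doteq> 0"
    using eqv_trans[OF cub(4)[OF bc(4) M13_12 M13_23] eqv_diff[OF eqv_uminus[OF Mr13] Ms12]]
    by (simp add: bTop_def)
qed

text \<open>The table has the shape of the one for the family \<open>M\<close> except in three
  places: \<open>x23 * bVr\<close> and \<open>x13 * bVs\<close> reach \<open>bW'\<close> instead of
  vanishing, and \<open>x23 * bV23\<close> vanishes instead of reaching \<open>bTop\<close>. The
  entries with \<open>bW'\<close> lead from the weights of \<open>L\<close> to the weight
  \<open>t12\<close>.\<close>

lemma basis_action_V:
  "x12 * bV13 \<doteq> bVr" "x13 * bV13 \<doteq> bTop" "x23 * bV13 \<doteq> bVs"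
  "x12 * bV23 \<doteq> bVs" "x13 * bV23 \<doteq> bVr" "x23 * bV23 \<doteq> 0"
  "x12 * bVr \<doteq> c \<bullet> bV13" "x13 * bVr \<doteq> - (c \<bullet> bV23)" "x23 * bVr \<doteq> bW'"
  "x12 * bVs \<doteq> c \<bullet> bV23" "x13 * bVs \<doteq> - bW'" "x23 * bVs \<doteq> - (c \<bullet> bV13)"
  "x12 * bW' \<doteq> - (c \<bullet> bTop)" "x13 * bW' \<doteq> 0" "x23 * bW' \<doteq> 0"
proof -
  note bc = basis_closed and hom = basis_homogeneous and cub = eqv_cubic_trans
  have one: "x12 * 1 \<doteq> bW" "x13 * 1 \<doteq> x13" "x23 * 1 \<doteq> x23"
    by (simp_all add: bW_def eqv_refl closed)
  show V13_12: "x12 * bV13 \<doteq> bVr" and V23_12: "x12 * bV23 \<doteq> bVs"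
    by (simp_all add: bVr_def bVs_def eqv_refl closed bc)
  show Vs13: "x13 * bVs \<doteq> - bW'" by (simp add: bW'_def eqv_refl closed bc)
  show V13_13: "x13 * bV13 \<doteq> bTop"
    using eqv_add[OF eqv_squares(2)[OF homogeneous_one] basis_action_M(11)]
    by (simp add: bV13_def f_fun_c eqv_simps distrib_left)
  show V23_23: "x23 * bV23 \<doteq> 0"
    using eqv_uminus[OF eqv_squares(3)[OF homogeneous_one]] by (simp add: bV23_def f_fun_c eqv_simps)
  show Vr12: "x12 * bVr \<doteq> c \<bullet> bV13" and Vs12: "x12 * bVs \<doteq> c \<bullet> bV23"
    using eqv_squares(1)[OF hom(7)] eqv_squares(1)[OF hom(8)] by (simp_all add: bVr_def bVs_def f_fun_c)
  show V23_13: "x13 * bV23 \<doteq> bVr"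
  proof -
    have "x13 * bV23 \<doteq> x23 * bW + x12 * x13"
      using eqv_uminus[OF cub(2)[OF closed(2) one(1,2)]] by (simp add: bV23_def add.commute)
    also have "\<dots> \<doteq> x12 * bM13 + x12 * x13"
      using basis_action_M(3,10) by (intro eqv_add) (auto intro: eqv_trans eqv_sym eqv_refl simp: closed)
    finally show ?thesis by (simp add: bVr_def bV13_def distrib_left add.commute)
  qed
  \<comment> \<open>The term \<open>x13\<close> alone would leave an additional
    \<open>- bMs\<close>, which cancels against \<open>x23 * bM13\<close>.\<close>
  show V13_23: "x23 * bV13 \<doteq> bVs"
  proof -
    have "x23 * bV13 \<doteq> (- (x13 * bW) - x12 * x23) + x23 * bM13"
      using eqv_add[OF cub(4)[OF closed(2) one(1,3)] eqv_refl[of "x23 * bM13"]]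
      by (simp add: bV13_def distrib_left closed bc)
    also have "\<dots> \<doteq> (- bMs - x12 * x23) + bMs"
      using basis_action_M(2,12) by (intro eqv_add eqv_diff eqv_uminus eqv_refl) (auto simp: closed)
    finally show ?thesis by (simp add: bVs_def bV23_def)
  qed
  \<comment> \<open>Besides \<open>x12 * bV13\<close>, the vector \<open>bVr\<close> is also
    \<open>x13 * bV23\<close>; in this second form the relation for the square of \<open>x13\<close>
    applies.\<close>
  show Vr13: "x13 * bVr \<doteq> - (c \<bullet> bV23)"
    using eqv_trans[OF eqv_mult[OF x_closed(2) eqv_sym[OF V23_13]] eqv_squares(2)[OF hom(8)]]
    by (simp add: f_fun_c smul_simps)
  show Vs23: "x23 * bVs \<doteq> - (c \<bullet> bV13)"
    using eqv_trans[OF eqv_mult[OF x_closed(3) eqv_sym[OF V13_23]] eqv_squares(3)[OF hom(7)]]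
    by (simp add: f_fun_c smul_simps)
  show "x23 * bVr \<doteq> bW'"
    using eqv_trans[OF eqv_mult[OF x_closed(3) eqv_sym[OF V23_13]] cub(4)[OF bc(8) V23_12 V23_23]]
    by (simp add: bW'_def)
  show "x13 * bW' \<doteq> 0"
    using eqv_uminus[OF eqv_squares(2)[OF hom(10)]] by (simp add: bW'_def f_fun_c eqv_simps)
  \<comment> \<open>Both products on the right are \<open>c\<close> times \<open>bVr\<close>, with
    opposite signs, so their sum vanishes.\<close>
  have "x23 * (x13 * bVs) \<doteq> - (c \<bullet> (x13 * bV23)) + c \<bullet> (x12 * bV13)"
    using cub(4)[OF bc(10) Vs12 Vs23] by (simp add: mult_smul)
  from eqv_trans[OF this eqv_add[OF eqv_uminus[OF eqv_smul[OF V23_13]] eqv_smul[OF V13_12]]]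
  show "x23 * bW' \<doteq> 0" using eqv_uminus[of _ 0] by (simp add: bW'_def)
  have "x12 * (x13 * bVs) \<doteq> c \<bullet> (x13 * bV13) - c \<bullet> (x23 * bV23)"
    using cub(3)[OF bc(10) Vs23 Vs12] by (simp add: mult_smul)
  from eqv_uminus[OF eqv_trans[OF this eqv_diff[OF eqv_smul[OF V13_13] eqv_smul[OF V23_23]]]]
  show "x12 * bW' \<doteq> - (c \<bullet> bTop)" by (simp add: bW'_def smul_simps)
qed


definition vec :: "(ix \<Rightarrow> 'k) \<Rightarrow> (gen list \<Rightarrow>\<^sub>0 'k)" where
  "vec u = u E \<bullet> 1 + (u Top \<bullet> bTop + (u W \<bullet> bW + (u W' \<bullet> bW' + (u V13 \<bullet> bV13 + (u V23 \<bullet> bV23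
     + (u Vr \<bullet> bVr + (u Vs \<bullet> bVs + (u M13 \<bullet> bM13 + (u M23 \<bullet> bM23 + (u Mr \<bullet> bMr + u Ms \<bullet> bMs))))))))))"

lemma vec_closed: "vec u \<in> fcarrier"
  by (simp add: vec_def closed basis_closed)

lemma vec_add: "vec (u + v) = vec u + vec v"
  by (simp add: vec_def smul_simps algebra_simps)

lemma vec_scale: "vec (scale k u) = k \<bullet> vec u"
  by (simp add: vec_def smul_simps)

text \<open>The action tables evaluate a generator on each of the twelve summands; collecting
  coefficients yields the model action. A \<open>\<delta>_h\<close> keeps or kills each summand
  according to its weight.\<close>

lemma word_vec:
  assumes "x \<in> gens"
  shows "word [x] * vec u \<doteq> vec (model_act c x u)"
proof -
  have one: "x12 * 1 \<doteq> bW" "x13 * 1 \<doteq> bV13 - bM13" "x23 * 1 \<doteq> - bV23"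
    by (simp_all add: bW_def bV13_def bV23_def eqv_refl closed)
  have "x12 * vec u \<doteq> vec (act12 c u)"
  proof -
    have "x12 * vec u \<doteq> u E \<bullet> bW + (u Top \<bullet> 0 + (u W \<bullet> 0 + (u W' \<bullet> (- (c \<bullet> bTop)) + (u V13 \<bullet> bVr
        + (u V23 \<bullet> bVs + (u Vr \<bullet> c \<bullet> bV13 + (u Vs \<bullet> c \<bullet> bV23 + (u M13 \<bullet> bMr + (u M23 \<bullet> bMs
        + (u Mr \<bullet> c \<bullet> bM13 + u Ms \<bullet> c \<bullet> bM23))))))))))"
      unfolding vec_def distrib_left mult_smul
      by (intro eqv_add eqv_smul basis_action_M basis_action_V one)
    then show ?thesis by (simp add: vec_def act12_def smul_simps ac_simps)
  qed
  moreover have "x13 * vec u \<doteq> vec (act13 c u)"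
  proof -
    have "x13 * vec u \<doteq> u E \<bullet> (bV13 - bM13) + (u Top \<bullet> 0 + (u W \<bullet> bMs + (u W' \<bullet> 0 + (u V13 \<bullet> bTop
        + (u V23 \<bullet> bVr + (u Vr \<bullet> (- (c \<bullet> bV23)) + (u Vs \<bullet> (- bW') + (u M13 \<bullet> bTop + (u M23 \<bullet> bMr
        + (u Mr \<bullet> (- (c \<bullet> bM23)) + u Ms \<bullet> 0))))))))))"
      unfolding vec_def distrib_left mult_smul
      by (intro eqv_add eqv_smul basis_action_M basis_action_V one)
    then show ?thesis by (simp add: vec_def act13_def smul_simps algebra_simps)
  qed
  moreover have "x23 * vec u \<doteq> vec (act23 c u)"
  proof -
    have "x23 * vec u \<doteq> u E \<bullet> (- bV23) + (u Top \<bullet> 0 + (u W \<bullet> bMr + (u W' \<bullet> 0 + (u V13 \<bullet> bVs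
        + (u V23 \<bullet> 0 + (u Vr \<bullet> bW' + (u Vs \<bullet> (- (c \<bullet> bV13)) + (u M13 \<bullet> bMs + (u M23 \<bullet> bTop
        + (u Mr \<bullet> 0 + u Ms \<bullet> (- (c \<bullet> bM13))))))))))))"
      unfolding vec_def distrib_left mult_smul
      by (intro eqv_add eqv_smul basis_action_M basis_action_V one)
    then show ?thesis by (simp add: vec_def act23_def smul_simps algebra_simps)
  qed
  moreover have "word [Dl h] * vec u \<doteq> vec (model_act c (Dl h) u)" for h
  proof -
    have hom: "word [Dl h] * p \<doteq> (if g = h then 1 else 0) \<bullet> p" if "homogeneous g p" for g p
      using that[unfolded homogeneous_def, THEN conjunct2, rule_format, of h]
      by (cases "g = h") (simp_all add: smul_simps)
    have "word [Dl h] * vec u \<doteq> u E \<bullet> (if wt E = h then 1 else 0) \<bullet> 1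
      + (u Top \<bullet> (if wt Top = h then 1 else 0) \<bullet> bTop + (u W \<bullet> (if wt W = h then 1 else 0) \<bullet> bW
      + (u W' \<bullet> (if wt W' = h then 1 else 0) \<bullet> bW' + (u V13 \<bullet> (if wt V13 = h then 1 else 0) \<bullet> bV13
      + (u V23 \<bullet> (if wt V23 = h then 1 else 0) \<bullet> bV23 + (u Vr \<bullet> (if wt Vr = h then 1 else 0) \<bullet> bVr
      + (u Vs \<bullet> (if wt Vs = h then 1 else 0) \<bullet> bVs + (u M13 \<bullet> (if wt M13 = h then 1 else 0) \<bullet> bM13
      + (u M23 \<bullet> (if wt M23 = h then 1 else 0) \<bullet> bM23 + (u Mr \<bullet> (if wt Mr = h then 1 else 0) \<bullet> bMr
      + u Ms \<bullet> (if wt Ms = h then 1 else 0) \<bullet> bMs))))))))))"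
      unfolding vec_def distrib_left mult_smul wt.simps
      by (intro eqv_add eqv_smul hom basis_homogeneous homogeneous_one)
    moreover have "(if wt i = h then u i else 0) = u i * (if wt i = h then 1 else 0)" for i by simp
    ultimately show ?thesis unfolding vec_def model_act.simps by (simp only: smul_simps)
  qed
  ultimately show ?thesis
    using assms by (auto simp: gens_def O23_def model_act_X x12_def x13_def x23_def simp del: model_act.simps)
qed

text \<open>This gives more than spanning: the coordinates of \<open>p\<close> are obtained by
  letting \<open>p\<close> act on the unit vector \<open>E\<close> of the model, which stands for
  \<open>1 \<otimes> 1\<close>.\<close>

lemma eqv_vec:
  assumes "p \<in> fcarrier"
  shows "p \<doteq> vec (poly_act (model_act c) p (unit_vec E))"
  using assms
proof (induction p rule: free_algebra_induct)
  case (scalar k)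
  have "vec (unit_vec E) = 1" by (simp add: vec_def unit_vec_def smul_simps)
  then have "vec (scale k (unit_vec E)) = Poly_Mapping.single [] k" by (simp only: vec_scale smul_def mult_1_right)
  then show ?case
    by (simp only: poly_act_single foldr.simps id_apply) (simp add: eqv_refl free_algebra_closed)
next
  case (gen x p)
  then have "word [x] * p \<doteq> word [x] * vec (poly_act (model_act c) p (unit_vec E))"
    by (intro eqv_mult free_algebra_closed) auto
  also have "\<dots> \<doteq> vec (model_act c x (poly_act (model_act c) p (unit_vec E)))"
    by (rule word_vec[OF gen(1)])
  finally show ?case by (simp add: model.poly_act_single_mult scale_simps)
next
  case (add p q)
  then show ?case by (simp only: poly_act_add vec_add eqv_add)
qed

section \<open>Linear independence and the identification with the model\<close>

definition verma_of_vec :: "(ix \<Rightarrow> 'k) \<Rightarrow> ((gen list \<Rightarrow>\<^sub>0 'k) set \<times> 'k \<Rightarrow>\<^sub>0 int) set" where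
  "verma_of_vec u = verma_class a 1 (vec u)"

text \<open>The coordinates found in \<open>eqv_vec\<close> depend only on the class of
  \<open>p\<close>: in the model the relators vanish and \<open>unit_vec E\<close> has weight 1, so
  the universal property provides a map from the Verma module.\<close>

lemma poly_act_eq:
  assumes "p \<doteq> q"
  shows "poly_act (model_act c) p (unit_vec E) = poly_act (model_act c) q (unit_vec E)"
proof (rule poly_act_eq_if_verma_class_eq[OF linear_model_act])
  show "poly_act (model_act c) p u = 0" if "p \<in> relators a" for p u
    using poly_act_relators[OF a13 that] by (simp add: c_def)
  show "poly_act (model_act c) (free_of_fun f) (unit_vec E) = scale (f 1) (unit_vec E)" for f
    by (auto simp: fun_eq_iff poly_act_free_of_fun unit_vec_def)
qed (use assms in \<open>auto simp: eqv_def\<close>)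

lemma poly_act_x:
  "poly_act (model_act c) (x12 * p) u = act12 c (poly_act (model_act c) p u)"
  "poly_act (model_act c) (x13 * p) u = act13 c (poly_act (model_act c) p u)"
  "poly_act (model_act c) (x23 * p) u = act23 c (poly_act (model_act c) p u)"
  "poly_act (model_act c) (k \<bullet> p) u = scale k (poly_act (model_act c) p u)"
  by (simp_all add: x12_def x13_def x23_def smul_def model.poly_act_single_mult scale_simps model_act_X)

text \<open>Each representative yields its own unit vector when it acts on \<open>E\<close>. By
  linearity \<open>poly_act\<close> is therefore a left inverse of \<open>vec\<close>, and
  \<open>vec\<close> remains injective modulo congruence.\<close>

lemma poly_act_basis:
  "poly_act (model_act c) bW (unit_vec E) = unit_vec W"
  "poly_act (model_act c) bW' (unit_vec E) = unit_vec W'"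
  "poly_act (model_act c) bTop (unit_vec E) = unit_vec Top"
  "poly_act (model_act c) bV13 (unit_vec E) = unit_vec V13"
  "poly_act (model_act c) bV23 (unit_vec E) = unit_vec V23"
  "poly_act (model_act c) bVr (unit_vec E) = unit_vec Vr"
  "poly_act (model_act c) bVs (unit_vec E) = unit_vec Vs"
  "poly_act (model_act c) bM13 (unit_vec E) = unit_vec M13"
  "poly_act (model_act c) bM23 (unit_vec E) = unit_vec M23"
  "poly_act (model_act c) bMr (unit_vec E) = unit_vec Mr"
  "poly_act (model_act c) bMs (unit_vec E) = unit_vec Ms"
proof -
  note simps = fun_eq_iff all_ix act_defs unit_vec_def c_nonzero
  have 0: "poly_act (model_act c) x12 u = act12 c u" "poly_act (model_act c) x13 u = act13 c u"
    "poly_act (model_act c) x23 u = act23 c u" for u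
    using poly_act_x(1-3)[of 1] by (simp_all add: poly_act_one)
  show 1: "poly_act (model_act c) bW (unit_vec E) = unit_vec W"
    by (simp add: bW_def 0) (simp add: simps)
  show 2: "poly_act (model_act c) bMr (unit_vec E) = unit_vec Mr"
    by (simp add: bMr_def poly_act_x 1) (simp add: simps)
  show 3: "poly_act (model_act c) bMs (unit_vec E) = unit_vec Ms"
    by (simp add: bMs_def poly_act_x 1) (simp add: simps)
  show 4: "poly_act (model_act c) bM13 (unit_vec E) = unit_vec M13"
    by (simp add: bM13_def poly_act_x 2) (simp add: simps)
  show "poly_act (model_act c) bM23 (unit_vec E) = unit_vec M23"
    by (simp add: bM23_def poly_act_x 3) (simp add: simps)
  show "poly_act (model_act c) bTop (unit_vec E) = unit_vec Top"
    by (simp add: bTop_def poly_act_x 4) (simp add: simps)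
  show 5: "poly_act (model_act c) bV13 (unit_vec E) = unit_vec V13"
    by (simp add: bV13_def poly_act_add 0 4) (simp add: simps)
  show 6: "poly_act (model_act c) bV23 (unit_vec E) = unit_vec V23"
    by (simp add: bV23_def poly_act_uminus 0) (simp add: simps)
  show "poly_act (model_act c) bVr (unit_vec E) = unit_vec Vr"
    by (simp add: bVr_def poly_act_x 5) (simp add: simps)
  show 7: "poly_act (model_act c) bVs (unit_vec E) = unit_vec Vs"
    by (simp add: bVs_def poly_act_x 6) (simp add: simps)
  show "poly_act (model_act c) bW' (unit_vec E) = unit_vec W'"
    by (simp add: bW'_def poly_act_uminus poly_act_x 7) (simp add: simps)
qed

lemma poly_act_vec: "poly_act (model_act c) (vec u) (unit_vec E) = u"
  unfolding vec_def poly_act_add poly_act_x(4) poly_act_basis poly_act_one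
  by (simp add: fun_eq_iff all_ix unit_vec_def)

lemma verma_of_vec_bij: "bij_betw verma_of_vec UNIV (carrier (verma a 1))"
proof (rule bij_betwI')
  fix u v
  show "verma_of_vec u = verma_of_vec v \<longleftrightarrow> u = v"
  proof
    assume "verma_of_vec u = verma_of_vec v"
    then have "vec u \<doteq> vec v" by (simp add: eqv_def vec_closed verma_of_vec_def)
    from poly_act_eq[OF this] show "u = v" by (simp add: poly_act_vec)
  qed simp
  show "verma_of_vec u \<in> carrier (verma a 1)"
    by (simp add: verma_of_vec_def verma_class_closed vec_closed)
next
  fix y assume "y \<in> carrier (verma a 1)"
  then obtain p where "p \<in> fcarrier" "y = verma_class a 1 p" using verma_class_surj by blast
  then show "\<exists>u\<in>UNIV. y = verma_of_vec u"
    using eqv_vec[of p] by (auto simp: eqv_def verma_of_vec_def)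
qed

lemma verma_of_vec_add: "verma_of_vec (u + v) = verma_of_vec u \<oplus>\<^bsub>verma a 1\<^esub> verma_of_vec v"
  by (simp add: verma_of_vec_def vec_add verma_class_add vec_closed)

lemma verma_of_vec_zero: "verma_of_vec 0 = \<zero>\<^bsub>verma a 1\<^esub>"
  using vec_scale[of 0 0] by (simp add: verma_of_vec_def scale_simps smul_simps verma_class_zero)

lemma verma_class_eq_verma_of_vec:
  "p \<in> fcarrier \<Longrightarrow> verma_class a 1 p = verma_of_vec (poly_act (model_act c) p (unit_vec E))"
  using eqv_vec by (simp add: eqv_def verma_of_vec_def)

lemma smult_verma_of_vec:
  assumes "p \<in> fcarrier"
  shows "alg_class a p \<odot>\<^bsub>verma a 1\<^esub> verma_of_vec u = verma_of_vec (poly_act (model_act c) p u)"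
  using verma_class_mult[OF assms vec_closed, of a 1 u] verma_class_eq_verma_of_vec[of "p * vec u"] assms
  by (simp add: verma_of_vec_def closed vec_closed model.poly_act_mult poly_act_vec)

text \<open>The factor \<open>c\<close> at \<open>Top\<close> compensates the normalisation by
  \<open>1 / c\<close> that \<open>bTop\<close> inherits from \<open>bM13\<close>.\<close>

lemma verma_vec_eq_verma_of_vec:
  "verma_vec a 1 [t23, t12] = verma_of_vec (unit_vec Mr)"
  "verma_vec a 1 [t13, t12, t23] = verma_of_vec (unit_vec W')"
  "verma_vec a 1 [t13, t12, t23, t12] = verma_of_vec (scale c (unit_vec Top))"
proof -
  have *: "verma_vec a 1 ts = verma_of_vec (foldr (model_act c) (map X ts) (unit_vec E))" if "set ts \<subseteq> O23" for ts
  proof -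
    have "word (map X ts) \<in> fcarrier" using that by (auto intro!: free_algebra_closed(7) simp: gens_def subset_iff)
    then show ?thesis
      by (simp add: verma_vec_eq[OF that] verma_class_eq_verma_of_vec poly_act_single scale_simps)
  qed
  show "verma_vec a 1 [t23, t12] = verma_of_vec (unit_vec Mr)"
    "verma_vec a 1 [t13, t12, t23] = verma_of_vec (unit_vec W')"
    "verma_vec a 1 [t13, t12, t23, t12] = verma_of_vec (scale c (unit_vec Top))"
    by (subst *; simp add: O23_def model_act_X; intro arg_cong[of _ _ verma_of_vec];
      simp add: fun_eq_iff all_ix act_defs unit_vec_def)+
qed

end

section \<open>Submodules of the coordinate model\<close>

definition linear_subspace :: "('i \<Rightarrow> 'k::comm_ring_1) set \<Rightarrow> bool" where
  "linear_subspace V \<longleftrightarrow> 0 \<in> V \<and> (\<forall>u\<in>V. \<forall>v\<in>V. u + v \<in> V) \<and> (\<forall>k. \<forall>u\<in>V. scale k u \<in> V)"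

definition model_submodule :: "'k::field \<Rightarrow> (ix \<Rightarrow> 'k) set \<Rightarrow> bool" where
  "model_submodule c V \<longleftrightarrow> linear_subspace V \<and> (\<forall>x\<in>gens. \<forall>u\<in>V. model_act c x u \<in> V)"

text \<open>The subspaces of the plane: \<open>Line k\<close> has slope \<open>k\<close>, and \<open>Vertical\<close> is the axis \<open>x = 0\<close>.\<close>

datatype 'k plane = Zero | Vertical | Line 'k | Full

fun in_plane :: "'k::field plane \<Rightarrow> 'k \<Rightarrow> 'k \<Rightarrow> bool" where
  "in_plane Zero x y \<longleftrightarrow> x = 0 \<and> y = 0"
| "in_plane Vertical x y \<longleftrightarrow> x = 0"
| "in_plane (Line k) x y \<longleftrightarrow> y = k * x"
| "in_plane Full x y \<longleftrightarrow> True"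

text \<open>Inclusion of subspaces of the plane as a rule on constructors, so that comparing
  submodules becomes a case distinction.\<close>

fun plane_le :: "'k plane \<Rightarrow> 'k plane \<Rightarrow> bool" where
  "plane_le Zero l \<longleftrightarrow> True"
| "plane_le Vertical l \<longleftrightarrow> l = Vertical \<or> l = Full"
| "plane_le (Line k) l \<longleftrightarrow> l = Line k \<or> l = Full"
| "plane_le Full l \<longleftrightarrow> l = Full"

lemma in_plane_zero: "in_plane l 0 0"
  by (cases l) auto

lemma in_plane_add: "in_plane l x y \<Longrightarrow> in_plane l x' y' \<Longrightarrow> in_plane l (x + x') (y + y')"
  by (cases l) (auto simp: algebra_simps)

lemma in_plane_mult: "in_plane l x y \<Longrightarrow> in_plane l (k * x) (k * y)"
  by (cases l) auto

lemma plane_le_iff: "plane_le l l' \<longleftrightarrow> (\<forall>x y. in_plane l x y \<longrightarrow> in_plane l' x y)"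
proof -
  have "(1::'a) \<noteq> 0" by simp
  then show ?thesis
    by (cases l; cases l'; simp; metis mult_zero_left mult_zero_right mult_1_right)
qed

text \<open>Two questions classify the subspaces: whether some vector has first coordinate 1, and
  whether some nonzero vector has first coordinate 0.\<close>

lemma plane_cases:
  fixes p :: "'k::field \<Rightarrow> 'k \<Rightarrow> bool"
  assumes zero: "p 0 0" and add: "\<And>x y x' y'. p x y \<Longrightarrow> p x' y' \<Longrightarrow> p (x + x') (y + y')"
    and mult: "\<And>k x y. p x y \<Longrightarrow> p (k * x) (k * y)"
  obtains l where "p = in_plane l"
proof (cases "\<exists>y. p 1 y")
  case True
  then obtain k where k: "p 1 k" ..
  show ?thesis
  proof (cases "\<exists>y. y \<noteq> 0 \<and> p 0 y")
    case True
    then obtain z where z: "z \<noteq> 0" "p 0 z" by blast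
    have "p x y" for x y
      using add[OF mult[OF k, of x] mult[OF z(2), of "(y - x * k) / z"]] z(1) by simp
    then show ?thesis by (intro that[of Full]) (simp add: fun_eq_iff)
  next
    case False
    have "y = k * x" if "p x y" for x y
    proof -
      have "p 0 (y - k * x)" using add[OF that mult[OF k, of "- x"]] by (simp add: algebra_simps)
      then have "y - k * x = 0" using False by blast
      then show ?thesis by simp
    qed
    then show ?thesis
      using mult[OF k] by (intro that[of "Line k"]) (force simp: fun_eq_iff mult.commute)
  qed
next
  case False
  have x0: "x = 0" if "p x y" for x y
    using mult[OF that, of "1 / x"] False by (cases "x = 0") auto
  show ?thesis
  proof (cases "\<exists>y. y \<noteq> 0 \<and> p 0 y")
    case True
    then obtain z where z: "z \<noteq> 0" "p 0 z" by blast
    have "p 0 y" for y using mult[OF z(2), of "y / z"] z(1) by simp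
    then show ?thesis using x0 by (intro that[of Vertical]) (auto simp: fun_eq_iff)
  next
    case False
    then show ?thesis using x0 zero by (intro that[of Zero]) (auto simp: fun_eq_iff)
  qed
qed

text \<open>The coordinate at \<open>Top\<close> is left free, so every layer contains the line of
  \<open>Top\<close>.\<close>

definition layer :: "'k::field plane \<Rightarrow> 'k plane \<Rightarrow> (ix \<Rightarrow> 'k) set" where
  "layer l m = {u. u E = 0 \<and> in_plane m (u W) (u W') \<and> in_plane l (u V13) (u M13) \<and>
     in_plane l (u V23) (u M23) \<and> in_plane l (u Vr) (u Mr) \<and> in_plane l (u Vs) (u Ms)}"

lemma layer_subspace: "linear_subspace (layer l m)"
  by (auto simp: linear_subspace_def layer_def in_plane_zero in_plane_add in_plane_mult)

text \<open>Between the weight \<open>t12\<close> and the other four, generators only move a first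
  coordinate into a second one: \<open>W\<close> into \<open>Mr\<close> and \<open>Ms\<close>, and
  \<open>Vr\<close> and \<open>Vs\<close>, up to sign, into \<open>W'\<close>. The two hypotheses
  absorb exactly these contributions.\<close>

lemma layer_submodule:
  assumes l: "\<And>x y. in_plane l x y \<Longrightarrow> in_plane m 0 x" and m: "\<And>x y. in_plane m x y \<Longrightarrow> in_plane l 0 x"
  shows "model_submodule c (layer l m)"
  unfolding model_submodule_def
proof (intro conjI ballI layer_subspace)
  have neg: "in_plane l (- x) (- y)" if "in_plane l x y" for l and x y :: 'a
    using in_plane_mult[OF that, of "-1"] by simp
  have neg': "in_plane l (- (k * x)) (- (k * y))" if "in_plane l x y" for l and k x y :: 'a
    by (rule neg[OF in_plane_mult[OF that]])
  have l': "in_plane m 0 (- x)" if "in_plane l x y" for x y using neg[OF l[OF that]] by simp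
  fix x u assume "x \<in> gens" and u: "u \<in> layer l m"
  then consider h where "x = Dl h" | "x = X t12" | "x = X t13" | "x = X t23" by (auto simp: gens_def O23_def)
  then show "model_act c x u \<in> layer l m"
  proof cases
    case 1
    show ?thesis using u unfolding 1 layer_def by (auto simp: in_plane_zero)
  qed (use u in \<open>auto simp: layer_def model_act_X act_defs in_plane_zero in_plane_mult neg' intro: l' m l\<close>)
qed

lemma layer_subset_iff: "layer l m \<subseteq> layer l' m' \<longleftrightarrow> plane_le l l' \<and> plane_le m m'"
proof
  assume *: "layer l m \<subseteq> layer l' m'"
  have "in_plane l' x y \<and> in_plane m' x' y'" if "in_plane l x y" "in_plane m x' y'" for x y x' y'
  proof -
    \<comment> \<open>The vector with coordinates \<open>(x, y)\<close> at each of the four weights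
      and \<open>(x', y')\<close> at \<open>t12\<close> tests both inclusions at once.\<close>
    have "case_ix 0 0 x' y' x x x x y y y y \<in> layer l m" using that by (simp add: layer_def)
    then have "case_ix 0 0 x' y' x x x x y y y y \<in> layer l' m'" using * by blast
    then show ?thesis by (simp add: layer_def)
  qed
  then show "plane_le l l' \<and> plane_le m m'"
    using in_plane_zero unfolding plane_le_iff by blast
qed (auto simp: layer_def plane_le_iff)

text \<open>Names follow the theorem: \<open>NN\<close> is the largest one, \<open>NP\<close> and
  \<open>NQ\<close> are generated by the weight spaces at \<open>(13)(23)\<close> and
  \<open>(12)\<close>, \<open>N2\<close> and \<open>N3\<close> by the vectors with two and three
  factors, \<open>NPQ\<close> by both of these, \<open>NT\<close> is the line of the top vector, and
  \<open>NV k\<close> and \<open>NW k\<close> are generated by a vector \<open>v\<close> or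
  \<open>w\<close> of slope \<open>k\<close>.\<close>

datatype 'k node = NN | NP | NQ | NPQ | N3 | N2 | NT | NV 'k | NW 'k

primrec node_set :: "'k::field node \<Rightarrow> (ix \<Rightarrow> 'k) set" where
  "node_set NN = layer Full Full"
| "node_set NP = layer Full Vertical"
| "node_set NQ = layer Vertical Full"
| "node_set NPQ = layer Vertical Vertical"
| "node_set N3 = layer Zero Vertical"
| "node_set N2 = layer Vertical Zero"
| "node_set NT = layer Zero Zero"
| "node_set (NV k) = layer (Line k) Vertical"
| "node_set (NW k) = layer Vertical (Line k)"

lemma node_set_submodule: "model_submodule c (node_set n)"
  by (cases n) (auto intro!: layer_submodule)

definition pair_vec :: "ix \<Rightarrow> ix \<Rightarrow> 'k::field \<Rightarrow> 'k \<Rightarrow> ix \<Rightarrow> 'k" where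
  "pair_vec i j x y = scale x (unit_vec i) + scale y (unit_vec j)"

lemma model_act_pair_vec:
  "act12 c (pair_vec E Top x y) = pair_vec W W' x 0"
  "act13 c (pair_vec E Top x y) = pair_vec V13 M13 x (- x)"
  "act23 c (pair_vec E Top x y) = pair_vec V23 M23 (- x) 0"
  "act12 c (pair_vec W W' x y) = pair_vec E Top 0 (- c * y)"
  "act13 c (pair_vec W W' x y) = pair_vec Vs Ms 0 x"
  "act23 c (pair_vec W W' x y) = pair_vec Vr Mr 0 x"
  "act12 c (pair_vec V13 M13 x y) = pair_vec Vr Mr x y"
  "act13 c (pair_vec V13 M13 x y) = pair_vec E Top 0 (x + y)"
  "act23 c (pair_vec V13 M13 x y) = pair_vec Vs Ms x y"
  "act12 c (pair_vec V23 M23 x y) = pair_vec Vs Ms x y"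
  "act13 c (pair_vec V23 M23 x y) = pair_vec Vr Mr x y"
  "act23 c (pair_vec V23 M23 x y) = pair_vec E Top 0 y"
  "act12 c (pair_vec Vr Mr x y) = pair_vec V13 M13 (c * x) (c * y)"
  "act13 c (pair_vec Vr Mr x y) = pair_vec V23 M23 (- c * x) (- c * y)"
  "act23 c (pair_vec Vr Mr x y) = pair_vec W W' 0 x"
  "act12 c (pair_vec Vs Ms x y) = pair_vec V23 M23 (c * x) (c * y)"
  "act13 c (pair_vec Vs Ms x y) = pair_vec W W' 0 (- x)"
  "act23 c (pair_vec Vs Ms x y) = pair_vec V13 M13 (- c * x) (- c * y)"
  by (simp_all add: fun_eq_iff all_ix unit_vec_def pair_vec_def act_defs)

lemma pair_vec_simps:
  "scale k (pair_vec i j x y) = pair_vec i j (k * x) (k * y)"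
  "pair_vec i j x y + pair_vec i j x' y' = pair_vec i j (x + x') (y + y')"
  "pair_vec i j 0 0 = 0"
  by (simp_all add: fun_eq_iff pair_vec_def algebra_simps)

lemma pair_vec_expansion:
  "u = pair_vec E Top (u E) (u Top) + pair_vec W W' (u W) (u W') + pair_vec V13 M13 (u V13) (u M13)
     + pair_vec V23 M23 (u V23) (u M23) + pair_vec Vr Mr (u Vr) (u Mr) + pair_vec Vs Ms (u Vs) (u Ms)"
  by (simp add: fun_eq_iff all_ix pair_vec_def unit_vec_def)

lemma one_neq: "(1 :: S3) \<noteq> t12" "(1 :: S3) \<noteq> t13" "(1 :: S3) \<noteq> t23"
  "(1 :: S3) \<noteq> t13 * t23" "(1 :: S3) \<noteq> t23 * t13"
  by (simp_all only: perm_eq_iff apply_times o_apply forall_three apply_t apply_one id_apply three_neq simp_thms)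

lemma model_act_delta_pair:
  "model_act c (Dl 1) u = pair_vec E Top (u E) (u Top)"
  "model_act c (Dl t12) u = pair_vec W W' (u W) (u W')"
  "model_act c (Dl t13) u = pair_vec V13 M13 (u V13) (u M13)"
  "model_act c (Dl t23) u = pair_vec V23 M23 (u V23) (u M23)"
  "model_act c (Dl (t13 * t23)) u = pair_vec Vr Mr (u Vr) (u Mr)"
  "model_act c (Dl (t23 * t13)) u = pair_vec Vs Ms (u Vs) (u Ms)"
  by (simp_all only: ix_fun_eq_iff all_ix model_act.simps wt.simps t_neq t_neq[symmetric] one_neq one_neq[symmetric] if_True if_False simp_thms,
    simp_all add: pair_vec_def unit_vec_def)

lemma model_submodule_cases:
  assumes c: "c \<noteq> 0" and V: "model_submodule c V"
  obtains "V = {0}" | "V = UNIV" | n where "V = node_set n"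
proof -
  have zero: "0 \<in> V" and add: "\<And>u v. u \<in> V \<Longrightarrow> v \<in> V \<Longrightarrow> u + v \<in> V"
    and scale: "\<And>k u. u \<in> V \<Longrightarrow> scale k u \<in> V" and act: "\<And>x u. x \<in> gens \<Longrightarrow> u \<in> V \<Longrightarrow> model_act c x u \<in> V"
    using V by (auto simp: model_submodule_def linear_subspace_def)
  have gen: "X t12 \<in> gens" "X t13 \<in> gens" "X t23 \<in> gens" "Dl h \<in> gens" for h by (simp_all add: gens_def O23_def)
  have delta: "pair_vec E Top (u E) (u Top) \<in> V" "pair_vec W W' (u W) (u W') \<in> V"
    "pair_vec V13 M13 (u V13) (u M13) \<in> V" "pair_vec V23 M23 (u V23) (u M23) \<in> V"
    "pair_vec Vr Mr (u Vr) (u Mr) \<in> V" "pair_vec Vs Ms (u Vs) (u Ms) \<in> V" if "u \<in> V" for u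
    using act[OF gen(4) that] by (metis model_act_delta_pair)+
  have x: "act12 c u \<in> V" "act13 c u \<in> V" "act23 c u \<in> V" if "u \<in> V" for u
    using act[OF gen(1) that] act[OF gen(2) that] act[OF gen(3) that] by (simp_all only: model_act_X)
  define p where "p x y \<longleftrightarrow> pair_vec Vr Mr x y \<in> V" for x y
  define q where "q x y \<longleftrightarrow> pair_vec W W' x y \<in> V" for x y
  have div: "pair_vec i j x y \<in> V" if "pair_vec i j (k * x) (k * y) \<in> V" "k \<noteq> 0" for i j k x y
    using scale[OF that(1), of "1 / k"] that(2) by (simp add: pair_vec_simps)
  \<comment> \<open>The action of \<open>t12\<close> takes the plane at weight \<open>t13\<close> to
    the one at \<open>t13 * t23\<close> with the same coordinates, and back with the factor
    \<open>c\<close>; dividing by \<open>c\<close> makes the memberships equivalent. The other two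
    weights are reached likewise.\<close>
  have p13: "pair_vec V13 M13 x y \<in> V \<longleftrightarrow> p x y" for x y
    using x(1)[of "pair_vec V13 M13 x y"] x(1)[of "pair_vec Vr Mr x y"] div[of V13 M13 c x y] c
    by (auto simp: p_def model_act_pair_vec)
  have p23: "pair_vec V23 M23 x y \<in> V \<longleftrightarrow> p x y" for x y
    using x(2)[of "pair_vec V23 M23 x y"] x(2)[of "pair_vec Vr Mr x y"] div[of V23 M23 "- c" x y] c
    by (auto simp: p_def model_act_pair_vec)
  have ps: "pair_vec Vs Ms x y \<in> V \<longleftrightarrow> p x y" for x y
    using x(1)[of "pair_vec Vs Ms x y"] x(1)[of "pair_vec V23 M23 x y"] div[of V23 M23 c x y] c
    by (auto simp: p23 model_act_pair_vec)
  obtain l where l: "p = in_plane l"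
    using zero add scale by (rule_tac plane_cases[of p]) (auto simp: p_def pair_vec_simps, metis pair_vec_simps(2), metis pair_vec_simps(1))
  obtain m where m: "q = in_plane m"
    using zero add scale by (rule_tac plane_cases[of q]) (auto simp: q_def pair_vec_simps, metis pair_vec_simps(2), metis pair_vec_simps(1))
  have pq: "q 0 x" if "p x y" for x y
    using x(3)[of "pair_vec Vr Mr x y"] that by (simp add: p_def q_def model_act_pair_vec)
  have qp: "p 0 x" if "q x y" for x y
    using x(3)[of "pair_vec W W' x y"] that by (simp add: p_def q_def model_act_pair_vec)
  show thesis
  proof (cases "\<exists>u\<in>V. u E \<noteq> 0")
    case True
    then obtain u where "u \<in> V" "u E \<noteq> 0" by blast
    then have E: "pair_vec E Top 1 (u Top / u E) \<in> V"
      using div[of E Top "u E" 1 "u Top / u E"] delta(1)[of u] by simp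
    \<comment> \<open>The normalised vector produces \<open>(1, 0)\<close> at weight
      \<open>t12\<close> and \<open>(1, -1)\<close> at \<open>t13\<close>. By \<open>pq\<close> and
      \<open>qp\<close> both planes then also contain \<open>(0, 1)\<close>, so both are
      full.\<close>
    have "q 1 0" "p 1 (- 1)" using x(1,2)[OF E] by (simp_all add: model_act_pair_vec q_def p13)
    then have "l = Full" "m = Full"
      using pq[of 1 "- 1"] qp[of 1 0] unfolding l m by (cases l; cases m; simp)+
    then have pq: "p x y" "q x y" for x y by (simp_all add: l m)
    have Top: "pair_vec E Top 0 y \<in> V" for y
      using x(2)[of "pair_vec V13 M13 0 y"] by (simp add: p13 pq model_act_pair_vec)
    have "pair_vec E Top x y \<in> V" for x y
      using add[OF scale[OF E, of x] Top[of "y - x * (u Top / u E)"]] by (simp add: pair_vec_simps)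
    then have "u \<in> V" for u
      by (subst pair_vec_expansion) (intro add; simp add: p13 p23 ps pq flip: p_def q_def)
    then show thesis using that(2) by blast
  next
    case False
    show thesis
    proof (cases "V = {0}")
      case False
      then obtain u where u: "u \<in> V" "u \<noteq> 0" using zero by blast
      have "\<exists>y. y \<noteq> 0 \<and> pair_vec E Top 0 y \<in> V"
      proof (rule ccontr)
        assume no: "\<not> ?thesis"
        have p0: "x = 0 \<and> y = 0" if "p x y" for x y
        proof -
          \<comment> \<open>From the weights \<open>t13\<close> and \<open>t23\<close> one reaches
            \<open>Top\<close> with the coefficients \<open>x + y\<close> and \<open>y\<close>, and
            these two functionals separate the points of the plane.\<close>
          have "pair_vec E Top 0 (x + y) \<in> V" "pair_vec E Top 0 y \<in> V"
            using that x(2)[of "pair_vec V13 M13 x y"] x(3)[of "pair_vec V23 M23 x y"]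
            by (simp_all add: p13 p23 model_act_pair_vec)
          then have "x + y = 0" "y = 0" using no by blast+
          then show ?thesis by simp
        qed
        have q0: "x = 0 \<and> y = 0" if "q x y" for x y
        proof -
          have "pair_vec E Top 0 (- c * y) \<in> V"
            using that x(1)[of "pair_vec W W' x y"] by (simp add: q_def model_act_pair_vec)
          then have "- c * y = 0" using no by blast
          then show ?thesis using c p0[OF qp[OF that]] by simp
        qed
        have "u E = 0" using u \<open>\<not> (\<exists>u\<in>V. u E \<noteq> 0)\<close> by blast
        then have "u = 0"
          using delta[OF u(1)] no by (auto simp: p13 p23 ps fun_eq_iff all_ix simp flip: p_def q_def dest!: p0 q0)
        then show False using u(2) by simp
      qed
      then obtain y where y: "y \<noteq> 0" "pair_vec E Top 0 y \<in> V" by blast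
      then have Top: "pair_vec E Top 0 z \<in> V" for z
        using scale[OF y(2), of "z / y"] by (simp add: pair_vec_simps)
      have "V = layer l m"
      proof (intro equalityI subsetI)
        fix u assume "u \<in> V"
        then show "u \<in> layer l m"
          using delta[of u] \<open>\<not> (\<exists>u\<in>V. u E \<noteq> 0)\<close>
          by (auto simp: layer_def p13 p23 ps simp flip: p_def q_def l m)
      next
        fix u assume "u \<in> layer l m"
        then show "u \<in> V"
          by (subst pair_vec_expansion)
            (intro add; simp add: layer_def p13 p23 ps Top flip: p_def q_def l m)
      qed
      \<comment> \<open>At first coordinate 1 the two conditions say that \<open>m\<close> contains
        \<open>(0, 1)\<close> if \<open>l\<close> is a line with a slope or full, and conversely. A
        line with a slope on one side thus forces \<open>Vertical\<close> on the other, and the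
        surviving pairs are those of \<open>node_set\<close>.\<close>
      moreover have "\<exists>n. layer l m = node_set n"
        using pq[unfolded l m, of 1] qp[unfolded l m, of 1]
        by (cases l; cases m; simp; metis node_set.simps)
      ultimately show thesis using that(3) by blast
    qed (use that(1) in simp)
  qed
qed

section \<open>Inclusions and coverings among the nodes\<close>

lemma layer_psubset_iff: "layer l m \<subset> layer l' m' \<longleftrightarrow>
    (plane_le l l' \<and> plane_le m m') \<and> \<not> (plane_le l' l \<and> plane_le m' m)"
  by (simp only: psubset_eq set_eq_subset layer_subset_iff) blast

lemma inj_node_set: "inj node_set"
proof (rule injI)
  fix m n :: "'a node" assume "node_set m = node_set n"
  then have "node_set m \<subseteq> node_set n" "node_set n \<subseteq> node_set m" by simp_all
  then show "m = n" by (cases m; cases n) (simp_all add: layer_subset_iff)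
qed

lemma ex_node: "(\<exists>n. P n) \<longleftrightarrow> P NN \<or> P NP \<or> P NQ \<or> P NPQ \<or> P N3 \<or> P N2 \<or> P NT
    \<or> (\<exists>k. P (NV k)) \<or> (\<exists>k. P (NW k))"
proof
  assume "\<exists>n. P n"
  then obtain n where "P n" ..
  then show "P NN \<or> P NP \<or> P NQ \<or> P NPQ \<or> P N3 \<or> P N2 \<or> P NT \<or> (\<exists>k. P (NV k)) \<or> (\<exists>k. P (NW k))"
    by (cases n) auto
qed auto

text \<open>Along these edges only the second plane shrinks, by one dimension and at the single
  weight \<open>t12\<close>. Along \<open>L_edges\<close> only the first one does, by one dimension
  at each of four weights. This accounts for subquotients of dimension 1 and 4.\<close>

definition k_edges :: "('k node \<times> 'k node) set" where
  "k_edges = {(NN, NP), (NQ, NPQ), (NPQ, N2), (N3, NT)} \<union> range (\<lambda>k. (NQ, NW k)) \<union> range (\<lambda>k. (NW k, N2))"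

definition L_edges :: "('k node \<times> 'k node) set" where
  "L_edges = {(NN, NQ), (NP, NPQ), (NPQ, N3), (N2, NT)} \<union> range (\<lambda>k. (NP, NV k)) \<union> range (\<lambda>k. (NV k, N3))"

text \<open>Since inclusion of layers is \<open>plane_le\<close> in both components, a case
  distinction on the two nodes decides the matter once the quantifier over \<open>z\<close> has been
  split by constructors.\<close>

lemma covering_node_iff:
  "node_set n \<subset> node_set m \<and> \<not> (\<exists>z. node_set n \<subset> node_set z \<and> node_set z \<subset> node_set m)
    \<longleftrightarrow> (m, n) \<in> k_edges \<union> L_edges"
  unfolding ex_node
  by (cases m; cases n; simp add: layer_psubset_iff k_edges_def L_edges_def image_iff)

lemma covering_pairs_node_set:
  assumes "inj f"
  shows "covering_pairs (range (\<lambda>n. f ` node_set n))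
    = (\<lambda>(m, n). (f ` node_set m, f ` node_set n)) ` (k_edges \<union> L_edges)"
proof -
  define F where "F = (\<lambda>n. f ` node_set n)"
  have sub: "F m \<subset> F n \<longleftrightarrow> node_set m \<subset> node_set n" for m n
    using inj_image_subset_iff[OF assms] by (simp add: F_def psubset_eq inj_image_eq_iff[OF assms])
  have cover: "F n \<subset> F m \<and> \<not> (\<exists>Z\<in>range F. F n \<subset> Z \<and> Z \<subset> F m) \<longleftrightarrow> (m, n) \<in> k_edges \<union> L_edges" for m n
    unfolding covering_node_iff[symmetric] by (simp only: sub bex_simps)
  have "covering_pairs (range F) = (\<lambda>(m, n). (F m, F n)) ` (k_edges \<union> L_edges)"
  proof (intro equalityI subsetI)
    fix x assume x: "x \<in> covering_pairs (range F)"
    then obtain m n where mn: "x = (F m, F n)" unfolding covering_pairs_def by fast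
    then have "(m, n) \<in> k_edges \<union> L_edges"
      using x unfolding cover[symmetric] covering_pairs_def by simp
    then show "x \<in> (\<lambda>(m, n). (F m, F n)) ` (k_edges \<union> L_edges)" unfolding mn by (rule rev_image_eqI) simp
  next
    fix x assume "x \<in> (\<lambda>(m, n). (F m, F n)) ` (k_edges \<union> L_edges)"
    then obtain m n where "(m, n) \<in> k_edges \<union> L_edges" "x = (F m, F n)" by fast
    then show "x \<in> covering_pairs (range F)"
      unfolding cover[symmetric] covering_pairs_def by simp
  qed
  then show ?thesis by (simp only: F_def)
qed

section \<open>Transport to the Verma module\<close>

context special_param
begin

abbreviation "M \<equiv> verma a 1"

lemma M_abelian: "abelian_group M"
  using left_module_verma[of a 1] by (simp add: left_module_def)

lemma inj_verma_of_vec: "inj verma_of_vec"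
  using verma_of_vec_bij by (simp add: bij_betw_def)

lemma carrier_M: "carrier M = range verma_of_vec"
  using verma_of_vec_bij by (simp add: bij_betw_def)

lemma verma_of_vec_mem_iff: "verma_of_vec u \<in> verma_of_vec ` V \<longleftrightarrow> u \<in> V"
  using inj_verma_of_vec by (auto dest: injD)

lemma scalar_verma_of_vec: "scalar a k \<odot>\<^bsub>M\<^esub> verma_of_vec u = verma_of_vec (scale k u)"
  by (simp add: scalar_def smult_verma_of_vec free_algebra_closed poly_act_single)

lemma verma_of_vec_uminus: "verma_of_vec (- u) = \<ominus>\<^bsub>M\<^esub> verma_of_vec u"
proof -
  interpret M: abelian_group M by (rule M_abelian)
  have "verma_of_vec (- u) \<oplus>\<^bsub>M\<^esub> verma_of_vec u = \<zero>\<^bsub>M\<^esub>"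
    by (simp flip: verma_of_vec_add verma_of_vec_zero)
  then show ?thesis
    by (intro M.minus_equality[symmetric]) (simp_all add: carrier_M)
qed

lemma linear_subspace_uminus: "linear_subspace V \<Longrightarrow> u \<in> V \<Longrightarrow> - u \<in> V"
proof -
  assume "linear_subspace V" "u \<in> V"
  then have "scale (- 1) u \<in> V" unfolding linear_subspace_def by blast
  moreover have "scale (- 1) u = - u" by (simp add: fun_eq_iff)
  ultimately show ?thesis by simp
qed

lemma subgroup_image_iff:
  "subgroup (verma_of_vec ` V) (add_monoid M) \<and> (\<forall>k. \<forall>x\<in>verma_of_vec ` V. scalar a k \<odot>\<^bsub>M\<^esub> x \<in> verma_of_vec ` V)
    \<longleftrightarrow> linear_subspace V" (is "?A \<longleftrightarrow> _")
proof
  interpret M: abelian_group M by (rule M_abelian)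
  assume A: ?A
  then have s: "subgroup (verma_of_vec ` V) (add_monoid M)" by blast
  show "linear_subspace V"
    unfolding linear_subspace_def
  proof (intro conjI ballI allI)
    show "0 \<in> V"
      using subgroup.one_closed[OF s] by (simp add: verma_of_vec_mem_iff flip: verma_of_vec_zero)
    show "u + v \<in> V" if "u \<in> V" "v \<in> V" for u v
      using subgroup.m_closed[OF s, of "verma_of_vec u" "verma_of_vec v"] that
      by (simp only: verma_of_vec_mem_iff monoid.simps simp_thms flip: verma_of_vec_add)
    show "scale k u \<in> V" if "u \<in> V" for k u
      using A that by (metis scalar_verma_of_vec verma_of_vec_mem_iff)
  qed
next
  interpret M: abelian_group M by (rule M_abelian)
  assume V: "linear_subspace V"
  have "subgroup (verma_of_vec ` V) (add_monoid M)"
  proof (rule M.add.subgroupI)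
    show "verma_of_vec ` V \<noteq> {}" using V by (auto simp: linear_subspace_def)
  qed (use V linear_subspace_uminus[OF V] in \<open>auto simp: carrier_M linear_subspace_def
      simp flip: verma_of_vec_add verma_of_vec_uminus a_inv_def\<close>)
  then show ?A using V by (auto simp: scalar_verma_of_vec linear_subspace_def)
qed

lemma model_submodule_act:
  assumes "model_submodule c V" "u \<in> V" "p \<in> fcarrier"
  shows "poly_act (model_act c) p u \<in> V"
  using assms(3)
proof (induction p rule: free_algebra_induct)
  case (scalar k)
  then show ?case
    using assms(1,2) unfolding poly_act_single foldr.simps id_apply model_submodule_def linear_subspace_def by blast
next
  case (gen x p)
  then have "poly_act (model_act c) (word [x] * p) u = model_act c x (poly_act (model_act c) p u)"
    by (simp add: model.poly_act_single_mult scale_simps)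
  then show ?case using gen assms(1) by (simp add: model_submodule_def)
next
  case (add p q)
  then show ?case
    using assms(1) unfolding poly_act_add model_submodule_def linear_subspace_def by blast
qed

lemma submodule_image_iff: "submodule (verma_of_vec ` V) (alg a) M \<longleftrightarrow> model_submodule c V"
proof
  assume s: "submodule (verma_of_vec ` V) (alg a) M"
  then have closed: "alg_class a p \<odot>\<^bsub>M\<^esub> verma_of_vec u \<in> verma_of_vec ` V" if "p \<in> fcarrier" "u \<in> V" for p u
    using that submodule.smult_closed[OF s] by (simp add: carrier_alg)
  have "linear_subspace V"
    unfolding subgroup_image_iff[symmetric]
    using s closed by (auto simp: submodule_def scalar_def free_algebra_closed)
  moreover have "model_act c x u \<in> V" if "x \<in> gens" "u \<in> V" for x u
    using closed[of "word [x]" u] that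
    by (simp add: smult_verma_of_vec free_algebra_closed poly_act_single scale_simps verma_of_vec_mem_iff)
  ultimately show "model_submodule c V" by (simp add: model_submodule_def)
next
  assume V: "model_submodule c V"
  then have "subgroup (verma_of_vec ` V) (add_monoid M)"
    using subgroup_image_iff by (auto simp: model_submodule_def)
  then show "submodule (verma_of_vec ` V) (alg a) M"
    unfolding submodule_def submodule_axioms_def carrier_alg
    using model_submodule_act[OF V] by (auto simp: smult_verma_of_vec)
qed

lemma subset_carrier_image:
  assumes "U \<subseteq> carrier M"
  obtains V where "U = verma_of_vec ` V"
  using assms unfolding carrier_M by (metis subset_image_iff)

lemma linear_span_image:
  assumes "linear_subspace Y" "S \<subseteq> Y" "\<And>V. linear_subspace V \<Longrightarrow> S \<subseteq> V \<Longrightarrow> Y \<subseteq> V"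
  shows "linear_span a M (verma_of_vec ` S) = verma_of_vec ` Y"
proof
  show "linear_span a M (verma_of_vec ` S) \<subseteq> verma_of_vec ` Y"
    unfolding linear_span_def using assms(1,2) subgroup_image_iff[of Y] by (intro Inter_lower) auto
  show "verma_of_vec ` Y \<subseteq> linear_span a M (verma_of_vec ` S)"
    unfolding linear_span_def
  proof (intro Inter_greatest)
    fix U assume "U \<in> {V. subgroup V (add_monoid M) \<and>
        (\<forall>k. \<forall>x\<in>V. scalar a k \<odot>\<^bsub>M\<^esub> x \<in> V) \<and> verma_of_vec ` S \<subseteq> V}"
    then have U: "subgroup U (add_monoid M)" "\<forall>k. \<forall>x\<in>U. scalar a k \<odot>\<^bsub>M\<^esub> x \<in> U" "verma_of_vec ` S \<subseteq> U"
      by blast+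
    have "U \<subseteq> carrier M" using subgroup.subset[OF U(1)] by simp
    then obtain V where V: "U = verma_of_vec ` V" by (rule subset_carrier_image)
    have "linear_subspace V" using U(1,2) unfolding V subgroup_image_iff[symmetric] by blast
    moreover have "S \<subseteq> V" using U(3) unfolding V inj_image_subset_iff[OF inj_verma_of_vec] .
    ultimately show "verma_of_vec ` Y \<subseteq> U" unfolding V by (intro image_mono assms(3))
  qed
qed

text \<open>By the classification, minimality has to be tested against nodes only: the zero
  submodule is excluded by the second hypothesis, and the whole module contains every node.\<close>

lemma generated_submodule_image:
  assumes "S \<subseteq> node_set n" "\<not> S \<subseteq> {0}" "\<And>m. S \<subseteq> node_set m \<Longrightarrow> node_set n \<subseteq> node_set m"
  shows "generated_submodule (alg a) M (verma_of_vec ` S) = verma_of_vec ` node_set n"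
proof
  show "generated_submodule (alg a) M (verma_of_vec ` S) \<subseteq> verma_of_vec ` node_set n"
    unfolding generated_submodule_def
    by (intro Inter_lower CollectI conjI image_mono assms(1) iffD2[OF submodule_image_iff] node_set_submodule)
  show "verma_of_vec ` node_set n \<subseteq> generated_submodule (alg a) M (verma_of_vec ` S)"
    unfolding generated_submodule_def
  proof (intro Inter_greatest)
    fix U assume "U \<in> {N. submodule N (alg a) M \<and> verma_of_vec ` S \<subseteq> N}"
    then have U: "submodule U (alg a) M" "verma_of_vec ` S \<subseteq> U" by simp_all
    have "U \<subseteq> carrier M"
      using subgroup.subset[OF submodule.axioms(1)[OF U(1)]] by simp
    then obtain V where V: "U = verma_of_vec ` V" by (rule subset_carrier_image)
    have SV: "S \<subseteq> V" using U(2) unfolding V inj_image_subset_iff[OF inj_verma_of_vec] .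
    have "model_submodule c V" using U(1) unfolding V submodule_image_iff .
    then have "node_set n \<subseteq> V"
    proof (rule model_submodule_cases[OF c_nonzero])
      show ?thesis if "V = {0}" using assms(2) SV unfolding that by blast
      show ?thesis if "V = UNIV" unfolding that by blast
      show ?thesis if "V = node_set m" for m using SV unfolding that by (rule assms(3))
    qed
    then show "verma_of_vec ` node_set n \<subseteq> U" unfolding V by (rule image_mono)
  qed
qed

lemma proper_submodules:
  "{U. submodule U (alg a) M \<and> U \<noteq> {\<zero>\<^bsub>M\<^esub>} \<and> U \<noteq> carrier M} = range (\<lambda>n. verma_of_vec ` node_set n)"
proof (intro equalityI subsetI)
  fix U assume "U \<in> {U. submodule U (alg a) M \<and> U \<noteq> {\<zero>\<^bsub>M\<^esub>} \<and> U \<noteq> carrier M}"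
  then have U: "submodule U (alg a) M" "U \<noteq> {\<zero>\<^bsub>M\<^esub>}" "U \<noteq> carrier M" by blast+
  have "U \<subseteq> carrier M"
    using subgroup.subset[OF submodule.axioms(1)[OF U(1)]] by simp
  then obtain V where V: "U = verma_of_vec ` V" by (rule subset_carrier_image)
  have "model_submodule c V" using U(1) unfolding V submodule_image_iff .
  then consider "V = {0}" | "V = UNIV" | n where "V = node_set n"
    by (rule model_submodule_cases[OF c_nonzero])
  then show "U \<in> range (\<lambda>n. verma_of_vec ` node_set n)"
  proof cases
    case 1
    then show ?thesis using U(2) by (simp only: V image_insert image_empty verma_of_vec_zero simp_thms)
  next
    case 2
    then show ?thesis using U(3) by (simp only: V carrier_M simp_thms)
  next
    case 3
    then show ?thesis using V by blast
  qed
next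
  fix U assume "U \<in> range (\<lambda>n. verma_of_vec ` node_set n)"
  then obtain n where n: "U = verma_of_vec ` node_set n" by blast
  \<comment> \<open>Every node contains \<open>Top\<close> and misses \<open>E\<close>; hence it is
    neither zero nor the whole module.\<close>
  have "unit_vec Top \<in> node_set n" "unit_vec E \<notin> node_set n"
    by (cases n; simp add: layer_def unit_vec_def in_plane_zero)+
  moreover have "unit_vec Top \<noteq> (0 :: ix \<Rightarrow> 'k)"
    by (auto simp: unit_vec_def fun_eq_iff)
  ultimately have "node_set n \<noteq> {0}" "node_set n \<noteq> UNIV" by auto
  then have "U \<noteq> {\<zero>\<^bsub>M\<^esub>}" "U \<noteq> carrier M"
    unfolding n carrier_M using inj_image_eq_iff[OF inj_verma_of_vec, of "node_set n" "{0}"]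
      inj_image_eq_iff[OF inj_verma_of_vec, of "node_set n" UNIV]
    by (simp_all add: verma_of_vec_zero)
  then show "U \<in> {U. submodule U (alg a) M \<and> U \<noteq> {\<zero>\<^bsub>M\<^esub>} \<and> U \<noteq> carrier M}"
    using node_set_submodule[of c n, folded submodule_image_iff] unfolding n by blast
qed

end

section \<open>Subquotients\<close>

lemma linear_gen_act: "linear_action (gen_act d)"
  using gen_act_add gen_act_scale
  by (intro linear_action.intro) (simp_all only: plus_fun_def scale_def)

context special_param
begin

text \<open>The first isomorphism theorem for a map \<open>\<theta>\<close> given in coordinates.
  Compatibility is demanded for generators and on \<open>V\<close> alone, since the maps used later
  respect the action only on the larger submodule.\<close>

lemma subquotient_isomorphic:
  fixes \<theta> :: "(ix \<Rightarrow> 'k) \<Rightarrow> S3 \<Rightarrow> 'k"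
  assumes V: "model_submodule c V" and V': "model_submodule c V'" and sub: "V' \<subseteq> V"
    and \<theta>_add: "\<And>u v. \<theta> (u + v) = \<theta> u + \<theta> v"
    and \<theta>_scale: "\<And>k u. \<theta> (scale k u) = scale k (\<theta> u)"
    and \<theta>_act: "\<And>x u. \<lbrakk>x \<in> gens; u \<in> V\<rbrakk> \<Longrightarrow> \<theta> (model_act c x u) = gen_act d x (\<theta> u)"
    and image: "\<theta> ` V = {w. \<forall>g. g \<notin> B \<longrightarrow> w g = 0}"
    and ker: "\<And>u. u \<in> V \<Longrightarrow> \<theta> u = 0 \<longleftrightarrow> u \<in> V'"
  shows "module_isomorphic (alg a) (subquotient M (verma_of_vec ` V) (verma_of_vec ` V')) (weight_basis_module B d)"
proof -
  interpret d: linear_action "gen_act d" by (rule linear_gen_act)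
  interpret M: abelian_group M by (rule M_abelian)
  have VD: "u + v \<in> V" "- u \<in> V" "scale k u \<in> V" if "u \<in> V" "v \<in> V" for u v k
    using V that linear_subspace_uminus[of V u] unfolding model_submodule_def linear_subspace_def by blast+
  have V'D: "0 \<in> V'" "\<And>u v. u \<in> V' \<Longrightarrow> v \<in> V' \<Longrightarrow> u + v \<in> V'"
    using V' unfolding model_submodule_def linear_subspace_def by blast+
  define cos where "cos u = verma_of_vec ` (\<lambda>v. v + u) ` V'" for u
  have coset: "verma_of_vec ` V' +>\<^bsub>M\<^esub> verma_of_vec u = cos u" for u
    by (auto simp: cos_def a_r_coset_def' simp flip: verma_of_vec_add)
  have \<theta>_diff: "\<theta> (u - v) = \<theta> u - \<theta> v" for u v
  proof -
    have "\<theta> (u - v) + \<theta> v = \<theta> u" using \<theta>_add[of "u - v" v] by simp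
    then show ?thesis by (metis add_diff_cancel_right')
  qed
  have cos_eq_iff: "cos u = cos v \<longleftrightarrow> \<theta> u = \<theta> v" if "u \<in> V" "v \<in> V" for u v
  proof
    assume "cos u = cos v"
    then have "(\<lambda>v. v + u) ` V' = (\<lambda>u. u + v) ` V'"
      unfolding cos_def inj_image_eq_iff[OF inj_verma_of_vec] .
    moreover have "u \<in> (\<lambda>v. v + u) ` V'" using V'D(1) by (rule rev_image_eqI) simp
    ultimately obtain w where "w \<in> V'" "u = w + v" by blast
    then show "\<theta> u = \<theta> v" using ker[of w] sub \<theta>_add[of w v] by auto
  next
    have le: "cos u \<subseteq> cos v" if "u \<in> V" "v \<in> V" "\<theta> u = \<theta> v" for u v
    proof -
      have "u - v \<in> V" using VD(1)[OF that(1) VD(2)[OF that(2,2)]] by simp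
      then have "u - v \<in> V'" using ker that(3) \<theta>_diff[of u v] by simp
      then have "w + u \<in> (\<lambda>w. w + v) ` V'" if "w \<in> V'" for w
        using V'D(2)[OF that] by (intro rev_image_eqI[of "w + (u - v)"]) simp_all
      then show ?thesis unfolding cos_def by blast
    qed
    assume "\<theta> u = \<theta> v"
    then show "cos u = cos v" using le that by (intro equalityI) simp_all
  qed
  let ?X = "subquotient M (verma_of_vec ` V) (verma_of_vec ` V')"
  have "carrier ?X = (\<lambda>x. verma_of_vec ` V' +>\<^bsub>M\<^esub> x) ` verma_of_vec ` V"
    by (auto simp: subquotient_def)
  then have car: "carrier ?X = cos ` V" by (simp only: image_image coset)
  define \<phi> where "\<phi> C = \<theta> (SOME u. u \<in> V \<and> C = cos u)" for C
  have \<phi>: "\<phi> (cos u) = \<theta> u" if u: "u \<in> V" for u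
  proof -
    define v where "v = (SOME v. v \<in> V \<and> cos u = cos v)"
    have "v \<in> V \<and> cos u = cos v" unfolding v_def by (rule someI[of _ u]) (simp add: u)
    then have "\<theta> u = \<theta> v" using cos_eq_iff[OF u] by blast
    then show ?thesis by (simp add: \<phi>_def v_def)
  qed
  have add: "cos u \<oplus>\<^bsub>?X\<^esub> cos v = cos (u + v)" for u v
  proof -
    have "cos u \<oplus>\<^bsub>?X\<^esub> cos v = {verma_of_vec (w + u) \<oplus>\<^bsub>M\<^esub> verma_of_vec (w' + v) | w w'. w \<in> V' \<and> w' \<in> V'}"
      by (auto simp: subquotient_def set_add_def' cos_def)
    also have "\<dots> = verma_of_vec ` {(w + u) + (w' + v) | w w'. w \<in> V' \<and> w' \<in> V'}"
      unfolding verma_of_vec_add[symmetric] by blast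
    also have "{(w + u) + (w' + v) | w w'. w \<in> V' \<and> w' \<in> V'} = (\<lambda>w. w + (u + v)) ` V'" (is "?L = ?R")
    proof
      have "w + u + (w' + v) = (w + w') + (u + v)" for w w' by (simp add: algebra_simps)
      then show "?L \<subseteq> ?R" using V'D(2) by blast
      have "w + (u + v) = (w + u) + (0 + v)" for w by (simp add: algebra_simps)
      then show "?R \<subseteq> ?L" using V'D(1) by blast
    qed
    finally show ?thesis by (simp only: cos_def)
  qed
  have act: "poly_act (model_act c) p u \<in> V" if "p \<in> fcarrier" "u \<in> V" for p u
    using model_submodule_act[OF V that(2,1)] .
  have \<theta>_poly: "\<theta> (poly_act (model_act c) p u) = free_act d p (\<theta> u)" if "p \<in> fcarrier" "u \<in> V" for p u
    unfolding free_act_eq_poly_act using that(1)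
  proof (induction p rule: free_algebra_induct)
    case (scalar k)
    show ?case unfolding poly_act_single foldr.simps id_apply by (rule \<theta>_scale)
  next
    case (gen x p)
    then show ?case
      using \<theta>_act[OF gen(1) act[OF gen(2) that(2)]]
      by (simp add: model.poly_act_single_mult d.poly_act_single_mult scale_simps)
  next
    case (add p q)
    then show ?case unfolding poly_act_add \<theta>_add by simp
  qed
  have smult: "alg_class a p \<odot>\<^bsub>?X\<^esub> cos u = cos (poly_act (model_act c) p u)" if p: "p \<in> fcarrier" and u: "u \<in> V" for p u
  proof -
    have "cos (poly_act (model_act c) p (w + u)) = cos (poly_act (model_act c) p u)" if "w \<in> V'" for w
    proof -
      have "\<theta> (w + u) = \<theta> u" using \<theta>_add[of w u] ker[of w] sub that by auto
      moreover have "w + u \<in> V" using VD(1) sub that u by blast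
      ultimately show ?thesis using cos_eq_iff act[OF p] u \<theta>_poly[OF p] by simp
    qed
    then have "(\<Union>x\<in>cos u. verma_of_vec ` V' +>\<^bsub>M\<^esub> (alg_class a p \<odot>\<^bsub>M\<^esub> x)) = (\<Union>w\<in>V'. cos (poly_act (model_act c) p u))"
      by (simp add: cos_def[of u] smult_verma_of_vec[OF p] coset)
    then show ?thesis using V'D(1) by (auto simp: subquotient_def)
  qed
  let ?N = "weight_basis_module B d"
  have smultN: "alg_class a p \<odot>\<^bsub>?N\<^esub> \<theta> u = free_act d p (\<theta> u)" if p: "p \<in> fcarrier" and u: "u \<in> V" for p u
  proof -
    interpret I: ideal "rel_ideal a" "free_algebra gens" by (rule ring_alg[OF relators_closed])
    \<comment> \<open>The relation ideal acts by zero in the model, and \<open>\<theta>\<close>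
      carries this over to the target. All representatives of a class thus act alike on
      \<open>\<theta> u\<close>, as \<open>the_elem\<close> requires.\<close>
    have "free_act d q (\<theta> u) = free_act d p (\<theta> u)" if q: "q \<in> alg_class a p" for q
    proof -
      from q obtain i where i: "i \<in> rel_ideal a" "q = i + p"
        by (auto simp: alg_class_def a_r_coset_def' free_algebra_ops)
      have "q \<in> fcarrier" using i p I.a_subset by (auto intro!: free_algebra_closed)
      moreover have "poly_act (model_act c) i u = 0"
        using poly_act_rel_ideal[OF linear_model_act _ i(1), of c u] poly_act_relators[OF a13] by (simp add: c_def)
      ultimately show ?thesis
        using \<theta>_poly[OF _ u, of q] \<theta>_poly[OF p u] by (simp add: i(2) poly_act_add)
    qed
    moreover have "p \<in> alg_class a p" unfolding alg_class_def by (rule I.a_rcos_self[OF p])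
    ultimately have "(\<lambda>p. free_act d p (\<theta> u)) ` alg_class a p = {free_act d p (\<theta> u)}" by blast
    then show ?thesis by (simp add: weight_basis_module_def)
  qed
  have "bij_betw \<phi> (carrier ?X) (carrier ?N)"
    unfolding bij_betw_def car
  proof
    show "inj_on \<phi> (cos ` V)" unfolding inj_on_def by (simp add: \<phi> cos_eq_iff)
    have "carrier ?N = \<theta> ` V" by (simp add: image weight_basis_module_def)
    then show "\<phi> ` cos ` V = carrier ?N" by (simp add: image_image \<phi>)
  qed
  moreover have "\<phi> (x \<oplus>\<^bsub>?X\<^esub> y) = \<phi> x \<oplus>\<^bsub>?N\<^esub> \<phi> y" if "x \<in> carrier ?X" "y \<in> carrier ?X" for x y
    using that VD(1) unfolding car by (auto simp: add \<phi> \<theta>_add) (simp add: weight_basis_module_def plus_fun_def)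
  moreover have "\<phi> (r \<odot>\<^bsub>?X\<^esub> x) = r \<odot>\<^bsub>?N\<^esub> \<phi> x" if "r \<in> carrier (alg a)" "x \<in> carrier ?X" for r x
    using that act unfolding car carrier_alg by (auto simp: smult smultN \<phi> \<theta>_poly)
  ultimately show ?thesis unfolding module_isomorphic_def by blast
qed

end

text \<open>A permutation is determined by the images of the three letters, and injectivity discards
  all triples of images except six.\<close>

lemma S3_cases: "g = 1 \<or> g = t12 \<or> g = t13 \<or> g = t23 \<or> g = t13 * t23 \<or> g = t23 * (t13 :: S3)"
proof -
  have three: "x = 1 \<or> x = 2 \<or> x = 3" for x :: 3
    using forall_three[of "\<lambda>x. x = 1 \<or> x = 2 \<or> x = 3"] by blast
  show ?thesis
    using three[of "Perm.apply g 1"] three[of "Perm.apply g 2"] three[of "Perm.apply g 3"]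
      apply_inj[of g 1 2] apply_inj[of g 1 3] apply_inj[of g 2 3]
    unfolding perm_eq_iff forall_three apply_times o_apply apply_one id_apply apply_t
    by (elim disjE) (simp_all only: three_neq apply_t simp_thms)
qed

lemma all_S3: "(\<forall>g. P g) \<longleftrightarrow> P 1 \<and> P t12 \<and> P t13 \<and> P t23 \<and> P (t13 * t23) \<and> P (t23 * t13)"
  using S3_cases by metis

context special_param
begin

abbreviation node_image :: "'k node \<Rightarrow> _" where
  "node_image n \<equiv> verma_of_vec ` node_set n"

text \<open>The functional with coefficients \<open>\<alpha>\<close> and \<open>\<beta>\<close> has
  kernel \<open>m'\<close> in \<open>m\<close>. On a layer, generators reach the weight
  \<open>t12\<close> only through the coordinate \<open>W'\<close>, which receives first coordinates
  of vectors of \<open>l\<close> up to sign; the last hypothesis makes the functional ignore them,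
  so every generator acts by zero.\<close>

lemma k_subquotient:
  assumes V: "model_submodule c (layer l m)" and V': "model_submodule c (layer l m')"
    and ker: "\<And>x y. in_plane m x y \<Longrightarrow> \<alpha> * x + \<beta> * y = 0 \<longleftrightarrow> in_plane m' x y"
    and sub: "\<And>x y. in_plane m' x y \<Longrightarrow> in_plane m x y"
    and surj: "in_plane m x\<^sub>0 y\<^sub>0" "\<alpha> * x\<^sub>0 + \<beta> * y\<^sub>0 = 1"
    and l: "\<And>x y. in_plane l x y \<Longrightarrow> \<beta> * x = 0"
  shows "module_isomorphic (alg a) (subquotient M (verma_of_vec ` layer l m) (verma_of_vec ` layer l m')) (k_module t12)"
proof -
  define \<theta> :: "(ix \<Rightarrow> 'k) \<Rightarrow> S3 \<Rightarrow> 'k" where "\<theta> u g = (if g = t12 then \<alpha> * u W + \<beta> * u W' else 0)" for u g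
  show ?thesis
    unfolding k_module_def
  proof (rule subquotient_isomorphic[OF V V', of \<theta>])
    show "layer l m' \<subseteq> layer l m" using sub by (auto simp: layer_def)
    show "\<theta> (u + v) = \<theta> u + \<theta> v" "\<theta> (scale k u) = scale k (\<theta> u)" for u v k
      by (simp_all add: \<theta>_def fun_eq_iff algebra_simps)
    show "\<theta> u = 0 \<longleftrightarrow> u \<in> layer l m'" if "u \<in> layer l m" for u
      using that ker[of "u W" "u W'"] by (auto simp: \<theta>_def fun_eq_iff layer_def)
    show "\<theta> ` layer l m = {w. \<forall>g. g \<notin> {t12} \<longrightarrow> w g = 0}"
    proof (intro equalityI subsetI)
      fix w :: "S3 \<Rightarrow> 'k" assume w: "w \<in> {w. \<forall>g. g \<notin> {t12} \<longrightarrow> w g = 0}"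
      let ?u = "pair_vec W W' (w t12 * x\<^sub>0) (w t12 * y\<^sub>0)"
      have u: "?u \<in> layer l m"
        using in_plane_mult[OF surj(1), of "w t12"] by (simp add: layer_def pair_vec_def unit_vec_def in_plane_zero)
      have "\<alpha> * (w t12 * x\<^sub>0) + \<beta> * (w t12 * y\<^sub>0) = w t12 * (\<alpha> * x\<^sub>0 + \<beta> * y\<^sub>0)"
        by (simp only: distrib_left mult.left_commute)
      then have "\<alpha> * (w t12 * x\<^sub>0) + \<beta> * (w t12 * y\<^sub>0) = w t12" by (simp only: surj(2) mult_1_right)
      then have "\<theta> ?u = w" using w by (auto simp: \<theta>_def fun_eq_iff pair_vec_def unit_vec_def)
      then show "w \<in> \<theta> ` layer l m" using imageI[OF u, of \<theta>] by (simp only:)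
    qed (auto simp: \<theta>_def)
    fix x u assume "x \<in> gens" and u: "u \<in> layer l m"
    then consider h where "x = Dl h" | "x = X t12" | "x = X t13" | "x = X t23" by (auto simp: gens_def O23_def)
    then show "\<theta> (model_act c x u) = gen_act (\<lambda>t g. 0) x (\<theta> u)"
    proof cases
      case 1
      then show ?thesis by (auto simp: \<theta>_def fun_eq_iff)
    qed (use u l[of "u Vs" "u Ms"] l[of "u Vr" "u Mr"] in
        \<open>auto simp: \<theta>_def fun_eq_iff model_act_X act_defs layer_def\<close>)
  qed
qed

text \<open>One functional is used at all four weights, since the generators of the model identify
  them. What arrives from weight \<open>t12\<close> is a first coordinate, entered at
  \<open>Mr\<close> or \<open>Ms\<close>; the last hypothesis removes it.\<close>

lemma L_subquotient:
  assumes V: "model_submodule c (layer l m)" and V': "model_submodule c (layer l' m)"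
    and ker: "\<And>x y. in_plane l x y \<Longrightarrow> \<alpha> * x + \<beta> * y = 0 \<longleftrightarrow> in_plane l' x y"
    and sub: "\<And>x y. in_plane l' x y \<Longrightarrow> in_plane l x y"
    and surj: "in_plane l x\<^sub>0 y\<^sub>0" "\<alpha> * x\<^sub>0 + \<beta> * y\<^sub>0 = 1"
    and m: "\<And>x y. in_plane m x y \<Longrightarrow> \<beta> * x = 0"
  shows "module_isomorphic (alg a) (subquotient M (verma_of_vec ` layer l m) (verma_of_vec ` layer l' m)) (L_module a)"
proof -
  let ?B = "{t13, t23, t13 * t23, t23 * t13}"
  define \<theta> :: "(ix \<Rightarrow> 'k) \<Rightarrow> S3 \<Rightarrow> 'k" where
    "\<theta> u g = (if g = t13 then \<alpha> * u V13 + \<beta> * u M13 else if g = t23 then \<alpha> * u V23 + \<beta> * u M23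
      else if g = t13 * t23 then \<alpha> * u Vr + \<beta> * u Mr else if g = t23 * t13 then \<alpha> * u Vs + \<beta> * u Ms else 0)" for u g
  have \<theta>: "\<theta> u 1 = 0" "\<theta> u t12 = 0" "\<theta> u t13 = \<alpha> * u V13 + \<beta> * u M13" "\<theta> u t23 = \<alpha> * u V23 + \<beta> * u M23"
    "\<theta> u (t13 * t23) = \<alpha> * u Vr + \<beta> * u Mr" "\<theta> u (t23 * t13) = \<alpha> * u Vs + \<beta> * u Ms" for u
    unfolding \<theta>_def by (simp_all only: t_neq t_neq[symmetric] one_neq if_True if_False simp_thms)
  define d where "d t g = (if g = t then 0 else if sgn_S3 g = - 1 then 1 else f_fun a t g)" for t g
  have d: "d t12 t13 = 1" "d t13 t13 = 0" "d t23 t13 = 1" "d t12 t23 = 1" "d t13 t23 = 1" "d t23 t23 = 0"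
    "d t12 (t13 * t23) = c" "d t13 (t13 * t23) = - c" "d t23 (t13 * t23) = 0"
    "d t12 (t23 * t13) = c" "d t13 (t23 * t13) = 0" "d t23 (t23 * t13) = - c"
    by (simp_all only: d_def sgn_S3 t_neq f_fun_c) simp_all
  show ?thesis
    unfolding L_module_def d_def[symmetric]
  proof (rule subquotient_isomorphic[OF V V', of \<theta>])
    show "layer l' m \<subseteq> layer l m" using sub by (auto simp: layer_def)
    show "\<theta> (u + v) = \<theta> u + \<theta> v" "\<theta> (scale k u) = scale k (\<theta> u)" for u v k
      by (simp_all add: \<theta>_def fun_eq_iff algebra_simps)
    show "\<theta> u = 0 \<longleftrightarrow> u \<in> layer l' m" if "u \<in> layer l m" for u
      using that unfolding fun_eq_iff[of "\<theta> u"] all_S3 \<theta> by (simp add: layer_def ker)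
    show "\<theta> ` layer l m = {w. \<forall>g. g \<notin> ?B \<longrightarrow> w g = 0}"
    proof (intro equalityI subsetI)
      fix w :: "S3 \<Rightarrow> 'k" assume w: "w \<in> {w. \<forall>g. g \<notin> ?B \<longrightarrow> w g = 0}"
      have eq: "\<alpha> * (k * x\<^sub>0) + \<beta> * (k * y\<^sub>0) = k" for k
      proof -
        have "\<alpha> * (k * x\<^sub>0) + \<beta> * (k * y\<^sub>0) = k * (\<alpha> * x\<^sub>0 + \<beta> * y\<^sub>0)"
          by (simp only: distrib_left mult.left_commute)
        then show ?thesis by (simp only: surj(2) mult_1_right)
      qed
      \<comment> \<open>A preimage of \<open>w\<close>: at each of the four weights the vector with
        coordinates \<open>(x\<^sub>0, y\<^sub>0)\<close>, where the functional is 1, times the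
        value of \<open>w\<close>.\<close>
      let ?u = "\<lambda>i. if i \<in> {V13, V23, Vr, Vs} then w (wt i) * x\<^sub>0
        else if i \<in> {M13, M23, Mr, Ms} then w (wt i) * y\<^sub>0 else 0"
      have u: "?u \<in> layer l m"
        using in_plane_mult[OF surj(1)] by (simp add: layer_def in_plane_zero)
      have "w 1 = 0" "w t12 = 0" using w by (simp_all add: one_neq t_neq t_neq[symmetric])
      then have "\<theta> ?u = w" unfolding fun_eq_iff all_S3 \<theta> by (simp add: eq)
      then show "w \<in> \<theta> ` layer l m" using imageI[OF u, of \<theta>] by (simp only:)
    qed (auto simp: \<theta>_def)
    fix x u assume "x \<in> gens" and u: "u \<in> layer l m"
    then consider h where "x = Dl h" | "x = X t12" | "x = X t13" | "x = X t23" by (auto simp: gens_def O23_def)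
    then show "\<theta> (model_act c x u) = gen_act d x (\<theta> u)"
    proof cases
      case (1 h)
      show ?thesis
        unfolding 1 fun_eq_iff[of "\<theta> _"] all_S3 gen_act.simps \<theta> model_act.simps wt.simps by simp
    next
      case 2
      show ?thesis
        using u unfolding 2 fun_eq_iff[of "\<theta> _"] all_S3 gen_act_X[OF O23_mem(1)]
        by (simp only: \<theta> S3_mult swap_self mult_1_right d model_act_X act_defs ix.case mult_zero_left layer_def mem_Collect_eq)
          (simp add: algebra_simps)
    next
      case 3
      show ?thesis
        using u m[of "u W" "u W'"] unfolding 3 fun_eq_iff[of "\<theta> _"] all_S3 gen_act_X[OF O23_mem(2)]
        by (simp only: \<theta> S3_mult swap_self mult_1_right d model_act_X act_defs ix.case mult_zero_left layer_def mem_Collect_eq)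
          (simp add: algebra_simps)
    next
      case 4
      show ?thesis
        using u m[of "u W" "u W'"] unfolding 4 fun_eq_iff[of "\<theta> _"] all_S3 gen_act_X[OF O23_mem(3)]
        by (simp only: \<theta> S3_mult swap_self mult_1_right d model_act_X act_defs ix.case mult_zero_left layer_def mem_Collect_eq)
          (simp add: algebra_simps)
    qed
  qed
qed

text \<open>The functional is \<open>y - k x\<close> if the smaller plane is \<open>Line k\<close>,
  \<open>y\<close> if the larger one is \<open>Vertical\<close>, and \<open>x\<close> otherwise. The
  vector with entries \<open>x\<^sub>0\<close> and \<open>y\<^sub>0\<close> lies in the larger plane
  and has value 1.\<close>

lemma k_edge_isomorphic:
  assumes "(m, n) \<in> k_edges"
  shows "module_isomorphic (alg a) (subquotient M (node_image m) (node_image n)) (k_module t12)"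
proof -
  note sub = node_set_submodule[of c m] node_set_submodule[of c n]
  consider "m = NN" "n = NP" | "m = NQ" "n = NPQ" | "m = NPQ" "n = N2" | "m = N3" "n = NT"
    | k where "m = NQ" "n = NW k" | k where "m = NW k" "n = N2"
    using assms by (auto simp: k_edges_def)
  then show ?thesis
  proof cases
    case 1
    show ?thesis using sub unfolding 1 node_set.simps by (rule k_subquotient[where \<alpha> = 1 and \<beta> = 0 and x\<^sub>0 = 1 and y\<^sub>0 = 0]) auto
  next
    case 2
    show ?thesis using sub unfolding 2 node_set.simps by (rule k_subquotient[where \<alpha> = 1 and \<beta> = 0 and x\<^sub>0 = 1 and y\<^sub>0 = 0]) auto
  next
    case 3
    show ?thesis using sub unfolding 3 node_set.simps by (rule k_subquotient[where \<alpha> = 0 and \<beta> = 1 and x\<^sub>0 = 0 and y\<^sub>0 = 1]) auto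
  next
    case 4
    show ?thesis using sub unfolding 4 node_set.simps by (rule k_subquotient[where \<alpha> = 0 and \<beta> = 1 and x\<^sub>0 = 0 and y\<^sub>0 = 1]) auto
  next
    case (5 k)
    show ?thesis using sub unfolding 5 node_set.simps by (rule k_subquotient[where \<alpha> = "- k" and \<beta> = 1 and x\<^sub>0 = 0 and y\<^sub>0 = 1]) auto
  next
    case (6 k)
    show ?thesis using sub unfolding 6 node_set.simps by (rule k_subquotient[where \<alpha> = 1 and \<beta> = 0 and x\<^sub>0 = 1 and y\<^sub>0 = k]) auto
  qed
qed

lemma L_edge_isomorphic:
  assumes "(m, n) \<in> L_edges"
  shows "module_isomorphic (alg a) (subquotient M (node_image m) (node_image n)) (L_module a)"
proof -
  note sub = node_set_submodule[of c m] node_set_submodule[of c n]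
  consider "m = NN" "n = NQ" | "m = NP" "n = NPQ" | "m = NPQ" "n = N3" | "m = N2" "n = NT"
    | k where "m = NP" "n = NV k" | k where "m = NV k" "n = N3"
    using assms by (auto simp: L_edges_def)
  then show ?thesis
  proof cases
    case 1
    show ?thesis using sub unfolding 1 node_set.simps by (rule L_subquotient[where \<alpha> = 1 and \<beta> = 0 and x\<^sub>0 = 1 and y\<^sub>0 = 0]) auto
  next
    case 2
    show ?thesis using sub unfolding 2 node_set.simps by (rule L_subquotient[where \<alpha> = 1 and \<beta> = 0 and x\<^sub>0 = 1 and y\<^sub>0 = 0]) auto
  next
    case 3
    show ?thesis using sub unfolding 3 node_set.simps by (rule L_subquotient[where \<alpha> = 0 and \<beta> = 1 and x\<^sub>0 = 0 and y\<^sub>0 = 1]) auto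
  next
    case 4
    show ?thesis using sub unfolding 4 node_set.simps by (rule L_subquotient[where \<alpha> = 0 and \<beta> = 1 and x\<^sub>0 = 0 and y\<^sub>0 = 1]) auto
  next
    case (5 k)
    show ?thesis using sub unfolding 5 node_set.simps by (rule L_subquotient[where \<alpha> = "- k" and \<beta> = 1 and x\<^sub>0 = 0 and y\<^sub>0 = 1]) auto
  next
    case (6 k)
    show ?thesis using sub unfolding 6 node_set.simps by (rule L_subquotient[where \<alpha> = 1 and \<beta> = 0 and x\<^sub>0 = 1 and y\<^sub>0 = k]) auto
  qed
qed

end

section \<open>The lattice of submodules\<close>

lemma pair_vec_in_layer:
  "pair_vec Vr Mr x y \<in> layer l m \<longleftrightarrow> in_plane l x y"
  "pair_vec W W' x y \<in> layer l m \<longleftrightarrow> in_plane m x y"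
  "pair_vec Vr Mr x y + pair_vec W W' x' y' \<in> layer l m \<longleftrightarrow> in_plane l x y \<and> in_plane m x' y'"
  by (auto simp: layer_def pair_vec_def unit_vec_def in_plane_zero)

lemma pair_vec_eq_0_iff: "i \<noteq> j \<Longrightarrow> pair_vec i j x y = 0 \<longleftrightarrow> x = 0 \<and> y = 0"
  by (auto simp: fun_eq_iff pair_vec_def unit_vec_def)

lemma all_in_plane_iff: "(\<forall>x y. in_plane l x y) \<longleftrightarrow> l = Full"
proof
  assume "\<forall>x y. in_plane l x y"
  then have "in_plane l 1 0" "in_plane l 1 1" "in_plane l 0 1" by blast+
  then show "l = Full" by (cases l) auto
qed simp

lemma linear_subspace_combinations: "linear_subspace {scale s u + scale t v | s t. True}"
proof -
  have "\<exists>s' t'. scale s u + scale t v + (scale s1 u + scale t1 v) = scale s' u + scale t' v" for s t s1 t1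
    by (intro exI[of _ "s + s1"] exI[of _ "t + t1"]) (simp add: scale_simps algebra_simps)
  moreover have "\<exists>s' t'. scale k (scale s u + scale t v) = scale s' u + scale t' v" for k s t
    by (intro exI[of _ "k * s"] exI[of _ "k * t"]) (simp only: scale_simps)
  moreover have "\<exists>s t. 0 = scale s u + scale t v"
    by (intro exI[of _ 0]) (simp only: scale_simps add_0_left)
  ultimately show ?thesis unfolding linear_subspace_def by blast
qed

context special_param
begin

lemma linear_span_two:
  "linear_span a M {verma_of_vec u, verma_of_vec v} = verma_of_vec ` {scale s u + scale t v | s t. True}"
proof -
  have "linear_span a M (verma_of_vec ` {u, v}) = verma_of_vec ` {scale s u + scale t v | s t. True}"
  proof (rule linear_span_image[OF linear_subspace_combinations])
    have "u = scale 1 u + scale 0 v" "v = scale 0 u + scale 1 v" by (simp_all only: scale_simps add_0_left add_0_right)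
    then show "{u, v} \<subseteq> {scale s u + scale t v | s t. True}" by blast
    show "{scale s u + scale t v | s t. True} \<subseteq> V" if "linear_subspace V" "{u, v} \<subseteq> V" for V
      using that unfolding linear_subspace_def by blast
  qed
  then show ?thesis by simp
qed

lemma linear_span_one: "linear_span a M {verma_of_vec u} = verma_of_vec ` range (\<lambda>s. scale s u)"
proof -
  have "scale s u + scale t u = scale (s + t) u" for s t by (simp only: scale_simps)
  then have "{scale s u + scale t u | s t. True} = range (\<lambda>s. scale s u)"
    by (auto intro: exI[of _ 0]) (metis add_0_right)
  then show ?thesis using linear_span_two[of u u] by simp
qed

lemma weight_space_M: "weight_space a M g = verma_of_vec ` range (model_act c (Dl g))"
proof -
  have "delta a g \<odot>\<^bsub>M\<^esub> verma_of_vec u = verma_of_vec (model_act c (Dl g) u)" for u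
    unfolding delta_def smult_verma_of_vec[OF word_X_closed(2)]
    by (simp only: poly_act_single foldr.simps o_apply id_apply scale_simps)
  then show ?thesis by (auto simp: weight_space_def carrier_M)
qed

lemma weight_spaces:
  "weight_space a M (t13 * t23) = verma_of_vec ` {pair_vec Vr Mr x y | x y. True}"
  "weight_space a M t12 = verma_of_vec ` {pair_vec W W' x y | x y. True}"
proof -
  have 1: "pair_vec Vr Mr x y = model_act c (Dl (t13 * t23)) (pair_vec Vr Mr x y)"
    and 2: "pair_vec W W' x y = model_act c (Dl t12) (pair_vec W W' x y)" for x y
    unfolding model_act_delta_pair by (simp_all add: pair_vec_def unit_vec_def)
  have "range (model_act c (Dl (t13 * t23))) = {pair_vec Vr Mr x y | x y. True}"
    "range (model_act c (Dl t12)) = {pair_vec W W' x y | x y. True}"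
    using 1 2 model_act_delta_pair(2,5)[of c] by blast+
  then show "weight_space a M (t13 * t23) = verma_of_vec ` {pair_vec Vr Mr x y | x y. True}"
    "weight_space a M t12 = verma_of_vec ` {pair_vec W W' x y | x y. True}"
    by (simp_all only: weight_space_M)
qed

text \<open>Together with \<open>(0, 1)\<close>, a vector spans the plane exactly when its first
  coordinate is nonzero. The admissible \<open>v\<close> and \<open>w\<close> are thereby
  parametrised, and up to scalars only their slope \<open>y / x\<close> remains.\<close>

lemma complements:
  assumes "i \<noteq> j"
  shows "{v \<in> carrier M. verma_of_vec ` {pair_vec i j x y | x y. True} = linear_span a M {v, verma_of_vec (unit_vec j)}}
    = (\<lambda>(x, y). verma_of_vec (pair_vec i j x y)) ` {(x, y). x \<noteq> 0}" (is "?V = _")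
proof -
  have coord: "pair_vec i j x y i = x" "pair_vec i j x y j = y" "unit_vec j i = (0 :: 'k)" for x y
    using assms by (auto simp: pair_vec_def unit_vec_def)
  have uj: "unit_vec j = pair_vec i j 0 1" by (simp add: fun_eq_iff pair_vec_def)
  have "{pair_vec i j x y | x y. True} = {scale s u + scale t (unit_vec j) | s t. True}
      \<longleftrightarrow> (\<exists>x y. x \<noteq> 0 \<and> u = pair_vec i j x y)" (is "?P = ?S \<longleftrightarrow> _") for u :: "ix \<Rightarrow> 'k"
  proof
    assume eq: "?P = ?S"
    have "u = scale 1 u + scale 0 (unit_vec j)" by (simp only: scale_simps add_0_right)
    then have "u \<in> ?P" unfolding eq by blast
    then obtain x y where u: "u = pair_vec i j x y" by blast
    \<comment> \<open>Comparing coordinates at \<open>i\<close> in an expression of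
      \<open>(1, 0)\<close> shows that \<open>u\<close> cannot vanish there.\<close>
    have "pair_vec i j 1 0 \<in> ?S" unfolding eq[symmetric] by blast
    then obtain s t where "pair_vec i j 1 0 = scale s u + scale t (unit_vec j)" by blast
    then have "pair_vec i j 1 0 i = s * u i + t * unit_vec j i" by simp
    then have "x \<noteq> 0" unfolding u coord by auto
    then show "\<exists>x y. x \<noteq> 0 \<and> u = pair_vec i j x y" using u by blast
  next
    assume "\<exists>x y. x \<noteq> 0 \<and> u = pair_vec i j x y"
    then obtain x y where x: "x \<noteq> 0" and u: "u = pair_vec i j x y" by blast
    have 1: "scale s u + scale t (unit_vec j) = pair_vec i j (s * x) (s * y + t)" for s t
      unfolding u uj pair_vec_simps by simp
    then have 2: "pair_vec i j x' y' = scale (x' / x) u + scale (y' - x' / x * y) (unit_vec j)" for x' y'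
      unfolding 1 using x by simp
    show "?P = ?S" using 1 2 by blast
  qed
  then have mem: "verma_of_vec u \<in> ?V \<longleftrightarrow> (\<exists>x y. x \<noteq> 0 \<and> u = pair_vec i j x y)" for u
    by (simp only: mem_Collect_eq linear_span_two inj_image_eq_iff[OF inj_verma_of_vec] carrier_M rangeI simp_thms)
  show ?thesis
  proof (intro equalityI subsetI)
    fix v assume v: "v \<in> ?V"
    then obtain u where u: "v = verma_of_vec u" unfolding carrier_M by blast
    then show "v \<in> (\<lambda>(x, y). verma_of_vec (pair_vec i j x y)) ` {(x, y). x \<noteq> 0}"
      using v mem[of u] by force
  next
    fix v assume "v \<in> (\<lambda>(x, y). verma_of_vec (pair_vec i j x y)) ` {(x, y). x \<noteq> 0}"
    then obtain x y where "x \<noteq> 0" and v: "v = verma_of_vec (pair_vec i j x y)" by auto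
    then show "v \<in> ?V" unfolding v mem by blast
  qed
qed

lemma mem_linear_span_pair:
  assumes "i \<noteq> j" "x \<noteq> 0" "x' \<noteq> 0"
  shows "verma_of_vec (pair_vec i j x y) \<in> linear_span a M {verma_of_vec (pair_vec i j x' y')} \<longleftrightarrow> y / x = y' / x'"
proof -
  have "pair_vec i j x y = pair_vec i j (s * x') (s * y') \<longleftrightarrow> x = s * x' \<and> y = s * y'" for s
    using assms(1) by (auto simp: fun_eq_iff pair_vec_def unit_vec_def split: if_splits)
  then have "verma_of_vec (pair_vec i j x y) \<in> linear_span a M {verma_of_vec (pair_vec i j x' y')}
      \<longleftrightarrow> (\<exists>s. x = s * x' \<and> y = s * y')"
    unfolding linear_span_one verma_of_vec_mem_iff by (simp only: image_iff bex_UNIV pair_vec_simps)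
  also have "\<dots> \<longleftrightarrow> y / x = y' / x'"
    using assms(2,3) by (auto simp: field_simps intro: exI[of _ "x / x'"])
  finally show ?thesis .
qed

lemma node_image_eq_iff: "node_image m = node_image n \<longleftrightarrow> m = n"
  by (simp only: inj_image_eq_iff[OF inj_verma_of_vec] inj_eq[OF inj_node_set])

text \<open>If \<open>x\<close> is nonzero, a node containing this vector has first plane
  \<open>Full\<close> or the line of slope \<open>y / x\<close>; among these nodes
  \<open>NV (y / x)\<close> is the least.\<close>

lemma generated_line_V:
  assumes "x \<noteq> 0"
  shows "generated_submodule (alg a) M {verma_of_vec (pair_vec Vr Mr x y)} = node_image (NV (y / x))"
proof -
  have "generated_submodule (alg a) M (verma_of_vec ` {pair_vec Vr Mr x y}) = node_image (NV (y / x))"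
  proof (rule generated_submodule_image)
    show "node_set (NV (y / x)) \<subseteq> node_set n" if "{pair_vec Vr Mr x y} \<subseteq> node_set n" for n
      using that assms by (cases n) (auto simp: pair_vec_in_layer layer_subset_iff)
  qed (use assms in \<open>auto simp: pair_vec_in_layer pair_vec_eq_0_iff\<close>)
  then show ?thesis by simp
qed

lemma generated_line_W:
  assumes "x \<noteq> 0"
  shows "generated_submodule (alg a) M {verma_of_vec (pair_vec W W' x y)} = node_image (NW (y / x))"
proof -
  have "generated_submodule (alg a) M (verma_of_vec ` {pair_vec W W' x y}) = node_image (NW (y / x))"
  proof (rule generated_submodule_image)
    show "node_set (NW (y / x)) \<subseteq> node_set n" if "{pair_vec W W' x y} \<subseteq> node_set n" for n
      using that assms by (cases n) (auto simp: pair_vec_in_layer layer_subset_iff)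
  qed (use assms in \<open>auto simp: pair_vec_in_layer pair_vec_eq_0_iff\<close>)
  then show ?thesis by simp
qed

lemma unit_vec_pair: "unit_vec Mr = pair_vec Vr Mr 0 1" "unit_vec W' = pair_vec W W' 0 1"
  by (simp_all add: fun_eq_iff pair_vec_def)

text \<open>All generating sets consist of vectors supported at \<open>t13 * t23\<close> and
  \<open>t12\<close>, so lying in a layer becomes a condition on its two planes, and the least node
  satisfying it is found by cases.\<close>

lemma generated_submodules:
  "generated_submodule (alg a) M (verma_of_vec ` {pair_vec Vr Mr x y | x y. True}) = node_image NP"
  "generated_submodule (alg a) M (verma_of_vec ` {pair_vec W W' x y | x y. True}) = node_image NQ"
  "generated_submodule (alg a) M (verma_of_vec ` {pair_vec Vr Mr x y | x y. True} <+>\<^bsub>M\<^esub>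
     verma_of_vec ` {pair_vec W W' x y | x y. True}) = node_image NN"
  "generated_submodule (alg a) M (linear_span a M {verma_of_vec (unit_vec W'), verma_of_vec (unit_vec Mr)})
     = node_image NPQ"
  "generated_submodule (alg a) M {verma_of_vec (unit_vec W')} = node_image N3"
  "generated_submodule (alg a) M {verma_of_vec (unit_vec Mr)} = node_image N2"
proof -
  have V_sub: "{pair_vec Vr Mr x y | x y. True} \<subseteq> layer l m \<longleftrightarrow> l = Full"
    and W_sub: "{pair_vec W W' x y | x y. True} \<subseteq> layer l m \<longleftrightarrow> m = Full" for l m :: "'k plane"
    using pair_vec_in_layer(1,2)[of _ _ l m] unfolding all_in_plane_iff[symmetric] by blast+
  have nz: "pair_vec Vr Mr 1 0 \<noteq> (0 :: ix \<Rightarrow> 'k)" "pair_vec W W' 1 0 \<noteq> (0 :: ix \<Rightarrow> 'k)"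
    by (simp_all add: pair_vec_eq_0_iff)
  show "generated_submodule (alg a) M (verma_of_vec ` {pair_vec Vr Mr x y | x y. True}) = node_image NP"
  proof (rule generated_submodule_image)
    show "\<not> {pair_vec Vr Mr x y | x y. True} \<subseteq> {0 :: ix \<Rightarrow> 'k}" using nz by blast
    show "node_set NP \<subseteq> node_set n" if "{pair_vec Vr Mr x y | x y. True} \<subseteq> node_set n" for n :: "'k node"
      using that by (cases n) (simp_all only: node_set.simps V_sub layer_subset_iff, simp_all)
  qed (simp only: node_set.simps V_sub)
  show "generated_submodule (alg a) M (verma_of_vec ` {pair_vec W W' x y | x y. True}) = node_image NQ"
  proof (rule generated_submodule_image)
    show "\<not> {pair_vec W W' x y | x y. True} \<subseteq> {0 :: ix \<Rightarrow> 'k}" using nz by blast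
    show "node_set NQ \<subseteq> node_set n" if "{pair_vec W W' x y | x y. True} \<subseteq> node_set n" for n :: "'k node"
      using that by (cases n) (simp_all only: node_set.simps W_sub layer_subset_iff, simp_all)
  qed (simp only: node_set.simps W_sub)
  let ?S = "{pair_vec Vr Mr x y + pair_vec W W' x' y' | x y x' y'. True} :: (ix \<Rightarrow> 'k) set"
  have S: "?S \<subseteq> layer l m \<longleftrightarrow> l = Full \<and> m = Full" for l m
  proof -
    have "?S \<subseteq> layer l m \<longleftrightarrow> (\<forall>x y x' y'. in_plane l x y \<and> in_plane m x' y')"
      using pair_vec_in_layer(3)[of _ _ _ _ l m] by blast
    then show ?thesis using in_plane_zero by (simp flip: all_in_plane_iff)
  qed
  have "verma_of_vec ` {pair_vec Vr Mr x y | x y. True} <+>\<^bsub>M\<^esub> verma_of_vec ` {pair_vec W W' x y | x y. True}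
      = verma_of_vec ` ?S"
    unfolding set_add_def' by (auto simp flip: verma_of_vec_add intro!: imageI)
  moreover have "generated_submodule (alg a) M (verma_of_vec ` ?S) = node_image NN"
  proof (rule generated_submodule_image)
    have "pair_vec Vr Mr 1 0 = pair_vec Vr Mr 1 0 + pair_vec W W' 0 (0 :: 'k)" by (simp only: pair_vec_simps add_0_right)
    then show "\<not> ?S \<subseteq> {0}" using nz(1) by blast
    show "node_set NN \<subseteq> node_set n" if "?S \<subseteq> node_set n" for n :: "'k node"
      using that by (cases n) (simp_all only: node_set.simps S layer_subset_iff, simp_all)
  qed (simp only: node_set.simps S)
  ultimately show "generated_submodule (alg a) M (verma_of_vec ` {pair_vec Vr Mr x y | x y. True} <+>\<^bsub>M\<^esub>
     verma_of_vec ` {pair_vec W W' x y | x y. True}) = node_image NN" by simp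
  let ?T = "{scale s (unit_vec W') + scale t (unit_vec Mr) | s t. True} :: (ix \<Rightarrow> 'k) set"
  have T: "?T \<subseteq> layer l m \<longleftrightarrow> in_plane l 0 1 \<and> in_plane m 0 1" for l m
  proof -
    have eq: "scale s (unit_vec W') + scale t (unit_vec Mr) = pair_vec Vr Mr 0 t + pair_vec W W' 0 s" for s t :: 'k
      by (simp add: unit_vec_pair pair_vec_simps add.commute)
    have "?T \<subseteq> layer l m \<longleftrightarrow> (\<forall>s t. in_plane l 0 t \<and> in_plane m 0 s)"
      unfolding eq using pair_vec_in_layer(3)[of 0 _ 0 _ l m] by blast
    then show ?thesis using in_plane_mult[of l 0 1] in_plane_mult[of m 0 1] by auto
  qed
  have "generated_submodule (alg a) M (verma_of_vec ` ?T) = node_image NPQ"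
  proof (rule generated_submodule_image)
    have "unit_vec Mr = scale 0 (unit_vec W') + scale 1 (unit_vec Mr :: ix \<Rightarrow> 'k)"
      by (simp only: scale_simps add_0_left)
    moreover have "unit_vec Mr \<noteq> (0 :: ix \<Rightarrow> 'k)" by (simp add: unit_vec_pair pair_vec_eq_0_iff)
    ultimately show "\<not> ?T \<subseteq> {0}" by blast
    show "node_set NPQ \<subseteq> node_set n" if "?T \<subseteq> node_set n" for n :: "'k node"
      using that by (cases n) (simp_all only: node_set.simps T layer_subset_iff, simp_all)
  qed (simp only: node_set.simps T, simp)
  then show "generated_submodule (alg a) M (linear_span a M {verma_of_vec (unit_vec W'), verma_of_vec (unit_vec Mr)})
     = node_image NPQ" by (simp only: linear_span_two)
  have "generated_submodule (alg a) M (verma_of_vec ` {unit_vec W'}) = node_image N3"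
    unfolding unit_vec_pair
  proof (rule generated_submodule_image)
    show "node_set N3 \<subseteq> node_set n" if "{pair_vec W W' 0 1} \<subseteq> node_set n" for n
      using that by (cases n) (auto simp: pair_vec_in_layer layer_subset_iff)
  qed (auto simp: pair_vec_in_layer pair_vec_eq_0_iff)
  then show "generated_submodule (alg a) M {verma_of_vec (unit_vec W')} = node_image N3" by simp
  have "generated_submodule (alg a) M (verma_of_vec ` {unit_vec Mr}) = node_image N2"
    unfolding unit_vec_pair
  proof (rule generated_submodule_image)
    show "node_set N2 \<subseteq> node_set n" if "{pair_vec Vr Mr 0 1} \<subseteq> node_set n" for n
      using that by (cases n) (auto simp: pair_vec_in_layer layer_subset_iff)
  qed (auto simp: pair_vec_in_layer pair_vec_eq_0_iff)
  then show "generated_submodule (alg a) M {verma_of_vec (unit_vec Mr)} = node_image N2" by simp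
qed

lemma linear_span_Top: "linear_span a M {verma_of_vec (scale c (unit_vec Top))} = node_image NT"
proof -
  have "range (\<lambda>s. scale s (scale c (unit_vec Top))) = (node_set NT :: (ix \<Rightarrow> 'k) set)"
  proof (intro equalityI subsetI)
    fix u :: "ix \<Rightarrow> 'k" assume "u \<in> node_set NT"
    then have "u = scale (u Top / c) (scale c (unit_vec Top))"
      using c_nonzero by (simp add: layer_def fun_eq_iff all_ix unit_vec_def)
    then show "u \<in> range (\<lambda>s. scale s (scale c (unit_vec Top)))" by blast
  qed (auto simp: layer_def unit_vec_def)
  then show ?thesis by (simp only: linear_span_one)
qed

end

theorem lemma17:
  fixes a :: "S3 \<Rightarrow> 'k::{alg_closed_field, field_char_0}"
  assumes "a \<in> param_space"
    and "a t12 \<noteq> a t13"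
    and "a t13 = a t23"
  shows
   "let A = alg a;
        M = verma a 1;
        Sub = generated_submodule A M;
        Span = linear_span a M;
        P = weight_space a M (t13 * t23);
        Q = weight_space a M t12;
        m\<^sub>2 = verma_vec a 1 [t23, t12];
        m\<^sub>3 = verma_vec a 1 [t13, t12, t23];
        m\<^sub>t\<^sub>o\<^sub>p = verma_vec a 1 [t13, t12, t23, t12];
        N = Sub (P <+>\<^bsub>M\<^esub> Q);
        vs = {v \<in> carrier M. P = Span {v, m\<^sub>2}};
        ws = {w \<in> carrier M. Q = Span {w, m\<^sub>3}};
        S = {U. submodule U A M \<and> U \<noteq> {\<zero>\<^bsub>M\<^esub>} \<and> U \<noteq> carrier M};
        Edges_k =
          {(N, Sub P),
           (Sub Q, Sub (Span {m\<^sub>3, m\<^sub>2})),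
           (Sub (Span {m\<^sub>3, m\<^sub>2}), Sub {m\<^sub>2}),
           (Sub {m\<^sub>3}, Span {m\<^sub>t\<^sub>o\<^sub>p})}
          \<union> {(Sub Q, Sub {w}) | w. w \<in> ws}
          \<union> {(Sub {w}, Sub {m\<^sub>2}) | w. w \<in> ws};
        Edges_L =
          {(N, Sub Q),
           (Sub P, Sub (Span {m\<^sub>3, m\<^sub>2})),
           (Sub (Span {m\<^sub>3, m\<^sub>2}), Sub {m\<^sub>3}),
           (Sub {m\<^sub>2}, Span {m\<^sub>t\<^sub>o\<^sub>p})}
          \<union> {(Sub P, Sub {v}) | v. v \<in> vs}
          \<union> {(Sub {v}, Sub {m\<^sub>3}) | v. v \<in> vs}
    in S = {N, Sub P, Sub Q, Sub (Span {m\<^sub>3, m\<^sub>2}), Sub {m\<^sub>3}, Sub {m\<^sub>2}, Span {m\<^sub>t\<^sub>o\<^sub>p}}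
             \<union> {Sub {v} | v. v \<in> vs} \<union> {Sub {w} | w. w \<in> ws}
     \<and> covering_pairs S = Edges_k \<union> Edges_L
     \<and> (\<forall>(Y, Z)\<in>Edges_k. module_isomorphic A (subquotient M Y Z) (k_module t12))
     \<and> (\<forall>(Y, Z)\<in>Edges_L. module_isomorphic A (subquotient M Y Z) (L_module a))
     \<and> (\<forall>v\<in>vs. \<forall>v\<^sub>1\<in>vs. Sub {v} = Sub {v\<^sub>1} \<longleftrightarrow> v \<in> Span {v\<^sub>1})
     \<and> (\<forall>w\<in>ws. \<forall>w\<^sub>1\<in>ws. Sub {w} = Sub {w\<^sub>1} \<longleftrightarrow> w \<in> Span {w\<^sub>1})"
proof -
  interpret special_param a using assms(2,3) by unfold_locales
  define F where "F n = node_image n" for n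
  let ?Sub = "generated_submodule (alg a) M"
  let ?vs = "(\<lambda>(x, y). verma_of_vec (pair_vec Vr Mr x y)) ` {(x, y). x \<noteq> 0}"
  let ?ws = "(\<lambda>(x, y). verma_of_vec (pair_vec W W' x y)) ` {(x, y). x \<noteq> 0}"
  \<comment> \<open>The function \<open>f\<close> is arbitrary because the submodules generated by
    the \<open>v\<close> occur in three roles: as elements of the lattice, as lower ends and as
    upper ends of edges.\<close>
  have vs: "(\<lambda>v. f (?Sub {v})) ` ?vs = range (\<lambda>k. f (F (NV k)))" for f :: "_ \<Rightarrow> 'z"
  proof (intro equalityI subsetI)
    fix y assume "y \<in> range (\<lambda>k. f (F (NV k)))"
    then obtain k where "y = f (F (NV k))" by blast
    \<comment> \<open>The vector with coordinates \<open>(1, k)\<close> represents the slope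
      \<open>k\<close>.\<close>
    then have "y = f (?Sub {verma_of_vec (pair_vec Vr Mr 1 k)})" by (simp add: generated_line_V F_def)
    then show "y \<in> (\<lambda>v. f (?Sub {v})) ` ?vs" by force
  qed (auto simp: generated_line_V F_def)
  have ws: "(\<lambda>w. f (?Sub {w})) ` ?ws = range (\<lambda>k. f (F (NW k)))" for f :: "_ \<Rightarrow> 'z"
  proof (intro equalityI subsetI)
    fix y assume "y \<in> range (\<lambda>k. f (F (NW k)))"
    then obtain k where "y = f (F (NW k))" by blast
    then have "y = f (?Sub {verma_of_vec (pair_vec W W' 1 k)})" by (simp add: generated_line_W F_def)
    then show "y \<in> (\<lambda>w. f (?Sub {w})) ` ?ws" by force
  qed (auto simp: generated_line_W F_def)
  have range_F: "range F = {F NN, F NP, F NQ, F NPQ, F N3, F N2, F NT} \<union> range (\<lambda>k. F (NV k)) \<union> range (\<lambda>k. F (NW k))"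
  proof -
    have "n \<in> {NN, NP, NQ, NPQ, N3, N2, NT} \<union> range NV \<union> range NW" for n :: "'k node"
      by (cases n) auto
    then have "(UNIV :: 'k node set) = {NN, NP, NQ, NPQ, N3, N2, NT} \<union> range NV \<union> range NW" by blast
    then have "range F = F ` ({NN, NP, NQ, NPQ, N3, N2, NT} \<union> range NV \<union> range NW)" by (simp only:)
    then show ?thesis by (simp only: image_Un image_insert image_empty image_image)
  qed
  let ?k = "{(F NN, F NP), (F NQ, F NPQ), (F NPQ, F N2), (F N3, F NT)}
    \<union> range (\<lambda>k. (F NQ, F (NW k))) \<union> range (\<lambda>k. (F (NW k), F N2))"
  let ?L = "{(F NN, F NQ), (F NP, F NPQ), (F NPQ, F N3), (F N2, F NT)}
    \<union> range (\<lambda>k. (F NP, F (NV k))) \<union> range (\<lambda>k. (F (NV k), F N3))"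
  have k: "?k = (\<lambda>(m, n). (F m, F n)) ` k_edges" and L: "?L = (\<lambda>(m, n). (F m, F n)) ` L_edges"
    by (simp_all add: k_edges_def L_edges_def image_Un image_image)
  have cover: "covering_pairs (range F) = ?k \<union> ?L"
    unfolding k L using covering_pairs_node_set[OF inj_verma_of_vec] by (simp add: F_def[abs_def] image_Un)
  have k_iso: "\<forall>(Y, Z)\<in>?k. module_isomorphic (alg a) (subquotient M Y Z) (k_module t12)"
    unfolding k using k_edge_isomorphic by (auto simp: F_def)
  have L_iso: "\<forall>(Y, Z)\<in>?L. module_isomorphic (alg a) (subquotient M Y Z) (L_module a)"
    unfolding L using L_edge_isomorphic by (auto simp: F_def)
  have vs_eq: "\<forall>v\<in>?vs. \<forall>v\<^sub>1\<in>?vs. ?Sub {v} = ?Sub {v\<^sub>1} \<longleftrightarrow> v \<in> linear_span a M {v\<^sub>1}"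
    by (auto simp: generated_line_V node_image_eq_iff mem_linear_span_pair simp del: node_set.simps)
  have ws_eq: "\<forall>w\<in>?ws. \<forall>w\<^sub>1\<in>?ws. ?Sub {w} = ?Sub {w\<^sub>1} \<longleftrightarrow> w \<in> linear_span a M {w\<^sub>1}"
    by (auto simp: generated_line_W node_image_eq_iff mem_linear_span_pair simp del: node_set.simps)
  have neq: "Vr \<noteq> Mr" "W \<noteq> W'" by simp_all
  show ?thesis
    unfolding Let_def weight_spaces verma_vec_eq_verma_of_vec generated_submodules[folded F_def]
      linear_span_Top[folded F_def] complements[OF neq(1)] complements[OF neq(2)] Collect_mem_eq
      proper_submodules[folded F_def] setcompr_eq_image
      vs[of "\<lambda>U. U"] vs[of "Pair (F NP)"] vs[of "\<lambda>U. (U, F N3)"]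
      ws[of "\<lambda>U. U"] ws[of "Pair (F NQ)"] ws[of "\<lambda>U. (U, F N2)"]
    by (intro conjI range_F cover k_iso L_iso vs_eq ws_eq)
qed

end
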